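(* Let $\kappa$ be an uncountable regular cardinal and let $\mathcal{I}$ be a $\kappa$-complete proper ideal on $\kappa$ containing every bounded subset of $\kappa$. Let $\nu\in\{2,\kappa\}$. Then the $\mathcal{I}$-Borel hierarchy on ${}^{\kappa}\nu$ does not collapse: for every ordinal $\alpha$ with $1\le\alpha<\kappa^+$ we have $\boldsymbol{\Sigma}^0_\alpha({}^{\kappa}\nu,\tau_{\mathcal{I}})\neq \mathcal{I}\text{-}\mathbf{Bor}({}^{\kappa}\nu)$. Hence the hierarchy has length $\kappa^+$, both for ${}^{\kappa}2$ and for ${}^{\kappa}\kappa$.
   Context: Work in ZFC. For $\nu\in\{2,\kappa\}$, ${}^{\kappa}\nu$ is the set of all functions $\kappa\to\nu$. Let $\mathrm{Fn}_{\mathcal{I}}({}^{\kappa}\nu)$ be the set of functions $f\colon D\to\nu$ with $D\in\mathcal{I}$, and for such $f$ let $\mathbf{N}_f=\{x\in{}^{\kappa}\nu: f\subseteq x\}$. The $\mathcal{I}$-topology $\tau_{\mathcal{I}}$ on ${}^{\kappa}\nu$ is the topology generated by the sets $\mathbf{N}_f$, $f\in\mathrm{Fn}_{\mathcal{I}}({}^{\kappa}\nu)$. $\mathcal{I}\text{-}\mathbf{Bor}({}^{\kappa}\nu)$ is the smallest family of subsets of ${}^{\kappa}\nu$ containing $\tau_{\mathcal{I}}$ and closed under complements and unions of at most $\kappa$ sets. The hierarchy is defined by recursion on $\alpha\ge1$: $\boldsymbol{\Sigma}^0_1$ = the $\tau_{\mathcal{I}}$-open sets, $\boldsymbol{\Pi}^0_1$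 = the $\tau_{\mathcal{I}}$-closed sets; for $\alpha>1$, $\boldsymbol{\Sigma}^0_\alpha$ consists of all unions $\bigcup_{\gamma<\kappa}A_\gamma$ with each $A_\gamma\in\bigcup_{1\le\beta<\alpha}\boldsymbol{\Pi}^0_\beta$, and $\boldsymbol{\Pi}^0_\alpha$ consists of the complements of sets in $\boldsymbol{\Sigma}^0_\alpha$. The hierarchy is said to collapse if $\min\{\alpha:\boldsymbol{\Sigma}^0_\alpha({}^{\kappa}\nu,\tau_{\mathcal{I}})=\mathcal{I}\text{-}\mathbf{Bor}({}^{\kappa}\nu)\}<\kappa^+$. *)

theory Defs
  imports Complex_Main "HOL-Library.Countable_Set"
begin

text \<open>The cardinal kappa is represented by a type 'k carrying a cardinal order r
  with Field r = UNIV; ordinals below kappa are the elements of 'k.\<close>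

definition proper_ideal_on :: "'k set set \<Rightarrow> bool" where
  "proper_ideal_on I \<longleftrightarrow> {} \<in> I \<and> (\<forall>A B. A \<in> I \<and> B \<subseteq> A \<longrightarrow> B \<in> I)
     \<and> (\<forall>A B. A \<in> I \<and> B \<in> I \<longrightarrow> A \<union> B \<in> I) \<and> UNIV \<notin> I"

definition kappa_complete :: "'k rel \<Rightarrow> 'k set set \<Rightarrow> bool" where
  "kappa_complete r I \<longleftrightarrow> (\<forall>X. X \<subseteq> I \<and> (card_of X, r) \<in> ordLess \<longrightarrow> \<Union>X \<in> I)"

definition bounded_in :: "'k rel \<Rightarrow> 'k set \<Rightarrow> bool" where
  "bounded_in r A \<longleftrightarrow> (\<exists>b. A \<subseteq> under r b)"

text \<open>Basic open sets N_f for f : D \<rightarrow> nu with D \<in> I (f given as restriction of y to D).\<close>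
definition I_basis :: "'k set set \<Rightarrow> ('k \<Rightarrow> 'v) set set" where
  "I_basis I = {{x. \<forall>d\<in>D. x d = y d} | D y. D \<in> I}"

definition I_open :: "'k set set \<Rightarrow> ('k \<Rightarrow> 'v) set \<Rightarrow> bool" where
  "I_open I = generate_topology (I_basis I)"

inductive I_Borel :: "'k set set \<Rightarrow> ('k \<Rightarrow> 'v) set \<Rightarrow> bool" for I where
  Open: "I_open I A \<Longrightarrow> I_Borel I A"
| Compl: "I_Borel I A \<Longrightarrow> I_Borel I (- A)"
| Union: "(\<And>g. I_Borel I (F g)) \<Longrightarrow> I_Borel I (\<Union>g. F (g::'k))"

text \<open>Ordinals are represented as elements of the field of a well-order W
  (the ordinal of a is the order type of its strict initial segment).
  ord_pos W a: the ordinal of a is \<ge> 1; ord_one W a: the ordinal of a is 1.\<close>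
definition ord_pos :: "'o rel \<Rightarrow> 'o \<Rightarrow> bool" where
  "ord_pos W a \<longleftrightarrow> a \<in> Field W \<and> (\<exists>b. (b, a) \<in> W \<and> b \<noteq> a)"

definition ord_one :: "'o rel \<Rightarrow> 'o \<Rightarrow> bool" where
  "ord_one W a \<longleftrightarrow> ord_pos W a \<and> (\<forall>b. (b, a) \<in> W \<and> b \<noteq> a \<longrightarrow> \<not> ord_pos W b)"

inductive I_Sigma :: "'k set set \<Rightarrow> 'o rel \<Rightarrow> 'o \<Rightarrow> ('k \<Rightarrow> 'v) set \<Rightarrow> bool"
  for I W where
  One: "ord_one W a \<Longrightarrow> I_open I A \<Longrightarrow> I_Sigma I W a A"
| Union: "ord_pos W a \<Longrightarrow> \<not> ord_one W a \<Longrightarrow>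
     (\<And>g. \<exists>b. ord_pos W b \<and> (b, a) \<in> W \<and> b \<noteq> a \<and> I_Sigma I W b (- F (g::'k)))
     \<Longrightarrow> I_Sigma I W a (\<Union>g. F g)"

end

(*
Identify points of 2^kappa with subsets x of kappa, and fix a rank a < kappa^+. The tree of all
finite sequences whose ranks descend from a carries, at every node l and every i < kappa, a leaf
(l, i). A point sends each leaf a list of True/False messages, and the last one is the value of
the leaf. A node is false if one of its leaves or children is true, and the set S of the points
making the root true is I-Borel. It is not Sigma_a: otherwise a forcing argument with conditions
that freeze fewer than kappa leaves and promise some nodes to be false yields a kappa-sequence of
conditions deciding a Sigma_a code of S, whereas by induction on the rank such a code cannot
follow the value of a node that a condition leaves free ("capture").

What remains is a way of sending messages that survives limits of kappa many stages. If there are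
kappa many disjoint I-positive sets B_j, a point tells the message j by meeting B_j. Otherwise I
is kappa-saturated; below a suitable I-positive set there is a function h which is incompressible,
so that null sets are closed under diagonal unions along h. Stationarity with respect to h then
provides a family of null, stationary, almost disjoint sets ("events") which no single null set
covers. An event occurs in x if it meets x in a stationary set, and messages are read off the
order type of the occurring events between two coloured ones.
*)
theory Submission imports Defs begin

section \<open>Regular cardinals and complete ideals\<close>

unbundle cardinal_syntax

text \<open>The forcing has to meet \<kappa> many requirements, since a code may have \<kappa> many
  subcodes, but it is closed only under shorter limits: a union of \<kappa> many null sets need not
  be null. So an open set containing the limit point x may be witnessed by a null set that no
  condition of the sequence covers. \<open>G_local\<close> then turns a restriction of x itself into
  a condition. Such a condition may tell \<kappa> many messages at once, which explains why a
  message can be overruled by one of higher level and why a condition assigns values only to its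
  frozen leaves. \<open>Ok_final\<close> in turn admits only limits in which every point entered
  early with respect to \<open>h\<close>, so that diagonal unions can replace unions.\<close>

definition small :: "'k rel \<Rightarrow> 'a set \<Rightarrow> bool" where
  "small r S \<longleftrightarrow> |S| <o r"

lemma small_subset: "small r T \<Longrightarrow> S \<subseteq> T \<Longrightarrow> small r S"
  unfolding small_def by (rule ordLeq_ordLess_trans[OF card_of_mono1])

lemma small_image: "small r S \<Longrightarrow> small r (f ` S)"
  unfolding small_def by (rule ordLeq_ordLess_trans[OF card_of_image])

lemma small_inj:
  assumes "inj_on f S" "f ` S \<subseteq> T" "small r T"
  shows "small r S"
proof -
  have "|S| \<le>o |T|" using assms(1,2) card_of_ordLeq[of S T] by auto
  then show ?thesis using assms(3) ordLeq_ordLess_trans unfolding small_def by auto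
qed

locale reg_card =
  fixes r :: "'k rel"
  assumes card_order_r: "Card_order r" and Field_r: "Field r = UNIV" and regular_r: "regularCard r"
    and uncountable_UNIV: "uncountable (UNIV :: 'k set)"
begin

definition lt :: "'k \<Rightarrow> 'k \<Rightarrow> bool" (infix "\<prec>" 50) where "a \<prec> b \<longleftrightarrow> (a, b) \<in> r \<and> a \<noteq> b"

lemma well_order_r: "Well_order r"
  using card_order_r card_order_on_def by blast

lemma lt_trans [trans]: assumes "a \<prec> b" "b \<prec> c" shows "a \<prec> c"
proof -
  have "trans r" "antisym r"
    using well_order_r unfolding well_order_on_def linear_order_on_def partial_order_on_def preorder_on_def
    by auto
  then show ?thesis using assms unfolding lt_def by (meson transD antisymD)
qed

lemma lt_irrefl [simp]: "\<not> a \<prec> a"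
  unfolding lt_def by blast

lemma lt_asym: "a \<prec> b \<Longrightarrow> \<not> b \<prec> a"
  using lt_trans lt_irrefl by blast

lemma lt_linear: "a \<prec> b \<or> a = b \<or> b \<prec> a"
proof -
  have "total_on UNIV r" using well_order_r Field_r unfolding well_order_on_def linear_order_on_def by simp
  then show ?thesis unfolding lt_def by (auto simp: total_on_def)
qed

lemma wf_lt: "wf {(a, b). a \<prec> b}"
proof -
  have "{(a, b). a \<prec> b} = r - Id" unfolding lt_def by auto
  then show ?thesis using well_order_r unfolding well_order_on_def by simp
qed

lemma lt_induct [consumes 0, case_names less]: "(\<And>a. (\<And>b. b \<prec> a \<Longrightarrow> P b) \<Longrightarrow> P a) \<Longrightarrow> P a"
  using wf_induct[OF wf_lt, of P a] by blast

lemma lt_least: "P a \<Longrightarrow> \<exists>m. P m \<and> (\<forall>b. b \<prec> m \<longrightarrow> \<not> P b)"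
  using wfE_min[OF wf_lt, of a "Collect P"] by auto

lemma infinite_r: "\<not> finite (Field r)"
  unfolding Field_r using uncountable_UNIV countable_finite by blast

lemma infinite_UNIV_k: "infinite (UNIV :: 'k set)"
  using infinite_r unfolding Field_r .

lemma Cinfinite_r: "Cinfinite r"
  using infinite_r card_order_r Field_r unfolding cinfinite_def by simp

lemma card_UNIV_r: "|UNIV :: 'k set| =o r"
  using card_of_Field_ordIso[OF card_order_r] Field_r by simp

lemma not_small_UNIV: "\<not> small r (UNIV :: 'k set)"
  unfolding small_def using not_ordLess_ordIso[of "|UNIV :: 'k set|" r] card_UNIV_r by auto

lemma small_iff: "small r S \<longleftrightarrow> \<not> |UNIV :: 'k set| \<le>o |S|"
proof
  assume "small r S"
  then have "|S| <o |UNIV :: 'k set|"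
    unfolding small_def by (rule ordLess_ordIso_trans[OF _ ordIso_symmetric[OF card_UNIV_r]])
  then show "\<not> |UNIV :: 'k set| \<le>o |S|" by (rule not_ordLess_ordLeq)
next
  assume "\<not> |UNIV :: 'k set| \<le>o |S|"
  then have "|S| <o |UNIV :: 'k set|"
    using not_ordLeq_iff_ordLess[OF card_of_Well_order card_of_Well_order] by auto
  then show "small r S" unfolding small_def by (rule ordLess_ordIso_trans[OF _ card_UNIV_r])
qed

lemma not_smallD: "\<not> small r S \<Longrightarrow> \<exists>f :: 'k \<Rightarrow> 'a. inj f \<and> range f \<subseteq> S"
  unfolding small_iff using card_of_ordLeq[of "UNIV :: 'k set" S] by auto

text \<open>Uncountability makes \<kappa>-complete ideals countably complete;
  \<open>wf_below_mod\<close> rests on this.\<close>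

lemma small_countable: assumes "countable S" shows "small r S"
proof (rule ccontr)
  assume "\<not> small r S"
  then obtain f :: "'k \<Rightarrow> 'a" where f: "inj f" "range f \<subseteq> S" using not_smallD[of S] by auto
  have "countable (UNIV :: 'k set)"
    using countable_image_inj_on[OF countable_subset[OF f(2) assms] f(1)] .
  then show False using uncountable_UNIV by simp
qed

lemma small_finite: "finite S \<Longrightarrow> small r S"
  by (rule small_countable[OF countable_finite])

lemma small_UN: "small r S \<Longrightarrow> (\<And>a. a \<in> S \<Longrightarrow> small r (F a)) \<Longrightarrow> small r (\<Union>a\<in>S. F a)"
  using card_of_UNION_ordLess_infinite_Field_regularCard[OF regular_r Cinfinite_r, of S F]
  unfolding small_def by auto

lemma small_Un: "small r S \<Longrightarrow> small r T \<Longrightarrow> small r (S \<union> T)"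
  using card_of_Un_ordLess_infinite_Field[OF infinite_r card_order_r, of S T] unfolding small_def by auto

lemma small_insert: "small r S \<Longrightarrow> small r (insert a S)"
  using small_Un[of "{a}" S] small_finite[of "{a}"] by simp

lemma small_below: "small r {b. b \<prec> a}"
proof -
  have "{b. b \<prec> a} = underS r a" unfolding lt_def underS_def by auto
  then show ?thesis using card_of_underS[OF card_order_r] Field_r unfolding small_def by simp
qed

lemma small_upto: "small r {b. b \<prec> a \<or> b = a}"
  using small_insert[OF small_below[of a], of a] by (rule small_subset) auto

lemma small_bounded:
  assumes "small r (S :: 'k set)"
  shows "\<exists>b. \<forall>s\<in>S. s \<prec> b"
proof -
  have le: "\<exists>b. \<forall>s\<in>T. s \<prec> b \<or> s = b" if "small r T" for T :: "'k set"
  proof -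
    have "\<not> |T| =o r" using that not_ordLess_ordIso[of "|T|" r] unfolding small_def by auto
    then have "\<not> cofinal T r" using regular_r Field_r unfolding regularCard_def by auto
    then obtain a where "\<forall>b\<in>T. \<not> (a \<noteq> b \<and> (a, b) \<in> r)" unfolding cofinal_def by blast
    then have "\<not> a \<prec> s" if "s \<in> T" for s using that unfolding lt_def by blast
    then have "\<forall>s\<in>T. s \<prec> a \<or> s = a" using lt_linear by blast
    then show ?thesis by blast
  qed
  obtain b where b: "\<forall>s\<in>S. s \<prec> b \<or> s = b" using le[OF assms] by blast
  \<comment> \<open>Non-cofinality only yields a weak bound; a strict one exists because \<kappa>
    has no largest element.\<close>
  have "\<exists>c. b \<prec> c"
  proof (rule ccontr)
    assume "\<not> ?thesis"
    then have "UNIV \<subseteq> {c. c \<prec> b \<or> c = b}" using lt_linear by blast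
    then show False using not_small_UNIV small_subset[OF small_upto[of b], of UNIV] by auto
  qed
  then show ?thesis using b lt_trans by blast
qed

lemma ex_above: "\<exists>b. a \<prec> b"
  using small_bounded[OF small_finite, of "{a}"] by auto

lemma small_nonempty_Compl: "small r S \<Longrightarrow> \<exists>a::'k. a \<notin> S"
  using not_small_UNIV small_subset[of r S UNIV] by auto

lemma ex_two: "\<exists>c d :: 'k. c \<noteq> d"
proof -
  obtain b where "undefined \<prec> b" using ex_above by auto
  then show ?thesis unfolding lt_def by auto
qed

section \<open>Coding pairs, sums and finite sequences by elements of \<kappa>\<close>

lemma ex_surj_on:
  assumes "|A| \<le>o |UNIV :: 'k set|" "A \<noteq> {}"
  shows "\<exists>f :: 'k \<Rightarrow> 'a. range f = A"
  using card_of_ordLeq2[of A "UNIV :: 'k set"] assms by auto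

lemma inj_prod: "\<exists>f :: 'k \<times> 'k \<Rightarrow> 'k. inj f"
proof -
  have "|(UNIV :: 'k set) \<times> (UNIV :: 'k set)| \<le>o |UNIV :: 'k set|"
    by (rule ordIso_imp_ordLeq[OF card_of_Times_same_infinite[OF infinite_UNIV_k]])
  then have "\<exists>f. inj_on f ((UNIV :: 'k set) \<times> (UNIV :: 'k set)) \<and> f ` (UNIV \<times> UNIV :: ('k \<times> 'k) set) \<subseteq> (UNIV :: 'k set)"
    by (rule iffD2[OF card_of_ordLeq])
  then show ?thesis by (simp add: UNIV_Times_UNIV)
qed

lemma inj_list: "\<exists>f :: 'k list \<Rightarrow> 'k. inj f"
proof -
  from inj_prod obtain p :: "'k \<times> 'k \<Rightarrow> 'k" where p: "inj p" ..
  obtain c d :: 'k where cd: "c \<noteq> d" using ex_two by blast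
  define e where "e = rec_list (p (d, d)) (\<lambda>x _ y. p (c, p (x, y)))"
  have e: "e [] = p (d, d)" "e (x # xs) = p (c, p (x, e xs))" for x xs unfolding e_def by auto
  have "e xs = e ys \<Longrightarrow> xs = ys" for xs ys
  proof (induction xs arbitrary: ys)
    case Nil then show ?case using cd by (cases ys) (auto simp: e inj_eq[OF p])
  next
    case (Cons x xs)
    then show ?case using cd by (cases ys) (auto simp: e inj_eq[OF p])
  qed
  then have "inj e" by (rule injI)
  then show ?thesis by (rule exI[of _ e])
qed

lemma inj_node: "\<exists>f :: ('k \<times> 'k) list \<Rightarrow> 'k. inj f"
proof -
  from inj_prod obtain p :: "'k \<times> 'k \<Rightarrow> 'k" where p: "inj p" ..
  from inj_list obtain e :: "'k list \<Rightarrow> 'k" where e: "inj e" ..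
  have "inj (e \<circ> map p)" using p e by (simp add: inj_compose)
  then show ?thesis by (rule exI[of _ "e \<circ> map p"])
qed

lemma inj_pair:
  assumes "inj (f :: 'a \<Rightarrow> 'k)" "inj (g :: 'b \<Rightarrow> 'k)"
  shows "\<exists>h :: 'a \<times> 'b \<Rightarrow> 'k. inj h"
proof -
  from inj_prod obtain p :: "'k \<times> 'k \<Rightarrow> 'k" where p: "inj p" ..
  have "inj (\<lambda>z. p (f (fst z), g (snd z)))"
    by (rule injI) (simp add: inj_eq[OF p] inj_eq[OF assms(1)] inj_eq[OF assms(2)] prod_eq_iff)
  then show ?thesis by (rule exI[of _ "\<lambda>z. p (f (fst z), g (snd z))"])
qed

lemma inj_sum:
  assumes "inj (f :: 'a \<Rightarrow> 'k)" "inj (g :: 'b \<Rightarrow> 'k)"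
  shows "\<exists>h :: 'a + 'b \<Rightarrow> 'k. inj h"
proof -
  from inj_prod obtain p :: "'k \<times> 'k \<Rightarrow> 'k" where p: "inj p" ..
  obtain c d :: 'k where cd: "c \<noteq> d" using ex_two by blast
  define h where "h = case_sum (\<lambda>x. p (c, f x)) (\<lambda>y. p (d, g y))"
  have "h s = h t \<Longrightarrow> s = t" for s t
    using cd unfolding h_def
    by (cases s; cases t) (simp_all add: inj_eq[OF p] inj_eq[OF assms(1)] inj_eq[OF assms(2)])
  then have "inj h" by (rule injI)
  then show ?thesis by (rule exI[of _ h])
qed

lemma inj_bool: "\<exists>h :: bool \<Rightarrow> 'k. inj h"
proof -
  obtain c d :: 'k where cd: "c \<noteq> d" using ex_two by blast
  have "inj (\<lambda>b. if b then c else d)"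
    by (rule injI) (simp add: cd cd[symmetric] split: if_splits)
  then show ?thesis by (rule exI[of _ "\<lambda>b. if b then c else d"])
qed

lemma surj_of_inj: "inj (f :: 'a \<Rightarrow> 'k) \<Longrightarrow> \<exists>g :: 'k \<Rightarrow> 'a. surj g"
  by (rule exI[of _ "inv f"]) (rule inj_imp_surj_inv)

text \<open>Enumerating pairs of a task and an element of \<kappa> lists each task \<kappa> times,
  and \<kappa> many positions cannot all lie below one bound. Repetition matters because promises
  made later need treatment too.\<close>

lemma cofinal_enumeration:
  assumes "inj (f :: 'a \<Rightarrow> 'k)"
  shows "\<exists>g :: 'k \<Rightarrow> 'a. \<forall>t k. \<exists>k'. k \<prec> k' \<and> g k' = t"
proof -
  from inj_pair[OF assms inj_on_id] obtain e :: "'a \<times> 'k \<Rightarrow> 'k" where e: "inj e" ..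
  from surj_of_inj[OF e] obtain g :: "'k \<Rightarrow> 'a \<times> 'k" where g: "surj g" ..
  have "\<exists>k'. k \<prec> k' \<and> fst (g k') = t" for t k
  proof (rule ccontr)
    assume *: "\<not> ?thesis"
    have "y \<in> (\<lambda>k. snd (g k)) ` {k'. k' \<prec> k \<or> k' = k}" for y
    proof -
      obtain k' where k': "g k' = (t, y)" using surjD[OF g, of "(t, y)"] by metis
      then have "k' \<prec> k \<or> k' = k" using * lt_linear[of k k'] by auto
      then show ?thesis using k' by (intro image_eqI[of _ _ k']) auto
    qed
    then have "(UNIV :: 'k set) \<subseteq> (\<lambda>k. snd (g k)) ` {k'. k' \<prec> k \<or> k' = k}" by blast
    then show False using small_subset[OF small_image[OF small_upto]] not_small_UNIV by blast
  qed
  then show ?thesis by (intro exI[of _ "\<lambda>k. fst (g k)"]) simp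
qed

end

section \<open>\<kappa>-complete proper ideals containing the singletons\<close>

locale ideal_on = reg_card r for r :: "'k rel" +
  fixes J :: "'k set set"
  assumes J_subset: "A \<in> J \<Longrightarrow> B \<subseteq> A \<Longrightarrow> B \<in> J"
    and J_Union: "small r X \<Longrightarrow> X \<subseteq> J \<Longrightarrow> \<Union>X \<in> J"
    and J_proper: "UNIV \<notin> J"
    and J_singleton: "{k} \<in> J"
begin

lemma J_empty: "{} \<in> J" using J_subset[OF J_singleton] by blast

lemma J_UN: "small r S \<Longrightarrow> (\<And>a. a \<in> S \<Longrightarrow> F a \<in> J) \<Longrightarrow> (\<Union>a\<in>S. F a) \<in> J"
  using J_Union[of "F ` S"] small_image by blast

lemma J_Un: "A \<in> J \<Longrightarrow> B \<in> J \<Longrightarrow> A \<union> B \<in> J"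
  using J_Union[of "{A, B}"] small_finite[of "{A, B}"] by simp

end

section \<open>Conditions, codes and forcing\<close>

type_synonym 'k node = "('k \<times> 'k) list"
type_synonym 'k leaf = "'k node \<times> 'k"

section \<open>The ranked tree and partial evaluation of its nodes\<close>

locale ord_tree =
  fixes W :: "'o rel" and a :: 'o and u :: "'k \<Rightarrow> 'o"
  assumes wf_W: "wf (W - Id)" and trans_W: "trans W"
    and u_surj: "(b, a) \<in> W \<Longrightarrow> b \<noteq> a \<Longrightarrow> \<exists>j. u j = b"
begin

text \<open>The step taken last is the head of the list, so the ancestors of a node are its
  suffixes.\<close>

definition rk :: "'k node \<Rightarrow> 'o" where
  "rk l = (case l of [] \<Rightarrow> a | x # _ \<Rightarrow> u (fst x))"

text \<open>The index \<open>i\<close> does not affect the rank. It supplies \<kappa> many copies of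
  every child, so that an untouched copy can always be found. Ranks start at 1, hence a node of rank
  1 has leaves only.\<close>

definition child :: "'k node \<Rightarrow> 'k node \<Rightarrow> bool" where
  "child c l \<longleftrightarrow> (\<exists>j i. c = (j, i) # l \<and> ord_pos W (u j) \<and> (u j, rk l) \<in> W \<and> u j \<noteq> rk l)"

text \<open>Partial evaluation: \<open>N\<close> holds nodes promised false, \<open>P\<close> and
  \<open>Q\<close> leaves known to be true and false; a node may receive no value. With
  \<open>N\<close> empty and \<open>Q\<close> the complement of \<open>P\<close> it is the
  evaluation at a point.\<close>

inductive tv :: "'k node set \<Rightarrow> 'k leaf set \<Rightarrow> 'k leaf set \<Rightarrow> 'k node \<Rightarrow> bool \<Rightarrow> bool" for N P Q where
  node: "l \<in> N \<Longrightarrow> tv N P Q l False"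
| leaf: "(l, i) \<in> P \<Longrightarrow> tv N P Q l False"
| child: "child c l \<Longrightarrow> tv N P Q c True \<Longrightarrow> tv N P Q l False"
| all: "(\<And>i. (l, i) \<in> Q) \<Longrightarrow> (\<And>c. child c l \<Longrightarrow> tv N P Q c False) \<Longrightarrow> tv N P Q l True"

lemma rank_induct: "(\<And>l. (\<And>c. child c l \<Longrightarrow> X c) \<Longrightarrow> X l) \<Longrightarrow> X l"
proof -
  assume step: "\<And>l. (\<And>c. child c l \<Longrightarrow> X c) \<Longrightarrow> X l"
  have "wf (inv_image (W - Id) rk)" using wf_W by (rule wf_inv_image)
  then show "X l"
  proof (induction l)
    case (less l)
    show ?case
    proof (rule step)
      fix c assume "child c l"
      then have "(c, l) \<in> inv_image (W - Id) rk" by (auto simp: child_def rk_def)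
      then show "X c" by (rule less)
    qed
  qed
qed

lemma tv_mono:
  assumes "tv N P Q l e" "\<And>l. l \<in> N \<Longrightarrow> tv N' P' Q' l False" "P \<subseteq> P'" "Q \<subseteq> Q'"
  shows "tv N' P' Q' l e"
  using assms(1)
proof induction
  case (node l) then show ?case by (rule assms(2))
next
  case (leaf l i) then show ?case using assms(3) by (blast intro: tv.leaf)
next
  case (child c l) then show ?case by (blast intro: tv.child)
next
  case (all l) then show ?case using assms(4) by (blast intro: tv.all)
qed

text \<open>The value of \<open>l\<close> depends only on data at \<open>l\<close> and below. If
  \<open>l\<close> is not on the path from \<open>t\<close> to the root, nothing below
  \<open>l\<close> is either, so promises on that path may be dropped without changing the
  value.\<close>

lemma tv_off_path:
  assumes "tv N P Q l e" "\<nexists>m. t = m @ l"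
    "\<And>n. n \<in> N \<Longrightarrow> \<nexists>m. t = m @ n \<Longrightarrow> n \<in> N'" "P \<subseteq> P'"
    "\<And>n i. (n, i) \<in> Q \<Longrightarrow> \<nexists>m. t = m @ n \<Longrightarrow> (n, i) \<in> Q'"
  shows "tv N' P' Q' l e"
  using assms(1,2)
proof induction
  case (node l) then show ?case using assms(3) by (blast intro: tv.node)
next
  case (leaf l i) then show ?case using assms(4) by (blast intro: tv.leaf)
next
  case (child c l)
  have "\<nexists>m. t = m @ c"
  proof
    assume "\<exists>m. t = m @ c"
    then obtain m where "t = m @ c" by blast
    moreover obtain x where "c = x # l" using child.hyps(1) child_def by blast
    ultimately have "t = (m @ [x]) @ l" by simp
    then show False using child.prems by blast
  qed
  then show ?case using child by (blast intro: tv.child)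
next
  case (all l)
  show ?case
  proof (rule tv.all)
    show "(l, i) \<in> Q'" for i using all assms(5) by blast
    fix c assume c: "child c l"
    have "\<nexists>m. t = m @ c"
    proof
      assume "\<exists>m. t = m @ c"
      then obtain m where "t = m @ c" by blast
      moreover obtain x where "c = x # l" using c child_def by blast
      ultimately have "t = (m @ [x]) @ l" by simp
      then show False using all.prems by blast
    qed
    then show "tv N' P' Q' c False" using all.IH c by blast
  qed
qed

lemma tv_exclusive: "\<not> (tv {} Y (- Y) l True \<and> tv {} Y (- Y) l False)"
proof (induction l rule: rank_induct)
  case (1 l)
  show ?case
  proof
    assume *: "tv {} Y (- Y) l True \<and> tv {} Y (- Y) l False"
    then have t: "\<And>i. (l, i) \<notin> Y" "\<And>c. child c l \<Longrightarrow> tv {} Y (- Y) c False"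
      by (auto elim: tv.cases)
    from * have "tv {} Y (- Y) l False" by simp
    then show False by cases (use t 1 in auto)
  qed
qed

end

text \<open>A condition knows the point pt on the null set dm; the leaves in fr are frozen (no further
  message will be sent to them), the nodes in nz and the leaves in lz are promised to be false.\<close>
datatype 'k cond = Cond (pt: "'k set") (dm: "'k set") (fr: "'k leaf set") (nz: "'k node set") (lz: "'k leaf set")

section \<open>Codes for the sets of the hierarchy\<close>

datatype 'k borel_code = Copen "'k set set" | Cunion "'k \<Rightarrow> 'k borel_code"

text \<open>Every \<Sigma> set of rank above 1 is a union of complements of \<Sigma> sets of smaller
  rank, so no separate codes for \<Pi> sets arise.\<close>

primrec sem :: "'k borel_code \<Rightarrow> 'k set set" where
  "sem (Copen U) = U"
| "sem (Cunion f) = (\<Union>g. - sem (f g))"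

definition open_in :: "'k set set \<Rightarrow> 'k set set \<Rightarrow> bool" where
  "open_in J U \<longleftrightarrow> (\<forall>x\<in>U. \<exists>D\<in>J. \<forall>x'. x' \<inter> D = x \<inter> D \<longrightarrow> x' \<in> U)"

inductive crank :: "'k set set \<Rightarrow> 'o rel \<Rightarrow> 'o \<Rightarrow> 'k borel_code \<Rightarrow> bool" for J W where
  one: "ord_one W b \<Longrightarrow> open_in J U \<Longrightarrow> crank J W b (Copen U)"
| union: "ord_pos W b \<Longrightarrow> \<not> ord_one W b \<Longrightarrow>
     (\<And>g. \<exists>b'. ord_pos W b' \<and> (b', b) \<in> W \<and> b' \<noteq> b \<and> crank J W b' (f g)) \<Longrightarrow> crank J W b (Cunion f)"

text \<open>The abstract transmission of messages: Theta x is the set of messages told by x, and Ok x D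
  says that fixing x on D preserves exactly these while leaving every other message available.
  The function h is only needed to keep unions of full length under control.\<close>
locale messages = ideal_on r J for r :: "'k rel" and J :: "'k set set" +
  fixes Theta :: "'k set \<Rightarrow> 'k set" and Ok :: "'k set \<Rightarrow> 'k set \<Rightarrow> bool" and G :: "'k set set" and h :: "'k \<Rightarrow> 'k"
  assumes Ok_empty: "\<exists>D. Ok {} D" and Theta_empty: "Theta {} = {}"
    and Ok_dom: "Ok x D \<Longrightarrow> x \<subseteq> D \<and> D \<in> J"
    and Theta_lock: "Ok x D \<Longrightarrow> x' \<inter> D = x \<Longrightarrow> Theta x \<subseteq> Theta x'"
    and Ok_extend: "Ok x D \<Longrightarrow> D' \<in> J \<Longrightarrow> Ok x (D \<union> D')"
    and h_fiber: "{\<xi>. h \<xi> = k} \<in> J"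
    and add_message: "Ok x D \<Longrightarrow> \<exists>x' D'. Ok x' D' \<and> D \<subseteq> D' \<and> x' \<inter> D = x \<and> Theta x' = insert m (Theta x)"
    and Ok_limit: "small r C \<Longrightarrow> C \<noteq> {} \<Longrightarrow> (\<And>x D. (x, D) \<in> C \<Longrightarrow> Ok x D) \<Longrightarrow>
        (\<And>x D x' D'. (x, D) \<in> C \<Longrightarrow> (x', D') \<in> C \<Longrightarrow>
           (D \<subseteq> D' \<and> x' \<inter> D = x) \<or> (D' \<subseteq> D \<and> x \<inter> D' = x')) \<Longrightarrow>
        Ok (\<Union>(fst ` C)) (\<Union>(snd ` C)) \<and> Theta (\<Union>(fst ` C)) \<subseteq> (\<Union>x\<in>fst ` C. Theta x)"
    and Ok_final: "(\<And>k. Ok (X k) (Y k)) \<Longrightarrow> (\<And>j k. lt j k \<Longrightarrow> Y j \<subseteq> Y k \<and> X k \<inter> Y j = X j) \<Longrightarrow>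
        (\<And>\<xi> k. \<xi> \<in> X k \<Longrightarrow> (\<forall>j. \<not> lt j (h \<xi>)) \<or> (\<exists>j. lt j (h \<xi>) \<and> \<xi> \<in> X j)) \<Longrightarrow>
        (\<Union>k. X k) \<in> G \<and> Theta (\<Union>k. X k) \<subseteq> (\<Union>k. Theta (X k))"
    and G_local: "x \<in> G \<Longrightarrow> D \<in> J \<Longrightarrow> \<exists>D'. D \<subseteq> D' \<and> Ok (x \<inter> D') D' \<and> Theta (x \<inter> D') \<subseteq> Theta x"

section \<open>Conditions, their order and the forcing relation\<close>

locale forcing = messages r J Theta Ok G h + ord_tree W a u
  for r :: "'k rel" and J Theta Ok G h and W :: "'o rel" and a and u :: "'k \<Rightarrow> 'o" +
  fixes dec :: "'k \<Rightarrow> 'k leaf \<times> 'k \<times> bool"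
  assumes surj_dec: "surj dec"
begin

definition Th :: "'k leaf \<Rightarrow> 'k set \<Rightarrow> ('k \<times> bool) set" where
  "Th i x = {(m, e). \<exists>j\<in>Theta x. dec j = (i, m, e)}"

text \<open>A message is a leaf, a level and a truth value. The message of the highest level counts;
  a leaf without a highest message, or with contradictory ones there, is false.\<close>
definition val :: "('k \<times> bool) set \<Rightarrow> bool" where
  "val s \<longleftrightarrow> (\<exists>m. (m, True) \<in> s \<and> (\<forall>m' e. (m', e) \<in> s \<longrightarrow> m' \<prec> m \<or> (m' = m \<and> e)))"

text \<open>This keeps every unfrozen leaf open: there is always a level above all those used so
  far.\<close>

definition Bd :: "'k set \<Rightarrow> bool" where
  "Bd x \<longleftrightarrow> (\<forall>i. \<exists>m. \<forall>m' e. (m', e) \<in> Th i x \<longrightarrow> m' \<prec> m)"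

definition tr :: "'k cond \<Rightarrow> 'k leaf set" where "tr p = {i \<in> fr p. val (Th i (pt p))}"
definition fa :: "'k cond \<Rightarrow> 'k leaf set" where "fa p = {i \<in> fr p. \<not> val (Th i (pt p))}"
definition qz :: "'k cond \<Rightarrow> 'k leaf set" where "qz p = lz p \<union> fa p"
definition ev :: "'k cond \<Rightarrow> 'k node \<Rightarrow> bool \<Rightarrow> bool" where "ev p = tv (nz p) (tr p) (qz p)"

text \<open>A promise on \<open>c\<close> itself does not count (\<open>m \<noteq> []\<close>). So
  promising all children of a node false leaves the children untouched, and one of these promises
  can be withdrawn later.\<close>

definition touched :: "'k node set \<Rightarrow> 'k leaf set \<Rightarrow> 'k node \<Rightarrow> bool" where
  "touched N L c \<longleftrightarrow> (\<exists>m. m \<noteq> [] \<and> m @ c \<in> N) \<or> (\<exists>m i. (m @ c, i) \<in> L)"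

text \<open>The last two clauses keep room: among the copies of a child there is an untouched one,
  and a node promised false has an unpromised leaf through which the promise can be made
  good.\<close>

definition valid :: "'k cond \<Rightarrow> bool" where
  "valid p \<longleftrightarrow> Ok (pt p) (dm p) \<and> Bd (pt p) \<and> small r (fr p) \<and> tr p \<inter> lz p = {} \<and>
     (\<forall>l j. small r {i. touched (nz p) (lz p) ((j, i) # l)}) \<and>
     (\<forall>l\<in>nz p. small r {i. (l, i) \<in> lz p})"

text \<open>A promise on a node need not be kept literally: it is enough that the node evaluates to
  false, for instance through a true leaf. Likewise a leaf promised false may meanwhile have been
  frozen false.\<close>

definition leq :: "'k cond \<Rightarrow> 'k cond \<Rightarrow> bool" where
  "leq q p \<longleftrightarrow> dm p \<subseteq> dm q \<and> pt q \<inter> dm p = pt p \<and> fr p \<subseteq> fr q \<and>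
     (\<forall>i\<in>fr p. Th i (pt q) = Th i (pt p)) \<and> (\<forall>l\<in>nz p. ev q l False) \<and> lz p \<subseteq> qz q"

text \<open>The promises \<open>nz\<close> and \<open>lz\<close> are left out on purpose: an open
  set cannot see them, and the base case of \<open>capture\<close> rests on this.\<close>

definition pts :: "'k cond \<Rightarrow> 'k set set" where
  "pts p = {x \<in> G. Bd x \<and> x \<inter> dm p = pt p \<and> (\<forall>i\<in>fr p. Th i x = Th i (pt p))}"

text \<open>This is strong forcing: a union is forced through one fixed member \<open>g\<close>, a
  complement through the absence of extensions forcing the set.\<close>

primrec forces :: "'k borel_code \<Rightarrow> 'k cond \<Rightarrow> bool" where
  "forces (Copen U) p \<longleftrightarrow> pts p \<subseteq> U"
| "forces (Cunion f) p \<longleftrightarrow> (\<exists>g. \<forall>q. valid q \<longrightarrow> leq q p \<longrightarrow> \<not> forces (f g) q)"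

lemma leq_tr: "leq q p \<Longrightarrow> tr p \<subseteq> tr q" and leq_fa: "leq q p \<Longrightarrow> fa p \<subseteq> fa q"
  unfolding leq_def tr_def fa_def by auto

lemma leq_qz: "leq q p \<Longrightarrow> qz p \<subseteq> qz q"
  using leq_fa unfolding qz_def leq_def by auto

lemma ev_mono: "leq q p \<Longrightarrow> ev p l e \<Longrightarrow> ev q l e"
  using tv_mono[of "nz p" "tr p" "qz p" l e "nz q" "tr q" "qz q"] leq_tr leq_qz
  unfolding ev_def leq_def by blast

lemma ev_node: "l \<in> nz p \<Longrightarrow> ev p l False"
  unfolding ev_def by (rule tv.node)

lemma leq_refl: "valid p \<Longrightarrow> leq p p"
  using Ok_dom unfolding leq_def valid_def qz_def by (auto simp: ev_node)

lemma leq_trans: assumes "leq s q" "leq q p" shows "leq s p"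
proof -
  have "pt s \<inter> dm p = pt s \<inter> dm q \<inter> dm p" using assms(2) unfolding leq_def by auto
  then have "pt s \<inter> dm p = pt p" using assms unfolding leq_def by auto
  moreover have "\<forall>i\<in>fr p. Th i (pt s) = Th i (pt p)" using assms unfolding leq_def by (metis subsetD)
  moreover have "\<forall>l\<in>nz p. ev s l False" using assms ev_mono unfolding leq_def by blast
  moreover have "lz p \<subseteq> qz s" using assms(2) leq_qz[OF assms(1)] unfolding leq_def by blast
  ultimately show ?thesis using assms unfolding leq_def by auto
qed

lemma pts_mono: assumes "leq q p" shows "pts q \<subseteq> pts p"
proof
  fix x assume x: "x \<in> pts q"
  have "x \<inter> dm p = x \<inter> dm q \<inter> dm p" using assms unfolding leq_def by auto
  then have "x \<inter> dm p = pt p" using assms x unfolding leq_def pts_def by auto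
  moreover have "\<forall>i\<in>fr p. Th i x = Th i (pt p)" using assms x unfolding leq_def pts_def by (auto dest: subsetD)
  ultimately show "x \<in> pts p" using x unfolding pts_def by auto
qed

lemma forces_mono: "leq q p \<Longrightarrow> forces C p \<Longrightarrow> forces C q"
  using pts_mono leq_trans by (cases C) (auto, blast)

lemma Th_subset: "Theta x \<subseteq> Theta y \<Longrightarrow> Th i x \<subseteq> Th i y"
  unfolding Th_def by auto

text \<open>A message at a level above all earlier ones overrules whatever the leaf was told, so an
  unfrozen leaf can still be given either value, subject to the promises in
  \<open>lz\<close>.\<close>

lemma freeze:
  assumes p: "valid p" and i: "i \<notin> fr p" and e: "e \<Longrightarrow> i \<notin> lz p"
  shows "\<exists>q. valid q \<and> leq q p \<and> fr q = insert i (fr p) \<and> nz q = nz p \<and> lz q = lz p \<and> (val (Th i (pt q)) \<longleftrightarrow> e)"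
proof -
  have ok: "Ok (pt p) (dm p)" using p valid_def by auto
  obtain m where m: "\<forall>m' e. (m', e) \<in> Th i (pt p) \<longrightarrow> m' \<prec> m" using p unfolding valid_def Bd_def by blast
  obtain j where j: "dec j = (i, m, e)" using surj_dec by (metis surjD)
  obtain x D where x: "Ok x D" "dm p \<subseteq> D" "x \<inter> dm p = pt p" "Theta x = insert j (Theta (pt p))"
    using add_message[OF ok] by blast
  have Th: "Th i' x = (if i' = i then insert (m, e) (Th i (pt p)) else Th i' (pt p))" for i'
    unfolding Th_def x(4) using j by auto
  define q where "q = Cond x D (insert i (fr p)) (nz p) (lz p)"
  have v: "val (Th i x) \<longleftrightarrow> e"
  proof
    assume "val (Th i x)"
    then obtain m1 where m1: "(m1, True) \<in> Th i x" "\<forall>m' e. (m', e) \<in> Th i x \<longrightarrow> m' \<prec> m1 \<or> (m' = m1 \<and> e)"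
      unfolding val_def by blast
    have "m \<prec> m1 \<or> (m = m1 \<and> e)" using m1(2) Th by simp
    moreover have "m1 = m \<and> e \<or> m1 \<prec> m" using m1(1) m Th by auto
    ultimately show e using lt_asym lt_irrefl by blast
  next
    assume e then show "val (Th i x)" unfolding val_def Th using m by auto
  qed
  have "Bd x" unfolding Bd_def
  proof
    fix i'
    show "\<exists>m. \<forall>m' e. (m', e) \<in> Th i' x \<longrightarrow> m' \<prec> m"
    proof (cases "i' = i")
      case True
      obtain m2 where m2: "m \<prec> m2" using ex_above[of m] by (rule exE)
      have "m' \<prec> m2" if "(m', e') \<in> Th i' x" for m' e'
      proof -
        have "m' = m \<or> m' \<prec> m" using that m True unfolding Th by auto
        then show ?thesis using m2 lt_trans[of m' m m2] by metis
      qed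
      then show ?thesis by (intro exI[of _ m2]) simp
    next
      case False
      have "Bd (pt p)" using p unfolding valid_def by simp
      then have "\<exists>m. \<forall>m' e. (m', e) \<in> Th i' (pt p) \<longrightarrow> m' \<prec> m" unfolding Bd_def by (rule spec)
      then show ?thesis unfolding Th if_not_P[OF False] .
    qed
  qed
  moreover have "tr q \<inter> lz q = {}"
  proof -
    have "k \<notin> lz p" if k: "k \<in> tr q" for k
    proof (cases "k = i")
      case True
      then have "val (Th i x)" using k unfolding tr_def q_def by simp
      then show ?thesis using v e True by simp
    next
      case False
      have "Th k x = Th k (pt p)" using Th[of k] False by simp
      then have "k \<in> tr p" using k False unfolding tr_def q_def by simp
      then show ?thesis using p unfolding valid_def by blast
    qed
    then show ?thesis unfolding q_def by auto
  qed
  moreover have "small r (insert i (fr p))" using p unfolding valid_def by (simp add: small_insert)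
  ultimately have "valid q" using p x(1) unfolding valid_def q_def by simp
  moreover have "leq q p"
  proof -
    have "\<forall>k\<in>fr p. Th k x = Th k (pt p)" using Th i by auto
    moreover have "\<forall>l\<in>nz p. ev q l False" using ev_node[of _ q] by (simp add: q_def)
    ultimately show ?thesis using x unfolding leq_def by (auto simp: q_def qz_def)
  qed
  ultimately show ?thesis using v by (intro exI[of _ q]) (simp add: q_def)
qed

text \<open>The last clause keeps the proper ancestors of \<open>t\<close> out of \<open>nz\<close>,
  because in a valid condition a promised node has few leaves in \<open>lz\<close>. Changes at
  \<open>t\<close> therefore do not endanger any promise.\<close>

definition free :: "'k cond \<Rightarrow> 'k node \<Rightarrow> bool" where
  "free p t \<longleftrightarrow> (\<forall>m. m @ t \<notin> nz p) \<and> (\<forall>m i. (m @ t, i) \<notin> lz p \<and> (m @ t, i) \<notin> fr p) \<and>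
     (\<forall>m s. t = m @ s \<longrightarrow> m \<noteq> [] \<longrightarrow> \<not> small r {i. (s, i) \<in> lz p})"

lemma free_suffix:
  assumes "valid p" "free p t" "t = m @ l" shows "l \<notin> nz p"
proof (cases "m = []")
  case True then show ?thesis using assms(2,3) unfolding free_def by (metis append_Nil)
next
  case False
  then have "\<not> small r {i. (l, i) \<in> lz p}" using assms(2,3) unfolding free_def by auto
  then show ?thesis using assms(1) unfolding valid_def by auto
qed

lemma validI_sub:
  assumes "valid p" "pt q = pt p" "dm q = dm p" "fr q = fr p" "nz q \<subseteq> nz p" "lz q \<subseteq> lz p"
  shows "valid q"
proof -
  have "touched (nz q) (lz q) c \<Longrightarrow> touched (nz p) (lz p) c" for c
    using assms(5,6) unfolding touched_def by blast
  then have "small r {i. touched (nz q) (lz q) ((j, i) # l)}" for j l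
    using assms(1) unfolding valid_def by (blast intro: small_subset[of r "{i. touched (nz p) (lz p) ((j, i) # l)}"])
  moreover have "small r {i. (l, i) \<in> lz q}" if "l \<in> nz q" for l
    by (rule small_subset[of r "{i. (l, i) \<in> lz p}"]) (use assms(1,5,6) that in \<open>auto simp: valid_def\<close>)
  moreover have "tr q = tr p" using assms(2,4) unfolding tr_def by simp
  ultimately show ?thesis using assms unfolding valid_def by auto
qed

lemma small_leaves:
  assumes "small r (F :: 'k leaf set)" shows "small r {i. (s, i) \<in> F}"
proof (rule small_subset[OF small_image[OF assms, of snd]])
  show "{i. (s, i) \<in> F} \<subseteq> snd ` F" by force
qed

text \<open>Promising all leaves and children of \<open>t\<close> false makes \<open>t\<close> true;
  freeness ensures that no frozen leaf or earlier promise stands in the way.\<close>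

lemma valid_close:
  assumes p: "valid p" and t: "free p t"
  defines "q \<equiv> Cond (pt p) (dm p) (fr p) (nz p \<union> {c. child c t}) (lz p \<union> range (Pair t))"
  shows "valid q" "leq q p" "ev q t True"
proof -
  have tch: "touched (nz q) (lz q) ((j, i) # l) \<Longrightarrow>
      touched (nz p) (lz p) ((j, i) # l) \<or> (\<exists>m. m @ (j, i) # l = t)" for j i l
  proof -
    assume "touched (nz q) (lz q) ((j, i) # l)"
    then consider "touched (nz p) (lz p) ((j, i) # l)" | m where "m \<noteq> []" "child (m @ (j, i) # l) t"
      | m where "m @ (j, i) # l = t"
      unfolding touched_def q_def by auto
    then show ?thesis
    proof cases
      case 2
      then show ?thesis unfolding child_def by (cases m) auto
    qed auto
  qed
  have "small r {i. touched (nz q) (lz q) ((j, i) # l)}" for j l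
  proof (rule small_subset)
    \<comment> \<open>The new promises touch only \<open>t\<close> and its ancestors, and
      \<open>t\<close> has just one suffix of each length.\<close>
    let ?S = "{i. \<exists>m. m @ (j, i) # l = t}"
    have "finite ?S"
    proof (rule finite_subset)
      show "?S \<subseteq> {snd (t ! (length t - Suc (length l)))}" by (auto simp: nth_append)
    qed simp
    then show "small r ({i. touched (nz p) (lz p) ((j, i) # l)} \<union> ?S)"
      using p small_finite by (intro small_Un) (auto simp: valid_def)
    show "{i. touched (nz q) (lz q) ((j, i) # l)} \<subseteq> {i. touched (nz p) (lz p) ((j, i) # l)} \<union> ?S"
      using tch by blast
  qed
  moreover have "small r {i. (l, i) \<in> lz q}" if "l \<in> nz q" for l
  proof (cases "l \<in> nz p")
    case True
    then have "l \<noteq> t" using t unfolding free_def by (metis append_Nil)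
    then have "{i. (l, i) \<in> lz q} = {i. (l, i) \<in> lz p}" unfolding q_def by auto
    then show ?thesis using p True unfolding valid_def by auto
  next
    case False
    then have "child l t" using that unfolding q_def by simp
    then obtain x where "l = [x] @ t" unfolding child_def by auto
    then have "(l, i) \<notin> lz q" for i using t unfolding free_def q_def
      by (auto) (metis append_Cons append_Nil)
    then show ?thesis by (simp add: small_finite)
  qed
  moreover have "tr q \<inter> lz q = {}"
  proof -
    have "tr q = tr p" unfolding tr_def q_def by simp
    moreover have "(t, i) \<notin> tr p" for i using t unfolding free_def tr_def by (auto) (metis append_Nil)
    ultimately show ?thesis using p unfolding valid_def q_def by auto
  qed
  ultimately show v: "valid q" using p unfolding valid_def by (auto simp: q_def)
  show "leq q p" using leq_refl[OF v] unfolding leq_def q_def by (auto simp: qz_def ev_node)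
  show "ev q t True" unfolding ev_def by (rule tv.all) (auto simp: q_def qz_def intro: tv.node)
qed

text \<open>Forcing a code of rank b cannot be tied to the value of a free node of the same rank: after
  promising all children false, a decision about a subcode is tied to an untouched child.\<close>
lemma capture:
  assumes "valid p" "free p t" "rk t = b" "crank J W b C" "b = a \<or> (b, a) \<in> W"
    "\<And>q. valid q \<Longrightarrow> leq q p \<Longrightarrow> ev q t True \<Longrightarrow> \<exists>s. valid s \<and> leq s q \<and> forces C s"
    "\<And>q. valid q \<Longrightarrow> leq q p \<Longrightarrow> ev q t False \<Longrightarrow> \<not> forces C q"
  shows False
  using assms
proof (induction b arbitrary: p t C rule: wf_induct_rule[OF wf_W])
  case (1 b)
  note p = \<open>valid p\<close> and t = \<open>free p t\<close> and H1 = "1.prems"(6) and H0 = "1.prems"(7)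
  obtain p1 where p1: "valid p1" "leq p1 p" "ev p1 t True" "nz p1 = nz p \<union> {c. child c t}" "lz p1 = lz p \<union> range (Pair t)"
    using valid_close[OF p t] by (metis cond.sel(4,5))
  obtain q where q: "valid q" "leq q p1" "forces C q" using H1[OF p1(1-3)] by blast
  have qp: "leq q p" using leq_trans[OF q(2) p1(2)] .
  have smq: "small r (fr q)" using q(1) valid_def by auto
  have tq: "(t, i) \<in> qz q" for i using q(2) p1(5) unfolding leq_def by auto
  from \<open>crank J W b C\<close> show ?case
  proof cases
    case (one U)
    obtain i where i: "(t, i) \<notin> fr q" using small_nonempty_Compl[OF small_leaves[OF smq, of t]] by auto
    define q2 where "q2 = Cond (pt q) (dm q) (fr q) (nz q) (lz q - {(t, i)})"
    have v2: "valid q2" by (rule validI_sub[OF q(1)]) (auto simp: q2_def)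
    obtain q3 where q3: "valid q3" "leq q3 q2" "fr q3 = insert (t, i) (fr q2)" "nz q3 = nz q2"
        "lz q3 = lz q2" "val (Th (t, i) (pt q3))"
      using freeze[OF v2, of "(t, i)" True] i by (auto simp: q2_def)
    have tr2: "tr q2 = tr q" and fa2: "fa q2 = fa q" unfolding tr_def fa_def q2_def by auto
    have qz3: "qz q - {(t, i)} \<subseteq> qz q3" using leq_fa[OF q3(2)] fa2 q3(5) unfolding qz_def q2_def by auto
    \<comment> \<open>The condition \<open>q3\<close> breaks a promise of \<open>q\<close> but still
      extends \<open>p\<close>: no node of \<open>nz p\<close> lies on the path from
      \<open>t\<close> to the root.\<close>
    have "ev q3 l False" if l: "l \<in> nz p" for l
    proof -
      have *: "tv (nz q) (tr q) (qz q) l False" using qp l unfolding leq_def ev_def by auto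
      have "\<nexists>m. t = m @ l" using free_suffix[OF p t] l by blast
      then show ?thesis unfolding ev_def
        by (rule tv_off_path[OF *]) (use q3(4) leq_tr[OF q3(2)] tr2 qz3 in \<open>auto simp: q2_def\<close>)
    qed
    moreover have "lz p \<subseteq> qz q3"
    proof -
      have "(t, i) \<notin> lz p" using t unfolding free_def by (metis append_Nil)
      then show ?thesis using qp qz3 unfolding leq_def by blast
    qed
    moreover have "dm p \<subseteq> dm q3" "pt q3 \<inter> dm p = pt p" "fr p \<subseteq> fr q3"
      using qp q3(2) unfolding leq_def q2_def by auto
    moreover have "\<forall>i\<in>fr p. Th i (pt q3) = Th i (pt p)"
      using qp q3(2) unfolding leq_def q2_def by (auto dest: subsetD)
    ultimately have "leq q3 p" unfolding leq_def by blast
    moreover have "ev q3 t False" unfolding ev_def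
      by (rule tv.leaf[of _ i]) (use q3(3,6) in \<open>auto simp: tr_def\<close>)
    ultimately have "\<not> forces C q3" using H0[OF q3(1)] by blast
    moreover have "pts q2 = pts q" unfolding pts_def q2_def by simp
    ultimately show False using pts_mono[OF q3(2)] q(3) one by auto
  next
    case (union f)
    obtain g where g: "\<And>s. valid s \<Longrightarrow> leq s q \<Longrightarrow> \<not> forces (f g) s" using q(3) union(1) by auto
    obtain b' where b': "ord_pos W b'" "(b', b) \<in> W" "b' \<noteq> b" "crank J W b' (f g)" using union by blast
    have b'a: "(b', a) \<in> W" using b'(2) "1.prems"(5) trans_W by (auto dest: transD)
    have "b' \<noteq> a"
    proof
      assume "b' = a"
      then have "(b', b) \<in> W - Id" "(b, b') \<in> W - Id" using b'(2,3) "1.prems"(5) by auto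
      then show False using wf_asym[OF wf_W] by auto
    qed
    then obtain j where j: "u j = b'" using u_surj[OF b'a] by auto
    \<comment> \<open>For a frozen leaf below a child of \<open>t\<close>, the selected list entry
      is the step to that child; its copy index is excluded.\<close>
    define bad where "bad = {i. touched (nz q) (lz q) ((j, i) # t)} \<union> (\<lambda>l. snd (fst l ! (length (fst l) - Suc (length t)))) ` fr q"
    have "small r bad"
      unfolding bad_def by (intro small_Un small_image smq) (use q(1) in \<open>auto simp: valid_def\<close>)
    then obtain i where i: "i \<notin> bad" using small_nonempty_Compl by auto
    define t' where "t' = (j, i) # t"
    have untouched: "\<And>m. m \<noteq> [] \<Longrightarrow> m @ t' \<notin> nz q" "\<And>m k. (m @ t', k) \<notin> lz q"
      using i unfolding bad_def touched_def t'_def by auto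
    have nofr: "(m @ t', k) \<notin> fr q" for m k
    proof
      assume "(m @ t', k) \<in> fr q"
      then have "snd ((m @ t') ! (length (m @ t') - Suc (length t))) \<in> bad"
        unfolding bad_def by (intro UnI2 image_eqI[of _ _ "(m @ t', k)"]) auto
      then show False using i unfolding t'_def by (simp add: nth_append)
    qed
    have ch: "child t' t" using j b' "1.prems"(3) unfolding child_def t'_def by auto
    have "ev q t' False" using q(2) ch p1(4) unfolding leq_def by blast
    then have t'N: "t' \<in> nz q" unfolding ev_def
    proof cases
      case (leaf i')
      then show ?thesis using nofr[of "[]"] unfolding tr_def by simp
    next
      case (child c)
      obtain x where x: "c = [x] @ t'" using child(1) unfolding child_def by auto
      from child(2) have "(c, i) \<in> qz q" by cases auto
      then show ?thesis using nofr[of "[x]"] untouched(2)[of "[x]"] x unfolding qz_def fa_def by auto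
    qed auto
    \<comment> \<open>Release the promise on the untouched child \<open>t'\<close>, which becomes
      free. The subcode would then follow the value of \<open>t'\<close>, against the induction
      hypothesis: \<open>t'\<close> true makes \<open>t\<close> false, so \<open>C\<close> is not
      forced and the subcode can be; \<open>t'\<close> false gives back an extension of
      \<open>q\<close>, which excludes the subcode.\<close>
    define q2 where "q2 = Cond (pt q) (dm q) (fr q) (nz q - {t'}) (lz q)"
    have v2: "valid q2" by (rule validI_sub[OF q(1)]) (auto simp: q2_def)
    have tr2: "tr q2 = tr q" and qz2: "qz q2 = qz q" unfolding tr_def fa_def q2_def qz_def by auto
    \<comment> \<open>A leaf known to be false is promised or frozen, and few leaves are
      frozen.\<close>
    have big: "\<not> small r {i. (s, i) \<in> lz q}" if "\<And>i. (s, i) \<in> qz q \<or> (s, i) \<notin> S" "\<not> small r {i. (s, i) \<in> S}" for s S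
    proof
      assume "small r {i. (s, i) \<in> lz q}"
      then have "small r ({i. (s, i) \<in> lz q} \<union> {i. (s, i) \<in> fr q})"
        using small_leaves[OF smq] small_Un by auto
      then have "small r {i. (s, i) \<in> S}"
        by (rule small_subset) (use that(1) in \<open>auto simp: qz_def fa_def\<close>)
      then show False using that(2) by simp
    qed
    have "free q2 t'" unfolding free_def
    proof (intro conjI allI impI)
      show "m @ t' \<notin> nz q2" for m using untouched(1)[of m] by (cases "m = []") (auto simp: q2_def)
      show "(m @ t', k) \<notin> lz q2" for m k using untouched(2) by (simp add: q2_def)
      show "(m @ t', k) \<notin> fr q2" for m k using nofr by (simp add: q2_def)
      fix m s assume m: "t' = m @ s" "m \<noteq> []"
      then obtain m' where m': "t = m' @ s" unfolding t'_def by (cases m) auto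
      have "\<not> small r {i. (s, i) \<in> lz q}"
      proof (cases "m' = []")
        case True
        then have "s = t" using m' by simp
        then show ?thesis using tq not_small_UNIV by (intro big[of _ UNIV]) auto
      next
        case False
        then have "\<not> small r {i. (s, i) \<in> lz p}" using t m' unfolding free_def by blast
        then show ?thesis using qp unfolding leq_def by (intro big[of _ "lz p"]) auto
      qed
      then show "\<not> small r {i. (s, i) \<in> lz q2}" by (simp add: q2_def)
    qed
    moreover have q2p: "leq q2 p"
    proof -
      have "ev q2 l False" if l: "l \<in> nz p" for l
      proof -
        have *: "tv (nz q) (tr q) (qz q) l False" using qp l unfolding leq_def ev_def by auto
        have "l \<noteq> t'" using t l unfolding t'_def free_def by (metis append_Cons append_Nil)
        moreover have "t \<noteq> m @ l" for m using free_suffix[OF p t] l by blast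
        ultimately have **: "\<nexists>m. t' = m @ l" unfolding t'_def by (auto simp: Cons_eq_append_conv)
        show ?thesis unfolding ev_def tr2 qz2
          by (rule tv_off_path[OF * **]) (auto simp: q2_def)
      qed
      then show ?thesis using qp qz2 unfolding leq_def by (auto simp: q2_def)
    qed
    moreover have qq2: "e \<in> {e. leq e q}" if "leq e q2" "ev e t' False" for e
      using that qz2 unfolding leq_def by (auto simp: q2_def)
    have "\<exists>s. valid s \<and> leq s e \<and> forces (f g) s" if e: "valid e" "leq e q2" "ev e t' True" for e
    proof (rule ccontr)
      assume "\<not> ?thesis"
      then have "forces C e" using union(1) by auto
      moreover have "ev e t False" using e(3) ch unfolding ev_def by (blast intro: tv.child)
      ultimately show False using H0[OF e(1) leq_trans[OF e(2) q2p]] by blast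
    qed
    moreover have "\<not> forces (f g) e" if "valid e" "leq e q2" "ev e t' False" for e
      using g[OF that(1)] qq2[OF that(2,3)] by blast
    moreover have "rk t' = b'" using j by (simp add: rk_def t'_def)
    ultimately show False
      using "1.IH"[of b' q2 t' "f g"] b' b'a v2 by blast
  qed
qed

end

section \<open>Generic sequences\<close>

primrec sub_code :: "'k borel_code \<Rightarrow> 'k list \<Rightarrow> 'k borel_code" where
  "sub_code (Copen U) gs = Copen U"
| "sub_code (Cunion f) gs = (case gs of [] \<Rightarrow> Cunion f | g # gs' \<Rightarrow> sub_code (f g) gs')"

lemma sub_code_Nil [simp]: "sub_code C [] = C"
  by (cases C) auto

primrec code_open :: "'k set set \<Rightarrow> 'k borel_code \<Rightarrow> bool" where
  "code_open J (Copen U) \<longleftrightarrow> open_in J U"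
| "code_open J (Cunion f) \<longleftrightarrow> (\<forall>g. code_open J (f g))"

lemma crank_code_open: "crank J W b C \<Longrightarrow> code_open J C"
  by (induction rule: crank.induct) auto

datatype 'k task = Decide "'k list" | Freeze "'k leaf" | Resolve "'k node"

context forcing begin

text \<open>Only promises kept literally from some point of the chain on go into \<open>nz\<close>.
  A node whose promise was replaced on the way is false through a leaf or a child, and by induction
  on the rank this survives the limit.\<close>

lemma limit:
  assumes C: "small r C" "C \<noteq> {}" "\<And>p. p \<in> C \<Longrightarrow> valid p" "\<And>p q. p \<in> C \<Longrightarrow> q \<in> C \<Longrightarrow> leq p q \<or> leq q p"
  shows "\<exists>l. valid l \<and> (\<forall>p\<in>C. leq l p) \<and> pt l = (\<Union>p\<in>C. pt p)"
proof -
  define S where "S = (\<lambda>p. (pt p, dm p)) ` C"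
  have OkC: "Ok (pt p) (dm p)" if "p \<in> C" for p using C(3)[OF that] unfolding valid_def by simp
  have "Ok (\<Union>(fst ` S)) (\<Union>(snd ` S)) \<and> Theta (\<Union>(fst ` S)) \<subseteq> (\<Union>x\<in>fst ` S. Theta x)"
  proof (rule Ok_limit)
    show "small r S" unfolding S_def using C(1) by (rule small_image)
    show "S \<noteq> {}" using C(2) S_def by simp
    show "Ok x D" if "(x, D) \<in> S" for x D using that OkC unfolding S_def by auto
    show "(D \<subseteq> D' \<and> x' \<inter> D = x) \<or> (D' \<subseteq> D \<and> x \<inter> D' = x')"
      if S2: "(x, D) \<in> S" "(x', D') \<in> S" for x D x' D'
    proof -
      obtain p q where "p \<in> C" "q \<in> C" and e: "x = pt p" "D = dm p" "x' = pt q" "D' = dm q"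
        using S2 unfolding S_def by auto
      then have "leq p q \<or> leq q p" using C(4) by simp
      then show ?thesis unfolding e leq_def by auto
    qed
  qed
  then have Ok: "Ok (\<Union>p\<in>C. pt p) (\<Union>p\<in>C. dm p)" and Theta: "Theta (\<Union>p\<in>C. pt p) \<subseteq> (\<Union>p\<in>C. Theta (pt p))"
    unfolding S_def by (simp_all add: image_image)
  define l where "l = Cond (\<Union>p\<in>C. pt p) (\<Union>p\<in>C. dm p) (\<Union>p\<in>C. fr p)
    {n. \<exists>p\<in>C. \<forall>q\<in>C. leq q p \<longrightarrow> n \<in> nz q} (\<Union>p\<in>C. lz p)"
  have ptdm: "pt l \<inter> dm p = pt p" if p: "p \<in> C" for p
  proof -
    have "pt q \<inter> dm p \<subseteq> pt p" if "q \<in> C" for q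
      using C(4)[OF p that] Ok_dom[OF OkC[OF that]] unfolding leq_def by auto
    then show ?thesis using Ok_dom[OF OkC[OF p]] p unfolding l_def by auto
  qed
  have lock: "Theta (pt p) \<subseteq> Theta (pt l)" if "p \<in> C" for p
    by (rule Theta_lock[OF OkC[OF that] ptdm[OF that]])
  have Thl: "Th i (pt l) \<subseteq> (\<Union>p\<in>C. Th i (pt p))" for i
    using subsetD[OF Theta] unfolding Th_def l_def by fastforce
  have frTh: "Th i (pt l) = Th i (pt p)" if p: "p \<in> C" "i \<in> fr p" for p i
  proof
    show "Th i (pt p) \<subseteq> Th i (pt l)" by (rule Th_subset[OF lock[OF p(1)]])
    have "Th i (pt q) \<subseteq> Th i (pt p)" if q: "q \<in> C" for q
    proof (cases "leq q p")
      case True then show ?thesis using p unfolding leq_def by auto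
    next
      case False
      then have "leq p q" using C(4)[OF p(1) q] by simp
      then have "pt p \<inter> dm q = pt q" unfolding leq_def by simp
      then show ?thesis using Theta_lock[OF OkC[OF q]] Th_subset by simp
    qed
    then show "Th i (pt l) \<subseteq> Th i (pt p)" using Thl[of i] by blast
  qed
  have trl: "tr p \<subseteq> tr l" and fal: "fa p \<subseteq> fa l" if "p \<in> C" for p
    using frTh[OF that] that unfolding tr_def fa_def l_def by auto
  have qzl: "qz p \<subseteq> qz l" if "p \<in> C" for p
    using fal[OF that] that unfolding qz_def by (auto simp: l_def)
  have evl: "\<forall>p\<in>C. \<forall>e. ev p n e \<longrightarrow> ev l n e" for n
  proof (induction n rule: rank_induct)
    case (1 n)
    have kids: "tv (nz l) (tr l) (qz l) n False"
      if p: "p \<in> C" "tv (nz p) (tr p) (qz p) n False" "n \<notin> nz p" for p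
      using p(2)
    proof cases
      case node then show ?thesis using p(3) by simp
    next
      case (leaf i) then show ?thesis using trl[OF p(1)] by (blast intro: tv.leaf)
    next
      case (child c) then show ?thesis using 1[of c] p(1) unfolding ev_def by (blast intro: tv.child)
    qed auto
    show ?case
    proof (intro ballI allI impI)
      fix p e assume p: "p \<in> C" "ev p n e"
      show "ev l n e"
      proof (cases e)
        case True
        then have "tv (nz p) (tr p) (qz p) n True" using p(2) unfolding ev_def by simp
        then have "tv (nz l) (tr l) (qz l) n True"
        proof cases
          case all
          then show ?thesis using 1 p(1) qzl[OF p(1)] unfolding ev_def by (blast intro: tv.all)
        qed auto
        then show ?thesis using True unfolding ev_def by simp
      next
        case False
        show ?thesis
        proof (cases "\<forall>q\<in>C. leq q p \<longrightarrow> n \<in> nz q")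
          case True
          then have "n \<in> nz l" using p(1) unfolding l_def by auto
          then show ?thesis using ev_node False by simp
        next
          case no: False
          then obtain q where q: "q \<in> C" "leq q p" "n \<notin> nz q" by blast
          then show ?thesis using kids[OF q(1) _ q(3)] ev_mono[OF q(2) p(2)] False unfolding ev_def by simp
        qed
      qed
    qed
  qed
  have leq: "leq l p" if p: "p \<in> C" for p
    using ptdm[OF p] frTh[OF p] evl ev_node qzl[OF p] p
    unfolding leq_def by (auto simp: l_def qz_def)
  moreover have "valid l"
  proof -
    have bdl: "Bd (pt l)" unfolding Bd_def
    proof
      fix i
      have "\<exists>m. \<forall>m' e. (m', e) \<in> Th i (pt p) \<longrightarrow> m' \<prec> m" if "p \<in> C" for p
      proof -
        have "Bd (pt p)" using C(3)[OF that] unfolding valid_def by simp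
        then show ?thesis unfolding Bd_def by (rule spec)
      qed
      then obtain m where m: "\<And>p m' e. p \<in> C \<Longrightarrow> (m', e) \<in> Th i (pt p) \<Longrightarrow> m' \<prec> m p" by metis
      obtain b where b: "\<And>p. p \<in> C \<Longrightarrow> m p \<prec> b" using small_bounded[OF small_image[OF C(1), of m]] by auto
      have "m' \<prec> b" if mem: "(m', e) \<in> Th i (pt l)" for m' e
      proof -
        obtain p where "p \<in> C" "(m', e) \<in> Th i (pt p)" using subsetD[OF Thl mem] by auto
        then show ?thesis using lt_trans[OF m b] by blast
      qed
      then show "\<exists>m. \<forall>m' e. (m', e) \<in> Th i (pt l) \<longrightarrow> m' \<prec> m" by blast
    qed
    have smfr: "small r (fr p)" if "p \<in> C" for p using C(3)[OF that] unfolding valid_def by simp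
    have "small r (fr l)" unfolding l_def by (simp add: small_UN[OF C(1)] smfr)
    moreover have "tr l \<inter> lz l = {}"
    proof -
      have "i \<notin> lz q" if i: "i \<in> tr l" and q: "q \<in> C" for i q
      proof
        assume iq: "i \<in> lz q"
        obtain p where p: "p \<in> C" "i \<in> fr p" using i unfolding tr_def l_def by auto
        then have ip: "i \<in> tr p" using frTh[OF p] i unfolding tr_def by simp
        show False
        proof (cases "leq p q")
          case True
          then have "i \<in> qz p" using iq unfolding leq_def by auto
          then show False using ip C(3)[OF p(1)] unfolding qz_def valid_def tr_def fa_def by auto
        next
          case False
          then have "i \<in> tr q" using C(4)[OF p(1) q] leq_tr ip by blast
          then show False using iq C(3)[OF q] unfolding valid_def by auto
        qed
      qed
      then show ?thesis unfolding l_def by auto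
    qed
    moreover have "small r {i. touched (nz l) (lz l) ((j, i) # n)}" for j n
    proof (rule small_subset)
      show "small r (\<Union>p\<in>C. {i. touched (nz p) (lz p) ((j, i) # n)})"
        using C(3) by (intro small_UN[OF C(1)]) (simp add: valid_def)
      have nz: "\<exists>p\<in>C. m \<in> nz p" if m: "m \<in> nz l" for m
      proof -
        obtain p where "p \<in> C" "\<forall>q\<in>C. leq q p \<longrightarrow> m \<in> nz q" using m unfolding l_def by auto
        then have "m \<in> nz p" using leq_refl[OF C(3)] by simp
        then show ?thesis using \<open>p \<in> C\<close> by (rule bexI)
      qed
      have "\<exists>p\<in>C. touched (nz p) (lz p) c" if "touched (nz l) (lz l) c" for c
        using that unfolding touched_def
      proof (elim disjE exE conjE)
        fix m assume m: "m \<noteq> []" "m @ c \<in> nz l"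
        then show "\<exists>p\<in>C. (\<exists>m. m \<noteq> [] \<and> m @ c \<in> nz p) \<or> (\<exists>m i. (m @ c, i) \<in> lz p)" using nz[OF m(2)] by blast
      next
        fix m i assume "(m @ c, i) \<in> lz l"
        then obtain p where "p \<in> C" "(m @ c, i) \<in> lz p" unfolding l_def by auto
        then show "\<exists>p\<in>C. (\<exists>m. m \<noteq> [] \<and> m @ c \<in> nz p) \<or> (\<exists>m i. (m @ c, i) \<in> lz p)" by blast
      qed
      then show "{i. touched (nz l) (lz l) ((j, i) # n)} \<subseteq> (\<Union>p\<in>C. {i. touched (nz p) (lz p) ((j, i) # n)})"
        by auto
    qed
    moreover have "small r {i. (n, i) \<in> lz l}" if n: "n \<in> nz l" for n
    proof -
      obtain p where p: "p \<in> C" "\<And>q. q \<in> C \<Longrightarrow> leq q p \<Longrightarrow> n \<in> nz q" using n unfolding l_def by auto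
      have np: "n \<in> nz q \<Longrightarrow> q \<in> C \<Longrightarrow> small r {i. (n, i) \<in> lz q}" for q
        using C(3)[of q] unfolding valid_def by simp
      have "small r {i. (n, i) \<in> lz q}" if q: "q \<in> C" for q
      proof (cases "leq q p")
        case True then show ?thesis using p(2) q np by blast
      next
        case False
        then have sub: "lz q \<subseteq> lz p \<union> fr p" using C(4)[OF p(1) q] unfolding leq_def qz_def fa_def by auto
        have "n \<in> nz p" using p(2)[OF p(1) leq_refl[OF C(3)[OF p(1)]]] .
        then have "small r ({i. (n, i) \<in> lz p} \<union> {i. (n, i) \<in> fr p})"
          using small_Un[OF np small_leaves[OF smfr[OF p(1)], of n]] p(1) by blast
        then show ?thesis by (rule small_subset) (use sub in auto)
      qed
      then have "small r (\<Union>q\<in>C. {i. (n, i) \<in> lz q})" by (rule small_UN[OF C(1)])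
      then show ?thesis by (rule small_subset) (auto simp: l_def)
    qed
    moreover have "Ok (pt l) (dm l)" using Ok unfolding l_def by simp
    ultimately show ?thesis using bdl unfolding valid_def by simp
  qed
  ultimately show ?thesis by (intro exI[of _ l]) (simp add: l_def)
qed

lemma extend_dm:
  assumes "valid p" "D \<in> J"
  shows "\<exists>q. valid q \<and> leq q p \<and> pt q = pt p \<and> D \<subseteq> dm q"
proof -
  define q where "q = Cond (pt p) (dm p \<union> D) (fr p) (nz p) (lz p)"
  have tr: "tr q = tr p" unfolding tr_def q_def by simp
  have "valid q" using assms Ok_extend tr unfolding valid_def q_def by simp
  moreover have "leq q p" using assms(1) Ok_dom ev_node[of _ q]
    unfolding leq_def valid_def qz_def by (auto simp: q_def)
  ultimately show ?thesis by (intro exI[of _ q]) (simp add: q_def)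
qed

definition decided :: "'k borel_code \<Rightarrow> 'k cond \<Rightarrow> bool" where
  "decided C q \<longleftrightarrow> forces C q \<or> (\<forall>s. valid s \<longrightarrow> leq s q \<longrightarrow> \<not> forces C s)"

fun achieved :: "'k borel_code \<Rightarrow> 'k task \<Rightarrow> 'k cond \<Rightarrow> bool" where
  "achieved C (Decide gs) q \<longleftrightarrow> decided (sub_code C gs) q"
| "achieved C (Freeze i) q \<longleftrightarrow> i \<in> fr q"
| "achieved C (Resolve l) q \<longleftrightarrow> (l \<in> nz q \<longrightarrow> (\<exists>i. (l, i) \<in> tr q))"

lemma achieve:
  assumes "valid p" shows "\<exists>q. valid q \<and> leq q p \<and> achieved C t q"
proof (cases t)
  case (Decide gs)
  show ?thesis
  proof (cases "\<exists>s. valid s \<and> leq s p \<and> forces (sub_code C gs) s")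
    case True
    then show ?thesis using Decide by (auto simp: decided_def)
  next
    case False
    then show ?thesis using Decide assms leq_refl[OF assms]
      by (intro exI[of _ p]) (auto simp: decided_def)
  qed
next
  case (Freeze i)
  show ?thesis
  proof (cases "i \<in> fr p")
    case True then show ?thesis using Freeze assms leq_refl[OF assms] by auto
  next
    case False then show ?thesis using freeze[OF assms False, of False] Freeze by auto
  qed
next
  case (Resolve l)
  show ?thesis
  proof (cases "l \<in> nz p")
    case True
    have "small r ({i. (l, i) \<in> lz p} \<union> {i. (l, i) \<in> fr p})"
      using assms True small_leaves unfolding valid_def by (intro small_Un) auto
    then obtain i where i: "(l, i) \<notin> lz p" "(l, i) \<notin> fr p" using small_nonempty_Compl by blast
    then obtain q where "valid q" "leq q p" "fr q = insert (l, i) (fr p)" "val (Th (l, i) (pt q))"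
      using freeze[OF assms i(2), of True] by auto
    then show ?thesis using Resolve by (intro exI[of _ q]) (auto simp: tr_def)
  next
    case False then show ?thesis using Resolve assms leq_refl[OF assms] by auto
  qed
qed

lemma cofinal_tasks: "\<exists>g :: 'k \<Rightarrow> 'k task. \<forall>t k. \<exists>k'. k \<prec> k' \<and> g k' = t"
proof -
  from inj_list obtain f1 :: "'k list \<Rightarrow> 'k" where f1: "inj f1" ..
  from inj_node obtain f2 :: "'k node \<Rightarrow> 'k" where f2: "inj f2" ..
  from inj_pair[OF f2 inj_on_id] obtain f3 :: "'k leaf \<Rightarrow> 'k" where f3: "inj f3" ..
  from inj_sum[OF f3 f2] obtain f4 :: "'k leaf + 'k node \<Rightarrow> 'k" where f4: "inj f4" ..
  from inj_sum[OF f1 f4] obtain f5 :: "'k list + ('k leaf + 'k node) \<Rightarrow> 'k" where f5: "inj f5" ..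
  define e :: "'k task \<Rightarrow> 'k list + ('k leaf + 'k node)"
    where "e t = (case t of Decide gs \<Rightarrow> Inl gs | Freeze i \<Rightarrow> Inr (Inl i) | Resolve l \<Rightarrow> Inr (Inr l))" for t
  have "inj e" by (rule injI) (auto simp: e_def split: task.splits)
  then have "inj (f5 \<circ> e)" using f5 by (simp add: inj_compose)
  then show ?thesis by (rule cofinal_enumeration)
qed

text \<open>At stage \<open>k\<close> the fibre of \<open>h\<close> over \<open>k\<close> is first
  added to the domain without any new point, and only then is the task performed. Hence a point
  belongs to the sequence before the stage given by its value of \<open>h\<close>, unless that value
  is least.\<close>

lemma generic_sequence:
  assumes p0: "valid p0"
  shows "\<exists>p. (\<forall>k. valid (p k) \<and> leq (p k) p0) \<and> (\<forall>j k. j \<prec> k \<longrightarrow> leq (p k) (p j)) \<and>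
     (\<forall>\<xi>. \<xi> \<in> dm (p (h \<xi>)) \<and> (\<xi> \<in> pt (p (h \<xi>)) \<longrightarrow> (\<forall>j. \<not> j \<prec> h \<xi>) \<or> (\<exists>j. j \<prec> h \<xi> \<and> \<xi> \<in> pt (p j)))) \<and>
     (\<forall>t k. \<exists>k'. k \<prec> k' \<and> achieved C t (p k'))"
proof -
  from cofinal_tasks obtain T :: "'k \<Rightarrow> 'k task" where T: "\<forall>t k. \<exists>k'. k \<prec> k' \<and> T k' = t" ..
  define P where "P f k q \<longleftrightarrow> valid q \<and> leq q p0 \<and> {\<xi>. h \<xi> = k} \<subseteq> dm q \<and> (\<forall>j. j \<prec> k \<longrightarrow> leq q (f j)) \<and>
     (\<forall>\<xi>. h \<xi> = k \<longrightarrow> \<xi> \<in> pt q \<longrightarrow> \<xi> \<in> pt p0 \<or> (\<exists>j. j \<prec> k \<and> \<xi> \<in> pt (f j))) \<and> achieved C (T k) q" for f k q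
  have "\<exists>p. \<forall>k. P p k (p k)"
  proof (rule dependent_wf_choice[OF wf_lt])
    show "P f x q = P g x q" if "\<And>z. (z, x) \<in> {(a, b). a \<prec> b} \<Longrightarrow> f z = g z" for f g x q
      using that unfolding P_def by auto
  next
    fix k f assume *: "\<And>j. (j, k) \<in> {(a, b). a \<prec> b} \<Longrightarrow> P f j (f j)"
    then have f: "P f j (f j)" if "j \<prec> k" for j using that by simp
    define S where "S = insert p0 (f ` {j. j \<prec> k})"
    have "\<exists>l. valid l \<and> (\<forall>p\<in>S. leq l p) \<and> pt l = (\<Union>p\<in>S. pt p)"
    proof (rule limit)
      show "small r S" unfolding S_def by (intro small_insert small_image small_below)
      show "S \<noteq> {}" unfolding S_def by simp
      show "valid q" if "q \<in> S" for q using that f p0 unfolding S_def P_def by auto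
      show "leq q q' \<or> leq q' q" if "q \<in> S" "q' \<in> S" for q q'
      proof -
        have ff: "leq (f i) (f j) \<or> leq (f j) (f i)" if "i \<prec> k" "j \<prec> k" for i j
          using lt_linear[of i j] f[OF that(1)] f[OF that(2)] leq_refl unfolding P_def by auto
        have "leq (f j) p0" if "j \<prec> k" for j using f[OF that] unfolding P_def by simp
        then show ?thesis using that ff leq_refl[OF p0] unfolding S_def by blast
      qed
    qed
    then obtain l where l: "valid l" "\<forall>p\<in>S. leq l p" "pt l = (\<Union>p\<in>S. pt p)" by blast
    obtain q1 where q1: "valid q1" "leq q1 l" "pt q1 = pt l" "{\<xi>. h \<xi> = k} \<subseteq> dm q1"
      using extend_dm[OF l(1) h_fiber] by blast
    obtain q where q: "valid q" "leq q q1" "achieved C (T k) q" using achieve[OF q1(1)] by blast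
    have ql: "leq q l" using leq_trans[OF q(2) q1(2)] .
    have "P f k q" unfolding P_def
    proof (intro conjI allI impI)
      show "valid q" "achieved C (T k) q" by fact+
      show "{\<xi>. h \<xi> = k} \<subseteq> dm q" using q1(4) q(2) unfolding leq_def by blast
      show "leq q p0" using leq_trans[OF ql] l(2) unfolding S_def by simp
      show "leq q (f j)" if "j \<prec> k" for j using leq_trans[OF ql] l(2) that unfolding S_def by simp
      fix \<xi> assume \<xi>: "h \<xi> = k" "\<xi> \<in> pt q"
      then have "\<xi> \<in> pt l" using q(2) q1(3,4) unfolding leq_def by auto
      then show "\<xi> \<in> pt p0 \<or> (\<exists>j. j \<prec> k \<and> \<xi> \<in> pt (f j))" unfolding l(3) S_def by auto
    qed
    then show "\<exists>q. P f k q" by blast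
  qed
  then obtain p where p: "\<And>k. P p k (p k)" by blast
  have "(\<forall>j. \<not> j \<prec> h \<xi>) \<or> (\<exists>j. j \<prec> h \<xi> \<and> \<xi> \<in> pt (p j))" if "\<xi> \<in> pt (p (h \<xi>))" for \<xi>
  proof -
    have "\<xi> \<in> pt p0 \<or> (\<exists>j. j \<prec> h \<xi> \<and> \<xi> \<in> pt (p j))" using p[of "h \<xi>"] that unfolding P_def by blast
    moreover have "\<xi> \<in> pt (p j)" if "\<xi> \<in> pt p0" for j using p[of j] that unfolding P_def leq_def by auto
    ultimately show ?thesis by blast
  qed
  moreover have "\<xi> \<in> dm (p (h \<xi>))" for \<xi> using p[of "h \<xi>"] unfolding P_def by auto
  moreover have "\<exists>k'. k \<prec> k' \<and> achieved C t (p k')" for t k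
  proof -
    obtain k' where "k \<prec> k'" "T k' = t" using T by blast
    then show ?thesis using p[of k'] unfolding P_def by auto
  qed
  moreover have "valid (p k) \<and> leq (p k) p0" for k using p[of k] unfolding P_def by simp
  moreover have "leq (p k) (p j)" if "j \<prec> k" for j k using p[of k] that unfolding P_def by simp
  ultimately show ?thesis by (intro exI[of _ p]) simp
qed

section \<open>The point of a generic sequence and the truth lemma\<close>

definition leaf_values :: "'k set \<Rightarrow> 'k leaf set" where
  "leaf_values x = {i. val (Th i x)}"

definition root_true :: "'k set set" where
  "root_true = {x. tv {} (leaf_values x) (- leaf_values x) [] True}"

text \<open>Node values are realised by induction on the rank, membership in coded sets by induction
  on codes, since every subcode is decided along the sequence.\<close>

lemma generic_truth:
  assumes p0: "valid p0" and C: "code_open J C"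
  shows "\<exists>x. (\<forall>e. ev p0 [] e \<longrightarrow> tv {} (leaf_values x) (- leaf_values x) [] e) \<and>
    (forces C p0 \<longrightarrow> x \<in> sem C) \<and> (x \<in> sem C \<longrightarrow> (\<exists>s. valid s \<and> leq s p0 \<and> forces C s))"
proof -
  obtain p where P: "\<forall>k. valid (p k) \<and> leq (p k) p0" "\<forall>j k. j \<prec> k \<longrightarrow> leq (p k) (p j)"
    "\<forall>\<xi>. \<xi> \<in> dm (p (h \<xi>)) \<and> (\<xi> \<in> pt (p (h \<xi>)) \<longrightarrow> (\<forall>j. \<not> j \<prec> h \<xi>) \<or> (\<exists>j. j \<prec> h \<xi> \<and> \<xi> \<in> pt (p j)))"
    "\<forall>t k. \<exists>k'. k \<prec> k' \<and> achieved C t (p k')"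
    using generic_sequence[OF p0, of C] by (elim exE conjE)
  have p: "\<And>k. valid (p k)" "\<And>k. leq (p k) p0" "\<And>j k. j \<prec> k \<Longrightarrow> leq (p k) (p j)"
    using P(1,2) by simp_all
  have h: "(\<forall>j. \<not> j \<prec> h \<xi>) \<or> (\<exists>j. j \<prec> h \<xi> \<and> \<xi> \<in> pt (p j))" if "\<xi> \<in> pt (p (h \<xi>))" for \<xi>
    using P(3) that by blast
  have ach: "\<exists>k'. k \<prec> k' \<and> achieved C t (p k')" for t k using P(4) by simp
  have hdm: "\<xi> \<in> dm (p (h \<xi>))" for \<xi> using P(3) by simp
  have lin: "leq (p j) (p k) \<or> leq (p k) (p j)" for j k
    using lt_linear[of j k] p(1,3) leq_refl by auto
  define x where "x = (\<Union>k. pt (p k))"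
  have Ok: "Ok (pt (p k)) (dm (p k))" for k using p(1)[of k] unfolding valid_def by simp
  have early: "(\<forall>j. \<not> j \<prec> h \<xi>) \<or> (\<exists>j. j \<prec> h \<xi> \<and> \<xi> \<in> pt (p j))" if \<xi>: "\<xi> \<in> pt (p k)" for \<xi> k
  proof (cases "k \<prec> h \<xi>")
    case True then show ?thesis using \<xi> by blast
  next
    case False
    then have "h \<xi> \<prec> k \<or> h \<xi> = k" using lt_linear[of k "h \<xi>"] by auto
    then have "\<xi> \<in> pt (p (h \<xi>))" using p(3)[of "h \<xi>" k] \<xi> hdm[of \<xi>] unfolding leq_def by auto
    then show ?thesis by (rule h)
  qed
  have "x \<in> G \<and> Theta x \<subseteq> (\<Union>k. Theta (pt (p k)))"
    unfolding x_def
  proof (rule Ok_final)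
    show "Ok (pt (p k)) (dm (p k))" for k by (rule Ok)
    show "dm (p j) \<subseteq> dm (p k) \<and> pt (p k) \<inter> dm (p j) = pt (p j)" if "j \<prec> k" for j k
      using p(3)[OF that] unfolding leq_def by simp
  qed (rule early)
  then have xG: "x \<in> G" and Theta: "Theta x \<subseteq> (\<Union>k. Theta (pt (p k)))" by auto
  have xdm: "x \<inter> dm (p k) = pt (p k)" for k
  proof -
    have "pt (p j) \<inter> dm (p k) \<subseteq> pt (p k)" for j
      using lin[of j k] Ok_dom[OF Ok[of j]] unfolding leq_def by auto
    then show ?thesis using Ok_dom[OF Ok[of k]] unfolding x_def by auto
  qed
  have lock: "Theta (pt (p k)) \<subseteq> Theta x" for k by (rule Theta_lock[OF Ok xdm])
  have frTh: "Th i x = Th i (pt (p k))" if i: "i \<in> fr (p k)" for i k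
  proof
    show "Th i (pt (p k)) \<subseteq> Th i x" by (rule Th_subset[OF lock])
    have "Th i (pt (p j)) \<subseteq> Th i (pt (p k))" for j
    proof (cases "leq (p j) (p k)")
      case True then show ?thesis using i unfolding leq_def by auto
    next
      case False
      then have "pt (p k) \<inter> dm (p j) = pt (p j)" using lin unfolding leq_def by blast
      then show ?thesis by (rule Th_subset[OF Theta_lock[OF Ok]])
    qed
    moreover have "Th i x \<subseteq> (\<Union>j. Th i (pt (p j)))" using subsetD[OF Theta] unfolding Th_def by fastforce
    ultimately show "Th i x \<subseteq> Th i (pt (p k))" by blast
  qed
  have fr: "\<exists>k'. k \<prec> k' \<and> i \<in> fr (p k')" for i k using ach[of k "Freeze i"] by simp
  have "Bd x" unfolding Bd_def
  proof
    fix i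
    obtain k where k: "i \<in> fr (p k)" using fr by blast
    have "Bd (pt (p k))" using p(1)[of k] unfolding valid_def by simp
    then show "\<exists>m. \<forall>m' e. (m', e) \<in> Th i x \<longrightarrow> m' \<prec> m" unfolding frTh[OF k] Bd_def by (rule spec)
  qed
  then have pts: "x \<in> pts (p k)" for k using xG xdm frTh unfolding pts_def by simp
  have tr: "i \<in> tr (p k) \<Longrightarrow> i \<in> leaf_values x" and fa: "i \<in> fa (p k) \<Longrightarrow> i \<notin> leaf_values x" for i k
    using frTh[of i k] unfolding tr_def fa_def leaf_values_def by auto
  \<comment> \<open>A promised leaf is frozen sooner or later, and then necessarily false, as
    \<open>tr\<close> and \<open>lz\<close> are disjoint.\<close>
  have qz: "i \<notin> leaf_values x" if i: "i \<in> qz (p k)" for i k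
  proof -
    obtain k' where k': "k \<prec> k'" "i \<in> fr (p k')" using fr by blast
    then have "i \<in> qz (p k')" using leq_qz[OF p(3)] i by blast
    then have "i \<in> fa (p k')" using k'(2) p(1)[of k'] unfolding qz_def valid_def tr_def fa_def by auto
    then show ?thesis by (rule fa)
  qed
  have ev: "\<forall>k e. ev (p k) l e \<longrightarrow> tv {} (leaf_values x) (- leaf_values x) l e" for l
  proof (induction l rule: rank_induct)
    case (1 l)
    show ?case
    proof (intro allI impI)
      fix k e assume l: "ev (p k) l e"
      show "tv {} (leaf_values x) (- leaf_values x) l e"
      proof (cases e)
        case True
        then have "tv (nz (p k)) (tr (p k)) (qz (p k)) l True" using l unfolding ev_def by simp
        then have "tv {} (leaf_values x) (- leaf_values x) l True"
        proof cases
          case all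
          show ?thesis
          proof (rule tv.all)
            show "(l, i) \<in> - leaf_values x" for i using qz all(1) by blast
            show "tv {} (leaf_values x) (- leaf_values x) c False" if "child c l" for c
              using 1[OF that] all(2)[OF that] unfolding ev_def by blast
          qed
        qed auto
        then show ?thesis using True by simp
      next
        case False
        \<comment> \<open>The point itself makes no promises, so falsity of \<open>l\<close> needs a
          cause. The task \<open>Resolve\<close> replaces a promise on \<open>l\<close> by a true
          leaf.\<close>
        obtain k' where k': "k \<prec> k'" "l \<in> nz (p k') \<longrightarrow> (\<exists>i. (l, i) \<in> tr (p k'))"
          using ach[of k "Resolve l"] by auto
        have "tv (nz (p k')) (tr (p k')) (qz (p k')) l False"
          using ev_mono[OF p(3)[OF k'(1)] l] False unfolding ev_def by simp
        then have "tv {} (leaf_values x) (- leaf_values x) l False"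
        proof cases
          case node
          then show ?thesis using k'(2) tr by (blast intro: tv.leaf)
        next
          case (leaf i)
          then show ?thesis using tr by (blast intro: tv.leaf)
        next
          case (child c)
          then show ?thesis using 1[of c] unfolding ev_def by (blast intro: tv.child)
        qed auto
        then show ?thesis using False by simp
      qed
    qed
  qed
  have truth: "x \<in> sem C' \<longleftrightarrow> (\<exists>k. forces C' (p k))"
    if "code_open J C'" "\<And>gs k. \<exists>k'. k \<prec> k' \<and> decided (sub_code C' gs) (p k')" for C'
    using that
  proof (induction C')
    case (Copen U)
    show ?case
    proof
      assume "x \<in> sem (Copen U)"
      then have "x \<in> U" by simp
      then obtain D where D: "D \<in> J" "\<And>x'. x' \<inter> D = x \<inter> D \<Longrightarrow> x' \<in> U"
        using Copen(1) unfolding open_in_def code_open.simps by blast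
      obtain k where k: "decided (Copen U) (p k)" using Copen(2)[of undefined "[]"] by auto
      \<comment> \<open>No domain of the sequence need cover \<open>D\<close>. So \<open>x\<close>
        itself, restricted to a null set containing \<open>D\<close>, becomes a condition; it forces
        \<open>U\<close>, hence the deciding condition \<open>p k\<close> cannot exclude
        \<open>U\<close> and must force it.\<close>
      have "D \<union> dm (p k) \<in> J" using D(1) Ok_dom[OF Ok] J_Un by blast
      then obtain D' where D': "D \<union> dm (p k) \<subseteq> D'" "Ok (x \<inter> D') D'" "Theta (x \<inter> D') \<subseteq> Theta x"
        using G_local[OF xG] by blast
      define s where "s = Cond (x \<inter> D') D' (fr (p k)) (nz (p k)) (lz (p k))"
      have sdm: "(x \<inter> D') \<inter> dm (p k) = pt (p k)" using D'(1) xdm[of k] by auto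
      have sTh: "Th i (x \<inter> D') = Th i (pt (p k))" if "i \<in> fr (p k)" for i
        using Th_subset[OF D'(3), of i] frTh[OF that] Th_subset[OF Theta_lock[OF Ok sdm], of i] by blast
      have "Bd (x \<inter> D')" unfolding Bd_def
      proof
        fix i
        have "\<exists>m. \<forall>m' e. (m', e) \<in> Th i x \<longrightarrow> m' \<prec> m" using \<open>Bd x\<close> unfolding Bd_def by (rule spec)
        then show "\<exists>m. \<forall>m' e. (m', e) \<in> Th i (x \<inter> D') \<longrightarrow> m' \<prec> m"
          using Th_subset[OF D'(3), of i] by blast
      qed
      moreover have "tr s = tr (p k)" using sTh unfolding tr_def s_def by auto
      ultimately have "valid s" using p(1)[of k] D'(2) unfolding valid_def by (simp add: s_def)
      moreover have "leq s (p k)" using sdm sTh D'(1) ev_node[of _ s]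
        unfolding leq_def by (auto simp: s_def qz_def)
      moreover have "pts s \<subseteq> U"
      proof
        fix y assume "y \<in> pts s"
        then have "y \<inter> D' = x \<inter> D'" unfolding pts_def s_def by simp
        then have "y \<inter> D = x \<inter> D" using D'(1) by blast
        then show "y \<in> U" by (rule D(2))
      qed
      ultimately show "\<exists>k. forces (Copen U) (p k)" using k unfolding decided_def by auto
    next
      assume "\<exists>k. forces (Copen U) (p k)"
      then show "x \<in> sem (Copen U)" using pts by auto
    qed
  next
    case (Cunion f)
    have dec: "\<exists>k'. k \<prec> k' \<and> decided (sub_code (f g) gs) (p k')" for g gs k
      using Cunion(3)[of k "g # gs"] by simp
    have IH: "x \<in> sem (f g) \<longleftrightarrow> (\<exists>k. forces (f g) (p k))" for g
    proof (rule Cunion(1))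
      show "f g \<in> range f" by simp
      show "code_open J (f g)" using Cunion(2) by simp
    qed (rule dec)
    show ?case
    proof
      assume "x \<in> sem (Cunion f)"
      then obtain g where g: "\<And>k. \<not> forces (f g) (p k)" using IH by auto
      obtain k where "decided (f g) (p k)" using dec[of undefined g "[]"] by auto
      then show "\<exists>k. forces (Cunion f) (p k)" using g unfolding decided_def by auto
    next
      assume "\<exists>k. forces (Cunion f) (p k)"
      then obtain k g where g: "\<And>q. valid q \<Longrightarrow> leq q (p k) \<Longrightarrow> \<not> forces (f g) q" by auto
      have "\<not> forces (f g) (p j)" for j
      proof
        assume j: "forces (f g) (p j)"
        show False
        proof (cases "leq (p j) (p k)")
          case True then show False using g[OF p(1)] j by blast
        next
          case False
          then have "forces (f g) (p k)" using forces_mono[OF _ j] lin by blast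
          then show False using g[OF p(1) leq_refl[OF p(1)]] by blast
        qed
      qed
      then show "x \<in> sem (Cunion f)" using IH by auto
    qed
  qed
  have truthC: "x \<in> sem C \<longleftrightarrow> (\<exists>k. forces C (p k))"
  proof (rule truth[OF C])
    show "\<exists>k'. k \<prec> k' \<and> decided (sub_code C gs) (p k')" for gs k using ach[of k "Decide gs"] by simp
  qed
  have "tv {} (leaf_values x) (- leaf_values x) [] e" if "ev p0 [] e" for e
    using ev ev_mono[OF p(2) that] by blast
  moreover have "x \<in> sem C" if "forces C p0" using truthC forces_mono[OF p(2) that] by blast
  moreover have "\<exists>s. valid s \<and> leq s p0 \<and> forces C s" if sem: "x \<in> sem C"
  proof -
    obtain k where "forces C (p k)" using truthC sem by blast
    then show ?thesis using p(1,2)[of k] by blast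
  qed
  ultimately show ?thesis by (intro exI[of _ x]) simp
qed

text \<open>A condition without promises leaves the root free, and by the truth lemma a code of the
  set would follow the value of the root.\<close>

theorem root_true_not_crank:
  assumes "crank J W a C"
  shows "sem C \<noteq> root_true"
proof
  assume S: "sem C = root_true"
  have C: "code_open J C" using assms by (rule crank_code_open)
  obtain D where D: "Ok {} D" using Ok_empty by blast
  define p where "p = Cond {} D {} {} {}"
  have "valid p" unfolding valid_def Bd_def Th_def touched_def tr_def p_def
    using D by (simp add: Theta_empty small_finite)
  moreover have "free p []" unfolding free_def p_def by simp
  ultimately show False
  proof (rule capture)
    show "rk [] = a" by (simp add: rk_def)
    show "crank J W a C" by fact
    show "\<exists>s. valid s \<and> leq s q \<and> forces C s" if q: "valid q" "leq q p" "ev q [] True" for q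
    proof -
      obtain x where x: "\<forall>e. ev q [] e \<longrightarrow> tv {} (leaf_values x) (- leaf_values x) [] e"
        "forces C q \<longrightarrow> x \<in> sem C" "x \<in> sem C \<longrightarrow> (\<exists>s. valid s \<and> leq s q \<and> forces C s)"
        using generic_truth[OF q(1) C] by (elim exE conjE)
      have "x \<in> root_true" using x(1) q(3) unfolding root_true_def by simp
      then show ?thesis using x(3) unfolding S by simp
    qed
    show "\<not> forces C q" if q: "valid q" "leq q p" "ev q [] False" for q
    proof
      assume f: "forces C q"
      obtain x where x: "\<forall>e. ev q [] e \<longrightarrow> tv {} (leaf_values x) (- leaf_values x) [] e"
        "forces C q \<longrightarrow> x \<in> sem C" "x \<in> sem C \<longrightarrow> (\<exists>s. valid s \<and> leq s q \<and> forces C s)"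
        using generic_truth[OF q(1) C] by (elim exE conjE)
      have "x \<in> root_true" using x(2) f unfolding S by simp
      then show False using x(1) q(3) tv_exclusive[of "leaf_values x" "[]"] unfolding root_true_def by simp
    qed
  qed simp
qed

end

section \<open>Complexity of the coded sets\<close>

text \<open>Recursive form in which all quantifiers range over \<kappa>, as the Borel computation
  requires.\<close>

lemma (in ord_tree) tv_iff:
  "tv {} Y (- Y) l True \<longleftrightarrow> (\<forall>i. (l, i) \<notin> Y) \<and>
     (\<forall>j i. ord_pos W (u j) \<and> (u j, rk l) \<in> W \<and> u j \<noteq> rk l \<longrightarrow> tv {} Y (- Y) ((j, i) # l) False)"
  "tv {} Y (- Y) l False \<longleftrightarrow> (\<exists>i. (l, i) \<in> Y) \<or>
     (\<exists>j i. (ord_pos W (u j) \<and> (u j, rk l) \<in> W \<and> u j \<noteq> rk l) \<and> tv {} Y (- Y) ((j, i) # l) True)"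
proof -
  have *: "(\<exists>c. child c l \<and> R c) \<longleftrightarrow> (\<exists>j i. (ord_pos W (u j) \<and> (u j, rk l) \<in> W \<and> u j \<noteq> rk l) \<and> R ((j, i) # l))" for R
    unfolding child_def by blast
  have **: "(\<forall>c. child c l \<longrightarrow> R c) \<longleftrightarrow> (\<forall>j i. (ord_pos W (u j) \<and> (u j, rk l) \<in> W \<and> u j \<noteq> rk l) \<longrightarrow> R ((j, i) # l))" for R
    using *[of "\<lambda>c. \<not> R c"] by blast
  show "tv {} Y (- Y) l True \<longleftrightarrow> (\<forall>i. (l, i) \<notin> Y) \<and>
     (\<forall>j i. ord_pos W (u j) \<and> (u j, rk l) \<in> W \<and> u j \<noteq> rk l \<longrightarrow> tv {} Y (- Y) ((j, i) # l) False)"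
    using tv.simps[of "{}" Y "- Y" l True] **[of "\<lambda>c. tv {} Y (- Y) c False"] by simp
  show "tv {} Y (- Y) l False \<longleftrightarrow> (\<exists>i. (l, i) \<in> Y) \<or>
     (\<exists>j i. (ord_pos W (u j) \<and> (u j, rk l) \<in> W \<and> u j \<noteq> rk l) \<and> tv {} Y (- Y) ((j, i) # l) True)"
    using tv.simps[of "{}" Y "- Y" l False] *[of "\<lambda>c. tv {} Y (- Y) c True"] by simp
qed

section \<open>Coordinatewise preimages, codes and Borel closure properties\<close>

context ideal_on begin

lemma I_open_iff:
  "I_open J A \<longleftrightarrow> (\<forall>x\<in>A. \<exists>D\<in>J. {x'. \<forall>d\<in>D. x' d = x d} \<subseteq> A)"
proof
  assume "I_open J A"
  then have "generate_topology (I_basis J) A" unfolding I_open_def .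
  then show "\<forall>x\<in>A. \<exists>D\<in>J. {x'. \<forall>d\<in>D. x' d = x d} \<subseteq> A"
  proof induction
    case UNIV then show ?case using J_empty by auto
  next
    case (Int A B)
    show ?case
    proof
      fix x assume x: "x \<in> A \<inter> B"
      obtain D where D: "D \<in> J" "{x'. \<forall>d\<in>D. x' d = x d} \<subseteq> A" using Int.IH(1) x by auto
      obtain E where E: "E \<in> J" "{x'. \<forall>d\<in>E. x' d = x d} \<subseteq> B" using Int.IH(2) x by auto
      show "\<exists>D\<in>J. {x'. \<forall>d\<in>D. x' d = x d} \<subseteq> A \<inter> B"
        using D(2) E(2) by (intro bexI[of _ "D \<union> E"] J_Un D(1) E(1)) auto
    qed
  next
    case (UN K)
    show ?case
    proof
      fix x assume "x \<in> \<Union>K"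
      then obtain k where k: "k \<in> K" "x \<in> k" by (rule UnionE)
      then obtain D where "D \<in> J" "{x'. \<forall>d\<in>D. x' d = x d} \<subseteq> k" using UN(2)[OF k(1)] by auto
      then show "\<exists>D\<in>J. {x'. \<forall>d\<in>D. x' d = x d} \<subseteq> \<Union>K" using k(1) by (intro bexI[of _ D]) auto
    qed
  next
    case (Basis A)
    then obtain D y where D: "D \<in> J" "A = {x. \<forall>d\<in>D. x d = y d}" unfolding I_basis_def by auto
    then show ?case by (intro ballI bexI[of _ D]) auto
  qed
next
  assume A: "\<forall>x\<in>A. \<exists>D\<in>J. {x'. \<forall>d\<in>D. x' d = x d} \<subseteq> A"
  have "A \<subseteq> \<Union>{B \<in> I_basis J. B \<subseteq> A}"
  proof
    fix x assume "x \<in> A"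
    then obtain D where D: "D \<in> J" "{x'. \<forall>d\<in>D. x' d = x d} \<subseteq> A" using A by auto
    have "{x'. \<forall>d\<in>D. x' d = x d} \<in> I_basis J" unfolding I_basis_def using D(1) by auto
    then have "{x'. \<forall>d\<in>D. x' d = x d} \<in> {B \<in> I_basis J. B \<subseteq> A}" using D(2) by simp
    then show "x \<in> \<Union>{B \<in> I_basis J. B \<subseteq> A}" by (rule UnionI) simp
  qed
  then have "A = \<Union>{B \<in> I_basis J. B \<subseteq> A}" by auto
  moreover have "generate_topology (I_basis J) (\<Union>{B \<in> I_basis J. B \<subseteq> A})"
    by (rule generate_topology.UN) (auto intro: generate_topology.Basis)
  ultimately show "I_open J A" unfolding I_open_def by simp
qed

text \<open>Under a coordinatewise map, the image on \<open>D\<close> depends only on the argument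
  on \<open>D\<close>. Every level of the hierarchy is therefore preserved, which links the two
  spaces.\<close>

lemma I_open_preimage:
  assumes "I_open J A" shows "I_open J {x. (\<lambda>i. c (x i)) \<in> A}"
  unfolding I_open_iff
proof
  fix x assume "x \<in> {x. (\<lambda>i. c (x i)) \<in> A}"
  then obtain D where "D \<in> J" "{x'. \<forall>d\<in>D. x' d = c (x d)} \<subseteq> A"
    using assms unfolding I_open_iff by auto
  then show "\<exists>D\<in>J. {x'. \<forall>d\<in>D. x' d = x d} \<subseteq> {x. (\<lambda>i. c (x i)) \<in> A}"
    by (intro bexI[of _ D]) auto
qed

lemma I_Borel_preimage: "I_Borel J A \<Longrightarrow> I_Borel J {x. (\<lambda>i. c (x i)) \<in> A}"
proof (induction rule: I_Borel.induct)
  case (Open A) then show ?case by (intro I_Borel.Open I_open_preimage)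
next
  case (Compl A) then show ?case using I_Borel.Compl[OF Compl.IH] by (simp add: Collect_neg_eq[symmetric])
next
  case (Union F)
  have "{x. (\<lambda>i. c (x i)) \<in> (\<Union>g. F g)} = (\<Union>g. {x. (\<lambda>i. c (x i)) \<in> F g})" by auto
  then show ?case using I_Borel.Union[OF Union.IH] by simp
qed

lemma I_Sigma_preimage: "I_Sigma J W a A \<Longrightarrow> I_Sigma J W a {x. (\<lambda>i. c (x i)) \<in> A}"
proof (induction rule: I_Sigma.induct)
  case (One a A) then show ?case by (intro I_Sigma.One I_open_preimage)
next
  case (Union a F)
  have "{x. (\<lambda>i. c (x i)) \<in> (\<Union>g. F g)} = (\<Union>g. {x. (\<lambda>i. c (x i)) \<in> F g})" by auto
  moreover have "I_Sigma J W a (\<Union>g. {x. (\<lambda>i. c (x i)) \<in> F g})"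
    using Union.hyps(1,2)
  proof (rule I_Sigma.Union)
    fix g
    obtain b where b: "ord_pos W b" "(b, a) \<in> W" "b \<noteq> a" "I_Sigma J W b {x. (\<lambda>i. c (x i)) \<in> - F g}"
      using Union.IH[of g] by blast
    have "{x. (\<lambda>i. c (x i)) \<in> - F g} = - {x. (\<lambda>i. c (x i)) \<in> F g}" by auto
    then show "\<exists>b. ord_pos W b \<and> (b, a) \<in> W \<and> b \<noteq> a \<and> I_Sigma J W b (- {x. (\<lambda>i. c (x i)) \<in> F g})"
      using b by auto
  qed
  ultimately show ?case by simp
qed

text \<open>Sets open for \<open>J\<close> remain open for the larger \<open>K\<close>, so the
  forcing may run over a larger ideal than the one defining the hierarchy.\<close>

lemma I_Sigma_crank:
  assumes "I_Sigma J W a A" "J \<subseteq> K"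
  shows "\<exists>C. crank K W a C \<and> sem C = {X. (\<lambda>i. i \<in> X) \<in> A}"
  using assms(1)
proof induction
  case (One a A)
  have "open_in K {X. (\<lambda>i. i \<in> X) \<in> A}" unfolding open_in_def
  proof
    fix X assume "X \<in> {X. (\<lambda>i. i \<in> X) \<in> A}"
    then obtain D where D: "D \<in> J" "{x'. \<forall>d\<in>D. x' d = (d \<in> X)} \<subseteq> A"
      using One(2) unfolding I_open_iff by auto
    have "(\<lambda>i. i \<in> X') \<in> A" if "X' \<inter> D = X \<inter> D" for X'
      by (rule subsetD[OF D(2)]) (use that in auto)
    then show "\<exists>D\<in>K. \<forall>x'. x' \<inter> D = X \<inter> D \<longrightarrow> x' \<in> {X. (\<lambda>i. i \<in> X) \<in> A}"
      using assms(2) D(1) by (intro bexI[of _ D]) auto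
  qed
  then show ?case using One(1) by (intro exI[of _ "Copen {X. (\<lambda>i. i \<in> X) \<in> A}"]) (simp add: crank.one)
next
  case (Union a F)
  have "\<forall>g. \<exists>C b. ord_pos W b \<and> (b, a) \<in> W \<and> b \<noteq> a \<and> crank K W b C \<and> sem C = {X. (\<lambda>i. i \<in> X) \<in> - F g}"
    using Union.IH by blast
  then obtain f where f: "\<forall>g. \<exists>b. ord_pos W b \<and> (b, a) \<in> W \<and> b \<noteq> a \<and> crank K W b (f g) \<and> sem (f g) = {X. (\<lambda>i. i \<in> X) \<in> - F g}"
    by (rule choice[THEN exE])
  have "crank K W a (Cunion f)" using Union.hyps f by (intro crank.union) blast+
  moreover have "sem (f g) = {X. (\<lambda>i. i \<in> X) \<in> - F g}" for g using f by blast
  ultimately show ?case by (intro exI[of _ "Cunion f"]) auto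
qed

lemma I_Borel_const [simp]: "I_Borel J {x. c}"
  by (rule I_Borel.Open) (use J_empty in \<open>auto simp: I_open_iff\<close>)

lemma I_Borel_not: "I_Borel J {x. P x} \<Longrightarrow> I_Borel J {x. \<not> P x}"
  unfolding Collect_neg_eq by (rule I_Borel.Compl)

lemma I_Borel_ex: "(\<And>g. I_Borel J {x. P g x}) \<Longrightarrow> I_Borel J {x. \<exists>g :: 'k. P g x}"
  unfolding Collect_ex_eq by (rule I_Borel.Union)

lemma I_Borel_all:
  assumes "\<And>g. I_Borel J {x. P g x}" shows "I_Borel J {x. \<forall>g :: 'k. P g x}"
proof -
  have "I_Borel J {x. \<not> (\<exists>g. \<not> P g x)}" by (intro I_Borel_not I_Borel_ex assms)
  then show ?thesis by simp
qed

lemma I_Borel_or: assumes "I_Borel J {x. P x}" "I_Borel J {x. Q x}" shows "I_Borel J {x. P x \<or> Q x}"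
proof -
  obtain c d :: 'k where "c \<noteq> d" using ex_two by metis
  then have "{x. P x \<or> Q x} = {x. \<exists>g. if g = c then P x else Q x}" by auto
  moreover have "I_Borel J {x. if g = c then P x else Q x}" for g using assms by (cases "g = c") simp_all
  ultimately show ?thesis using I_Borel_ex[of "\<lambda>g x. if g = c then P x else Q x"] by simp
qed

lemma I_Borel_and: assumes "I_Borel J {x. P x}" "I_Borel J {x. Q x}" shows "I_Borel J {x. P x \<and> Q x}"
proof -
  have "I_Borel J {x. \<not> (\<not> P x \<or> \<not> Q x)}" by (intro I_Borel_not I_Borel_or assms)
  then show ?thesis by simp
qed

lemma I_Borel_imp: "I_Borel J {x. P x} \<Longrightarrow> I_Borel J {x. Q x} \<Longrightarrow> I_Borel J {x. P x \<longrightarrow> Q x}"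
  unfolding imp_conv_disj by (intro I_Borel_or I_Borel_not)

lemmas I_Borel_intros = I_Borel_const I_Borel_not I_Borel_ex I_Borel_all I_Borel_or I_Borel_and I_Borel_imp

end

text \<open>Ranks descend and each node has at most \<kappa> many children, so induction on the rank
  uses unions of length \<kappa> only.\<close>

lemma (in forcing) I_Borel_root_true:
  assumes "ideal_on r I" and open_Theta: "\<And>j. open_in I {X. j \<in> Theta X}"
  shows "I_Borel I {x. Collect x \<in> root_true}"
proof -
  interpret I: ideal_on r I by fact
  have Th: "I_Borel I {x. j \<in> Theta (Collect x)}" for j
  proof (rule I_Borel.Open)
    show "I_open I {x. j \<in> Theta (Collect x)}" unfolding I.I_open_iff
    proof
      fix x assume "x \<in> {x. j \<in> Theta (Collect x)}"
      then have "\<exists>D\<in>I. \<forall>X. X \<inter> D = Collect x \<inter> D \<longrightarrow> j \<in> Theta X"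
        using open_Theta[of j] unfolding open_in_def by simp
      then obtain D where D: "D \<in> I" "\<forall>X. X \<inter> D = Collect x \<inter> D \<longrightarrow> j \<in> Theta X" by (rule bexE)
      have "j \<in> Theta (Collect x')" if "\<forall>d\<in>D. x' d = x d" for x'
        by (rule D(2)[rule_format]) (use that in auto)
      then show "\<exists>D\<in>I. {x'. \<forall>d\<in>D. x' d = x d} \<subseteq> {x. j \<in> Theta (Collect x)}"
        by (intro bexI[of _ D] D(1)) auto
    qed
  qed
  have me: "(m, e) \<in> Th i X \<longleftrightarrow> (\<exists>j. j \<in> Theta X \<and> dec j = (i, m, e))" for m e i X
    unfolding Th_def by auto
  have leaf: "I_Borel I {x. i \<in> leaf_values (Collect x)}" for i
    unfolding leaf_values_def val_def me all_bool_eq mem_Collect_eq by (intro I.I_Borel_intros Th)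
  have "I_Borel I {x. tv {} (leaf_values (Collect x)) (- leaf_values (Collect x)) l True} \<and>
    I_Borel I {x. tv {} (leaf_values (Collect x)) (- leaf_values (Collect x)) l False}" for l
  proof (induction l rule: rank_induct)
    case (1 l)
    let ?C = "\<lambda>j. ord_pos W (u j) \<and> (u j, rk l) \<in> W \<and> u j \<noteq> rk l"
    let ?T = "\<lambda>c e x. tv {} (leaf_values (Collect x)) (- leaf_values (Collect x)) c e"
    have IH: "I_Borel I {x. ?T ((j, i) # l) e x}" if "?C j" for j i e
      using 1[of "(j, i) # l"] that by (cases e) (simp_all add: child_def)
    have T: "I_Borel I {x. ?C j \<longrightarrow> ?T ((j, i) # l) False x}" for j i
      using IH[of j i False] I.I_Borel_const by (cases "?C j") (simp_all only: simp_thms)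
    have F: "I_Borel I {x. ?C j \<and> ?T ((j, i) # l) True x}" for j i
      using IH[of j i True] I.I_Borel_const by (cases "?C j") (simp_all only: simp_thms)
    have "I_Borel I {x. ?T l True x}"
      unfolding tv_iff(1)[of _ l] by (intro I.I_Borel_and I.I_Borel_all T I.I_Borel_not leaf)
    moreover have "I_Borel I {x. ?T l False x}"
      unfolding tv_iff(2)[of _ l] by (intro I.I_Borel_or I.I_Borel_ex F leaf)
    ultimately show ?case by (rule conjI)
  qed
  then show ?thesis unfolding root_true_def by simp
qed

lemma messages_not_collapse:
  fixes r :: "'k rel" and I J :: "'k set set"
  assumes a: "ord_pos (cardSuc r) a" and I: "ideal_on r I"
    and M: "messages r J Theta Ok G h" and IJ: "I \<subseteq> J" and op: "\<And>j. open_in I {X. j \<in> Theta X}"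
  shows "\<exists>A :: ('k \<Rightarrow> bool) set. I_Borel I A \<and> \<not> I_Sigma I (cardSuc r) a A"
proof -
  interpret messages r J Theta Ok G h by fact
  define W where "W = cardSuc r"
  have W: "Card_order W" unfolding W_def by (rule cardSuc_Card_order[OF card_order_r])
  then have wo: "Well_order W" unfolding card_order_on_def by blast
  have ne: "underS W a \<noteq> {}" using a unfolding ord_pos_def W_def underS_def by auto
  \<comment> \<open>An ordinal below \<kappa>^+ has at most \<kappa> many predecessors;
    \<open>u\<close> enumerates them and so provides the ranks of the tree.\<close>
  have "|underS W a| <o W" using card_of_underS[OF W] a unfolding ord_pos_def W_def by simp
  then have "|underS W a| \<le>o r" unfolding W_def by (simp only: cardSuc_ordLeq_ordLess[OF card_order_r card_of_Card_order])
  then have le: "|underS W a| \<le>o |UNIV :: 'k set|" by (rule ordLeq_ordIso_trans[OF _ ordIso_symmetric[OF card_UNIV_r]])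
  from ex_surj_on[OF le ne] obtain u :: "'k \<Rightarrow> 'k set" where u: "range u = underS W a" ..
  from inj_node obtain f2 :: "'k node \<Rightarrow> 'k" where f2: "inj f2" ..
  from inj_pair[OF f2 inj_on_id] obtain f3 :: "'k leaf \<Rightarrow> 'k" where f3: "inj f3" ..
  from inj_bool obtain f4 :: "bool \<Rightarrow> 'k" where f4: "inj f4" ..
  from inj_pair[OF inj_on_id f4] obtain f5 :: "'k \<times> bool \<Rightarrow> 'k" where f5: "inj f5" ..
  from inj_pair[OF f3 f5] obtain f6 :: "'k leaf \<times> 'k \<times> bool \<Rightarrow> 'k" where f6: "inj f6" ..
  from surj_of_inj[OF f6] obtain dec :: "'k \<Rightarrow> 'k leaf \<times> 'k \<times> bool" where dec: "surj dec" ..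
  interpret forcing r J Theta Ok G h W a u dec
  proof
    show "wf (W - Id)" using wo unfolding well_order_on_def by simp
    show "trans W" using wo
      unfolding well_order_on_def linear_order_on_def partial_order_on_def preorder_on_def by simp
    show "\<exists>j. u j = b" if "(b, a) \<in> W" "b \<noteq> a" for b
    proof -
      have "b \<in> range u" using that unfolding u underS_def by simp
      then show ?thesis by auto
    qed
  qed (rule dec)
  define A where "A = {x. Collect x \<in> root_true}"
  have "I_Borel I A" unfolding A_def by (rule I_Borel_root_true[OF I op])
  moreover have "\<not> I_Sigma I W a A"
  proof
    assume "I_Sigma I W a A"
    from ideal_on.I_Sigma_crank[OF I this IJ]
    obtain C where C: "crank J W a C \<and> sem C = {X. (\<lambda>i. i \<in> X) \<in> A}" ..
    have "{X. (\<lambda>i. i \<in> X) \<in> A} = root_true" unfolding A_def by simp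
    then show False using root_true_not_crank[of C] C by simp
  qed
  ultimately show ?thesis unfolding W_def by blast
qed

section \<open>From messages to strictness on both spaces\<close>

definition hierarchy_strict :: "'k rel \<Rightarrow> 'k set set \<Rightarrow> 'k set \<Rightarrow> bool" where
  "hierarchy_strict r I a \<longleftrightarrow>
     {A :: ('k \<Rightarrow> bool) set. I_Sigma I (cardSuc r) a A} \<noteq> {A. I_Borel I A}
   \<and> {A :: ('k \<Rightarrow> 'k) set. I_Sigma I (cardSuc r) a A} \<noteq> {A. I_Borel I A}"

lemma messages_strict:
  fixes r :: "'k rel" and I J :: "'k set set"
  assumes a: "ord_pos (cardSuc r) a" and I: "ideal_on r I"
    and M: "messages r J Theta Ok G h" and IJ: "I \<subseteq> J" and op: "\<And>j. open_in I {X. j \<in> Theta X}"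
  shows "hierarchy_strict r I a"
proof -
  interpret I: ideal_on r I by fact
  from messages_not_collapse[OF a I M IJ op]
  obtain A :: "('k \<Rightarrow> bool) set" where A: "I_Borel I A" "\<not> I_Sigma I (cardSuc r) a A" by auto
  obtain z0 z1 :: 'k where z: "z0 \<noteq> z1" using I.ex_two by metis
  \<comment> \<open>The set is pulled back along comparison with \<open>z1\<close>. Reading truth
    values as \<open>z0\<close> and \<open>z1\<close> is a right inverse of that map, so a low rank
    of \<open>A'\<close> would descend to \<open>A\<close>.\<close>
  define A' where "A' = {f :: 'k \<Rightarrow> 'k. (\<lambda>i. f i = z1) \<in> A}"
  have "I_Borel I A'" unfolding A'_def by (rule I.I_Borel_preimage[OF A(1)])
  moreover have "\<not> I_Sigma I (cardSuc r) a A'"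
  proof
    assume "I_Sigma I (cardSuc r) a A'"
    then have "I_Sigma I (cardSuc r) a {x. (\<lambda>i. if x i then z1 else z0) \<in> A'}" by (rule I.I_Sigma_preimage)
    moreover have "{x. (\<lambda>i. if x i then z1 else z0) \<in> A'} = A" unfolding A'_def using z by simp
    ultimately show False using A(2) by simp
  qed
  ultimately show ?thesis using A unfolding hierarchy_strict_def by auto
qed

section \<open>Ideals with \<kappa> many disjoint positive sets\<close>

lemma (in ideal_on) positive_family_strict:
  assumes a: "ord_pos (cardSuc r) a"
    and B: "\<And>j :: 'k. B j \<notin> J" "\<And>i j. i \<noteq> j \<Longrightarrow> B i \<inter> B j = {}"
  shows "hierarchy_strict r J a"
proof (rule messages_strict[OF a ideal_on_axioms])
  show "messages r J (\<lambda>x. {j. x \<inter> B j \<noteq> {}}) (\<lambda>x D. x \<subseteq> D \<and> D \<in> J) UNIV id"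
  proof
    show "\<exists>D. {} \<subseteq> D \<and> D \<in> J" using J_empty by auto
    show "x \<subseteq> D \<union> D' \<and> D \<union> D' \<in> J" if "x \<subseteq> D \<and> D \<in> J" "D' \<in> J" for x D D'
      using that J_Un by auto
    show "{\<xi>. id \<xi> = k} \<in> J" for k using J_singleton[of k] by simp
    show "\<exists>x' D'. (x' \<subseteq> D' \<and> D' \<in> J) \<and> D \<subseteq> D' \<and> x' \<inter> D = x \<and> {j. x' \<inter> B j \<noteq> {}} = insert m {j. x \<inter> B j \<noteq> {}}"
      if x: "x \<subseteq> D \<and> D \<in> J" for x D m
    proof -
      \<comment> \<open>A null domain never exhausts the positive set \<open>B m\<close>, and by
        disjointness a further point of it tells \<open>m\<close> alone.\<close>
      have "\<not> B m \<subseteq> D" using B(1)[of m] J_subset[of D "B m"] x by auto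
      then obtain \<xi> where \<xi>: "\<xi> \<in> B m" "\<xi> \<notin> D" by auto
      have "\<xi> \<in> B j \<longleftrightarrow> j = m" for j using \<xi> B(2)[of j m] by auto
      then have "{j. insert \<xi> x \<inter> B j \<noteq> {}} = insert m {j. x \<inter> B j \<noteq> {}}" by auto
      then show ?thesis using x \<xi>(2) J_Un[OF J_singleton[of \<xi>], of D]
        by (intro exI[of _ "insert \<xi> x"] exI[of _ "insert \<xi> D"]) auto
    qed
    show "(\<Union>(fst ` C) \<subseteq> \<Union>(snd ` C) \<and> \<Union>(snd ` C) \<in> J) \<and>
        {j. \<Union>(fst ` C) \<inter> B j \<noteq> {}} \<subseteq> (\<Union>x\<in>fst ` C. {j. x \<inter> B j \<noteq> {}})"
      if C: "small r C" "\<And>x D. (x, D) \<in> C \<Longrightarrow> x \<subseteq> D \<and> D \<in> J" for C :: "('k set \<times> 'k set) set"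
    proof -
      have "\<Union>(snd ` C) \<in> J" by (rule J_Union[OF small_image[OF C(1)]]) (use C(2) in auto)
      moreover have "fst z \<subseteq> snd z" if "z \<in> C" for z using C(2)[of "fst z" "snd z"] that by simp
      then have "\<Union>(fst ` C) \<subseteq> \<Union>(snd ` C)" by auto
      ultimately show ?thesis by auto
    qed
    show "\<exists>D'. D \<subseteq> D' \<and> (x \<inter> D' \<subseteq> D' \<and> D' \<in> J) \<and> {j. x \<inter> D' \<inter> B j \<noteq> {}} \<subseteq> {j. x \<inter> B j \<noteq> {}}"
      if "D \<in> J" for x D using that by (intro exI[of _ D]) auto
  qed auto
  show "open_in J {X. j \<in> {j. X \<inter> B j \<noteq> {}}}" for j
    unfolding open_in_def
  proof
    fix x assume "x \<in> {X. j \<in> {j. X \<inter> B j \<noteq> {}}}"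
    then obtain \<xi> where \<xi>: "\<xi> \<in> x" "\<xi> \<in> B j" by auto
    show "\<exists>D\<in>J. \<forall>x'. x' \<inter> D = x \<inter> D \<longrightarrow> x' \<in> {X. j \<in> {j. X \<inter> B j \<noteq> {}}}"
      using \<xi> by (intro bexI[of _ "{\<xi>}"] J_singleton) auto
  qed
qed simp

section \<open>Saturated ideals\<close>

lemma maximal_pairwise:
  "\<exists>M. (\<forall>B\<in>M. P B) \<and> (\<forall>B\<in>M. \<forall>C\<in>M. B \<noteq> C \<longrightarrow> R B C) \<and>
     (\<forall>E. P E \<longrightarrow> (\<forall>B\<in>M. R E B \<and> R B E) \<longrightarrow> E \<in> M)"
proof -
  let ?A = "{M. (\<forall>B\<in>M. P B) \<and> (\<forall>B\<in>M. \<forall>C\<in>M. B \<noteq> C \<longrightarrow> R B C)}"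
  have "\<exists>M\<in>?A. \<forall>X\<in>?A. M \<subseteq> X \<longrightarrow> X = M"
  proof (rule subset_Zorn_nonempty)
    show "?A \<noteq> {}" by (rule ex_in_conv[THEN iffD1], rule exI[of _ "{}"]) simp
    fix C assume C: "subset.chain ?A C"
    have R: "R B B'" if B: "B \<in> X" "X \<in> C" "B' \<in> X'" "X' \<in> C" "B \<noteq> B'" for B B' X X'
    proof -
      have "X \<in> ?A" "X' \<in> ?A" "X \<subseteq> X' \<or> X' \<subseteq> X" using C B unfolding subset_chain_def by auto
      then show ?thesis using B by auto
    qed
    have "C \<subseteq> ?A" using C unfolding subset_chain_def by simp
    then have "P B" if "B \<in> X" "X \<in> C" for B X using that by auto
    then show "\<Union>C \<in> ?A" using R by simp
  qed
  then obtain M where M: "M \<in> ?A" "\<forall>X\<in>?A. M \<subseteq> X \<longrightarrow> X = M" by (rule bexE)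
  have "E \<in> M" if E: "P E" "\<forall>B\<in>M. R E B \<and> R B E" for E
  proof -
    have "insert E M \<in> ?A" using M(1) E by auto
    from M(2)[rule_format, OF this subset_insertI] have "insert E M = M" .
    then show ?thesis by auto
  qed
  then show ?thesis using M(1) by (intro exI[of _ M]) simp
qed

section \<open>Saturation and incompressible functions\<close>

locale saturated_ideal = ideal_on r J for r :: "'k rel" and J :: "'k set set" +
  assumes saturated: "\<nexists>B :: 'k \<Rightarrow> 'k set. (\<forall>j. B j \<notin> J) \<and> (\<forall>i j. i \<noteq> j \<longrightarrow> B i \<inter> B j = {})"
begin

lemma small_positive_family:
  assumes "\<And>B. B \<in> X \<Longrightarrow> B \<notin> J" "\<And>B C. B \<in> X \<Longrightarrow> C \<in> X \<Longrightarrow> B \<noteq> C \<Longrightarrow> B \<inter> C = {}"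
  shows "small r X"
proof (rule ccontr)
  assume "\<not> small r X"
  from not_smallD[OF this] obtain f :: "'k \<Rightarrow> 'k set" where f: "inj f \<and> range f \<subseteq> X" ..
  have X: "f j \<in> X" for j using f by auto
  have "f j \<notin> J" for j using assms(1)[OF X] .
  moreover have "\<forall>i j. i \<noteq> j \<longrightarrow> f i \<inter> f j = {}"
  proof (intro allI impI)
    fix i j :: 'k assume "i \<noteq> j"
    then have "f i \<noteq> f j" using f by (simp add: inj_eq)
    then show "f i \<inter> f j = {}" by (rule assms(2)[OF X X])
  qed
  ultimately have "\<exists>B :: 'k \<Rightarrow> 'k set. (\<forall>j. B j \<notin> J) \<and> (\<forall>i j. i \<noteq> j \<longrightarrow> B i \<inter> B j = {})"
    by (intro exI[of _ f]) simp
  then show False using saturated by (rule notE[rotated])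
qed

lemma small_positive_fibers: "small r {k. {\<xi> \<in> T. g \<xi> = k} \<notin> J}"
proof (rule small_inj)
  let ?f = "\<lambda>k. {\<xi> \<in> T. g \<xi> = k}" and ?S = "{k. {\<xi> \<in> T. g \<xi> = k} \<notin> J}"
  show "inj_on ?f ?S"
  proof (rule inj_onI)
    fix k k' assume k: "k \<in> ?S" and eq: "?f k = ?f k'"
    have "?f k \<notin> J" using k by (rule CollectD)
    then have "?f k \<noteq> {}" using J_empty by metis
    then obtain \<xi> where \<xi>: "\<xi> \<in> ?f k" by (rule ex_in_conv[THEN iffD2, THEN exE])
    then have "\<xi> \<in> ?f k'" unfolding eq .
    then show "k = k'" using \<xi> by simp
  qed
  show "?f ` ?S \<subseteq> ?f ` ?S" by simp
  show "small r (?f ` ?S)" by (rule small_positive_family) auto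
qed

text \<open>Off a countable union of null sets, a descending sequence of functions would descend at
  a single point of \<kappa>.\<close>

lemma wf_below_mod: "wf {(g, h). {\<xi>. \<not> g \<xi> \<prec> h \<xi>} \<in> J}"
  unfolding wf_iff_no_infinite_down_chain
proof
  assume "\<exists>f. \<forall>i. (f (Suc i), f i) \<in> {(g, h). {\<xi>. \<not> g \<xi> \<prec> h \<xi>} \<in> J}"
  then obtain f where f: "\<forall>i. (f (Suc i), f i) \<in> {(g, h). {\<xi>. \<not> g \<xi> \<prec> h \<xi>} \<in> J}" ..
  have "(\<Union>i\<in>UNIV. {\<xi>. \<not> f (Suc i) \<xi> \<prec> f i \<xi>}) \<in> J"
  proof (rule J_UN)
    show "small r (UNIV :: nat set)" by (rule small_countable) simp
    show "{\<xi>. \<not> f (Suc i) \<xi> \<prec> f i \<xi>} \<in> J" for i using f by simp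
  qed
  then have "(\<Union>i\<in>UNIV. {\<xi>. \<not> f (Suc i) \<xi> \<prec> f i \<xi>}) \<noteq> UNIV" using J_proper by metis
  then obtain \<xi> where "\<xi> \<notin> (\<Union>i\<in>UNIV. {\<xi>. \<not> f (Suc i) \<xi> \<prec> f i \<xi>})" by (metis UNIV_eq_I)
  then have \<xi>: "f (Suc i) \<xi> \<prec> f i \<xi>" for i by simp
  have "\<exists>i. f i \<xi> = f 0 \<xi>" by (rule exI[of _ 0]) (rule refl)
  from lt_least[of "\<lambda>m. \<exists>i. f i \<xi> = m", OF this]
  obtain m where m: "(\<exists>i. f i \<xi> = m) \<and> (\<forall>b. b \<prec> m \<longrightarrow> (\<nexists>i. f i \<xi> = b))" ..
  from conjunct1[OF m] obtain i where i: "f i \<xi> = m" ..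
  have "f (Suc i) \<xi> \<prec> m" using \<xi>[of i] unfolding i .
  then have "\<nexists>i'. f i' \<xi> = f (Suc i) \<xi>" by (rule conjunct2[OF m, rule_format])
  then show False by (rule notE) (rule exI, rule refl)
qed

text \<open>Take \<open>h\<close> minimal modulo \<open>J\<close> among the functions with null
  fibres, and a maximal disjoint family of positive sets on which \<open>h\<close> can still be
  pressed down. The family is small by saturation. If it covered almost everything, gluing the
  smaller functions would contradict minimality; so its complement is positive and serves as
  \<open>A\<close>.\<close>

lemma ex_incompressible:
  "\<exists>A h. A \<notin> J \<and> (\<forall>k. {\<xi>. h \<xi> = k} \<in> J) \<and>
     (\<forall>E g. E \<subseteq> A \<longrightarrow> E \<notin> J \<longrightarrow> (\<forall>\<xi>\<in>E. g \<xi> \<prec> h \<xi>) \<longrightarrow> (\<exists>k. {\<xi> \<in> E. g \<xi> = k} \<notin> J))"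
proof -
  define Q where "Q = {h :: 'k \<Rightarrow> 'k. \<forall>k. {\<xi>. h \<xi> = k} \<in> J}"
  have "id \<in> Q" unfolding Q_def using J_singleton by simp
  from wf_below_mod[unfolded wf_eq_minimal, rule_format, OF this]
  obtain h where h: "h \<in> Q" "\<forall>g. (g, h) \<in> {(g, h). {\<xi>. \<not> g \<xi> \<prec> h \<xi>} \<in> J} \<longrightarrow> g \<notin> Q" ..
  define bad where "bad E \<longleftrightarrow> E \<notin> J \<and> (\<exists>g. (\<forall>\<xi>\<in>E. g \<xi> \<prec> h \<xi>) \<and> (\<forall>k. {\<xi> \<in> E. g \<xi> = k} \<in> J))" for E
  obtain M where M: "\<forall>B\<in>M. bad B" "\<forall>B\<in>M. \<forall>C\<in>M. B \<noteq> C \<longrightarrow> B \<inter> C = {}"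
    "\<forall>E. bad E \<longrightarrow> (\<forall>B\<in>M. E \<inter> B = {} \<and> B \<inter> E = {}) \<longrightarrow> E \<in> M"
    using maximal_pairwise[of bad "\<lambda>B C. B \<inter> C = {}"] by (elim exE conjE)
  have smM: "small r M" by (rule small_positive_family) (use M(1,2) in \<open>simp_all add: bad_def\<close>)
  have "\<forall>B\<in>M. \<exists>g. (\<forall>\<xi>\<in>B. g \<xi> \<prec> h \<xi>) \<and> (\<forall>k. {\<xi> \<in> B. g \<xi> = k} \<in> J)"
    using M(1) unfolding bad_def by simp
  from bchoice[OF this] obtain G where
    "\<forall>B\<in>M. (\<forall>\<xi>\<in>B. G B \<xi> \<prec> h \<xi>) \<and> (\<forall>k. {\<xi> \<in> B. G B \<xi> = k} \<in> J)" ..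
  then have G: "\<And>B \<xi>. B \<in> M \<Longrightarrow> \<xi> \<in> B \<Longrightarrow> G B \<xi> \<prec> h \<xi>" "\<And>B k. B \<in> M \<Longrightarrow> {\<xi> \<in> B. G B \<xi> = k} \<in> J"
    by simp_all
  have "- \<Union>M \<notin> J"
  proof
    assume null: "- \<Union>M \<in> J"
    \<comment> \<open>The default value is arbitrary, being used only on a null set.\<close>
    define g where "g \<xi> = (if \<xi> \<in> \<Union>M then G (THE B. B \<in> M \<and> \<xi> \<in> B) \<xi> else \<xi>)" for \<xi>
    have g: "g \<xi> = G B \<xi>" if B: "B \<in> M" "\<xi> \<in> B" for B \<xi>
    proof -
      have "(THE B. B \<in> M \<and> \<xi> \<in> B) = B"
      proof (rule the_equality)
        fix C assume C: "C \<in> M \<and> \<xi> \<in> C"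
        show "C = B"
        proof (rule ccontr)
          assume "C \<noteq> B"
          then have "C \<inter> B = {}" using M(2) B(1) C by simp
          then show False using B(2) C by auto
        qed
      qed (simp add: B)
      moreover have "\<xi> \<in> \<Union>M" using B by auto
      ultimately show ?thesis unfolding g_def by simp
    qed
    have "g \<xi> \<prec> h \<xi>" if "\<xi> \<in> \<Union>M" for \<xi>
    proof -
      obtain B where "B \<in> M" "\<xi> \<in> B" using \<open>\<xi> \<in> \<Union>M\<close> by (rule UnionE)
      then show ?thesis using g G(1) by simp
    qed
    then have "{\<xi>. \<not> g \<xi> \<prec> h \<xi>} \<subseteq> - \<Union>M" by auto
    then have "{\<xi>. \<not> g \<xi> \<prec> h \<xi>} \<in> J" by (rule J_subset[OF null])
    then have "g \<notin> Q" using h(2) by simp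
    moreover have "{\<xi>. g \<xi> = k} \<in> J" for k
    proof (rule J_subset)
      show "(\<Union>B\<in>M. {\<xi> \<in> B. G B \<xi> = k}) \<union> - \<Union>M \<in> J"
        by (intro J_Un null J_UN[OF smM] G(2))
      show "{\<xi>. g \<xi> = k} \<subseteq> (\<Union>B\<in>M. {\<xi> \<in> B. G B \<xi> = k}) \<union> - \<Union>M" using g by auto
    qed
    ultimately show False unfolding Q_def by simp
  qed
  moreover have "\<exists>k. {\<xi> \<in> E. g \<xi> = k} \<notin> J"
    if E: "E \<subseteq> - \<Union>M" "E \<notin> J" "\<forall>\<xi>\<in>E. g \<xi> \<prec> h \<xi>" for E g
  proof (rule ccontr)
    assume "\<not> ?thesis"
    then have "bad E" using E unfolding bad_def by auto
    moreover have "\<forall>B\<in>M. E \<inter> B = {} \<and> B \<inter> E = {}" using E(1) by auto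
    ultimately have "E \<in> M" using M(3) by simp
    then have "E = {}" using E(1) by auto
    then show False using E(2) J_empty by simp
  qed
  ultimately show ?thesis using h(1) unfolding Q_def by (intro exI[of _ "- \<Union>M"] exI[of _ h]) simp
qed

end

section \<open>Normality and stationarity along \<open>h\<close>\<close>

locale normal_ideal = saturated_ideal r J for r :: "'k rel" and J :: "'k set set" +
  fixes h :: "'k \<Rightarrow> 'k"
  assumes h_null: "{\<xi>. h \<xi> = k} \<in> J"
    and normal: "E \<notin> J \<Longrightarrow> (\<And>\<xi>. \<xi> \<in> E \<Longrightarrow> g \<xi> \<prec> h \<xi>) \<Longrightarrow> \<exists>k. {\<xi> \<in> E. g \<xi> = k} \<notin> J"
begin

text \<open>In other words, \<open>h\<close> maps \<open>x\<close> off the club of points closed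
  under \<open>g\<close>. The least element of \<kappa> is closed vacuously and therefore has to be
  exempted.\<close>

definition nonst :: "'k set \<Rightarrow> bool" where
  "nonst x \<longleftrightarrow> (\<exists>g. \<forall>\<xi>\<in>x. (\<forall>i. \<not> i \<prec> h \<xi>) \<or> (\<exists>i. i \<prec> h \<xi> \<and> \<not> g i \<prec> h \<xi>))"

lemma h_bounded_null: "{\<xi>. \<not> b \<prec> h \<xi>} \<in> J"
proof (rule J_subset)
  show "(\<Union>k\<in>{k. k \<prec> b \<or> k = b}. {\<xi>. h \<xi> = k}) \<in> J" by (rule J_UN[OF small_upto h_null])
  show "{\<xi>. \<not> b \<prec> h \<xi>} \<subseteq> (\<Union>k\<in>{k. k \<prec> b \<or> k = b}. {\<xi>. h \<xi> = k})" using lt_linear by auto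
qed

lemma positive_above:
  assumes "E \<notin> J" shows "\<exists>\<xi>\<in>E. b \<prec> h \<xi>"
proof (rule ccontr)
  assume "\<not> ?thesis"
  then have "E \<subseteq> {\<xi>. \<not> b \<prec> h \<xi>}" by auto
  then show False using assms J_subset[OF h_bounded_null] by blast
qed

text \<open>Choosing for each point an index below its \<open>h\<close> is regressive. On a positive
  set it would be constant on a positive part, which lies in a single null
  \<open>D k\<close>.\<close>

lemma diagonal_null:
  assumes "\<And>i. D i \<in> J" shows "{\<xi>. \<exists>i. i \<prec> h \<xi> \<and> \<xi> \<in> D i} \<in> J"
proof (rule ccontr)
  let ?E = "{\<xi>. \<exists>i. i \<prec> h \<xi> \<and> \<xi> \<in> D i}"
  assume E: "?E \<notin> J"
  define g where "g \<xi> = (SOME i. i \<prec> h \<xi> \<and> \<xi> \<in> D i)" for \<xi>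
  have g: "g \<xi> \<prec> h \<xi> \<and> \<xi> \<in> D (g \<xi>)" if "\<xi> \<in> ?E" for \<xi>
    unfolding g_def by (rule someI_ex) (use that in simp)
  have "\<exists>k. {\<xi> \<in> ?E. g \<xi> = k} \<notin> J" by (rule normal[OF E]) (use g in blast)
  then obtain k where k: "{\<xi> \<in> ?E. g \<xi> = k} \<notin> J" ..
  have "{\<xi> \<in> ?E. g \<xi> = k} \<subseteq> D k" using g by auto
  then show False using k J_subset[OF assms] by blast
qed

lemma zero_null: "{\<xi>. \<forall>i. \<not> i \<prec> h \<xi>} \<in> J"
  by (rule J_subset[OF h_bounded_null]) auto

lemma nonst_subset: "nonst x \<Longrightarrow> y \<subseteq> x \<Longrightarrow> nonst y"
  unfolding nonst_def by (elim exE, rule exI) (rule ballI, drule subsetD, assumption, drule bspec)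

lemma nonst_empty [simp]: "nonst {}"
  unfolding nonst_def by simp

lemma nonst_zero: "nonst {\<xi>. \<forall>i. \<not> i \<prec> h \<xi>}"
  unfolding nonst_def by simp

lemma nonst_bounded: "nonst {\<xi>. \<not> b \<prec> h \<xi>}"
  unfolding nonst_def by (rule exI[of _ "\<lambda>_. b"]) auto

lemma nonst_null: assumes "nonst x" shows "x \<in> J"
proof -
  from assms[unfolded nonst_def]
  obtain g where g: "\<forall>\<xi>\<in>x. (\<forall>i. \<not> i \<prec> h \<xi>) \<or> (\<exists>i. i \<prec> h \<xi> \<and> \<not> g i \<prec> h \<xi>)" ..
  show ?thesis
  proof (rule J_subset)
    show "{\<xi>. \<forall>i. \<not> i \<prec> h \<xi>} \<union> {\<xi>. \<exists>i. i \<prec> h \<xi> \<and> \<xi> \<in> {\<xi>. \<not> g i \<prec> h \<xi>}} \<in> J"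
      by (intro J_Un zero_null diagonal_null h_bounded_null)
    show "x \<subseteq> {\<xi>. \<forall>i. \<not> i \<prec> h \<xi>} \<union> {\<xi>. \<exists>i. i \<prec> h \<xi> \<and> \<xi> \<in> {\<xi>. \<not> g i \<prec> h \<xi>}}" using g by auto
  qed
qed

lemma nonst_diagonal:
  assumes "\<And>i. nonst (x i)" shows "nonst {\<xi>. \<exists>i. i \<prec> h \<xi> \<and> \<xi> \<in> x i}"
proof -
  have "\<forall>i. \<exists>g. \<forall>\<xi>\<in>x i. (\<forall>m. \<not> m \<prec> h \<xi>) \<or> (\<exists>m. m \<prec> h \<xi> \<and> \<not> g m \<prec> h \<xi>)"
    using assms unfolding nonst_def by simp
  from choice[OF this]
  obtain g where "\<forall>i. \<forall>\<xi>\<in>x i. (\<forall>m. \<not> m \<prec> h \<xi>) \<or> (\<exists>m. m \<prec> h \<xi> \<and> \<not> g i m \<prec> h \<xi>)" ..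
  then have g: "\<And>i \<xi>. \<xi> \<in> x i \<Longrightarrow> (\<forall>m. \<not> m \<prec> h \<xi>) \<or> (\<exists>m. m \<prec> h \<xi> \<and> \<not> g i m \<prec> h \<xi>)"
    by simp
  \<comment> \<open>The value \<open>b n\<close> dominates all \<open>g i m\<close> with
    \<open>i\<close> and \<open>m\<close> up to \<open>n\<close>. Two indices below
    \<open>h \<xi>\<close> have their maximum below \<open>h \<xi>\<close>, so closure under
    \<open>b\<close> implies closure under each \<open>g i\<close> concerned.\<close>
  have "\<forall>n. \<exists>b. \<forall>s\<in>(\<Union>i\<in>{i. i \<prec> n \<or> i = n}. g i ` {m. m \<prec> n \<or> m = n}). s \<prec> b"
    by (intro allI small_bounded small_UN small_image small_upto)
  from choice[OF this]
  obtain b where "\<forall>n. \<forall>s\<in>(\<Union>i\<in>{i. i \<prec> n \<or> i = n}. g i ` {m. m \<prec> n \<or> m = n}). s \<prec> b n" ..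
  then have b: "\<And>n i m. i \<prec> n \<or> i = n \<Longrightarrow> m \<prec> n \<or> m = n \<Longrightarrow> g i m \<prec> b n" by blast
  show ?thesis unfolding nonst_def
  proof (intro exI[of _ b] ballI)
    fix \<xi> assume "\<xi> \<in> {\<xi>. \<exists>i. i \<prec> h \<xi> \<and> \<xi> \<in> x i}"
    then obtain i where i: "i \<prec> h \<xi>" "\<xi> \<in> x i" by auto
    obtain m where m: "m \<prec> h \<xi>" "\<not> g i m \<prec> h \<xi>" using g[OF i(2)] i(1) by auto
    have "\<exists>n. n \<prec> h \<xi> \<and> (i \<prec> n \<or> i = n) \<and> (m \<prec> n \<or> m = n)"
      using lt_linear[of i m] i(1) m(1) by auto
    then obtain n where n: "n \<prec> h \<xi>" "g i m \<prec> b n" using b by auto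
    then have "\<not> b n \<prec> h \<xi>" using m(2) lt_trans by blast
    then show "(\<forall>i. \<not> i \<prec> h \<xi>) \<or> (\<exists>i. i \<prec> h \<xi> \<and> \<not> b i \<prec> h \<xi>)" using n(1) by blast
  qed
qed

lemma nonst_UN: assumes "small r S" "\<And>s. s \<in> S \<Longrightarrow> nonst (F s)" shows "nonst (\<Union>s\<in>S. F s)"
proof -
  have "\<forall>s\<in>S. \<exists>g. \<forall>\<xi>\<in>F s. (\<forall>m. \<not> m \<prec> h \<xi>) \<or> (\<exists>m. m \<prec> h \<xi> \<and> \<not> g m \<prec> h \<xi>)"
    using assms(2) unfolding nonst_def by simp
  from bchoice[OF this]
  obtain g where "\<forall>s\<in>S. \<forall>\<xi>\<in>F s. (\<forall>m. \<not> m \<prec> h \<xi>) \<or> (\<exists>m. m \<prec> h \<xi> \<and> \<not> g s m \<prec> h \<xi>)" ..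
  then have g: "\<And>s \<xi>. s \<in> S \<Longrightarrow> \<xi> \<in> F s \<Longrightarrow> (\<forall>m. \<not> m \<prec> h \<xi>) \<or> (\<exists>m. m \<prec> h \<xi> \<and> \<not> g s m \<prec> h \<xi>)"
    by simp
  have "\<forall>n. \<exists>b. \<forall>t\<in>(\<lambda>s. g s n) ` S. t \<prec> b" by (intro allI small_bounded small_image assms(1))
  from choice[OF this] obtain b where "\<forall>n. \<forall>t\<in>(\<lambda>s. g s n) ` S. t \<prec> b n" ..
  then have b: "\<And>n s. s \<in> S \<Longrightarrow> g s n \<prec> b n" by simp
  show ?thesis unfolding nonst_def
  proof (intro exI[of _ b] ballI)
    fix \<xi> assume "\<xi> \<in> (\<Union>s\<in>S. F s)"
    then obtain s where s: "s \<in> S" "\<xi> \<in> F s" by auto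
    show "(\<forall>i. \<not> i \<prec> h \<xi>) \<or> (\<exists>i. i \<prec> h \<xi> \<and> \<not> b i \<prec> h \<xi>)"
    proof (cases "\<forall>i. \<not> i \<prec> h \<xi>")
      case False
      then obtain m where m: "m \<prec> h \<xi>" "\<not> g s m \<prec> h \<xi>" using g[OF s] by auto
      then have "\<not> b m \<prec> h \<xi>" using lt_trans[OF b[OF s(1), of m]] by blast
      then show ?thesis using m(1) by blast
    qed simp
  qed
qed

lemma nonst_Un: "nonst x \<Longrightarrow> nonst y \<Longrightarrow> nonst (x \<union> y)"
  using nonst_UN[of "{x, y}" id] small_finite[of "{x, y}"] by auto

text \<open>Saturation leaves few positive fibres, so their values have a bound. Beyond it all
  fibres are null, and by normality the points there form a null set.\<close>

lemma regressive_bounded: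
  assumes "\<And>\<xi>. \<xi> \<in> T \<Longrightarrow> g \<xi> \<prec> h \<xi>"
  shows "\<exists>b. {\<xi> \<in> T. \<not> g \<xi> \<prec> b} \<in> J"
proof -
  obtain b where b: "\<forall>k\<in>{k. {\<xi> \<in> T. g \<xi> = k} \<notin> J}. k \<prec> b"
    using small_bounded[OF small_positive_fibers, of T g] by auto
  have "{\<xi> \<in> T. \<not> g \<xi> \<prec> b} \<in> J"
  proof (rule ccontr)
    assume R: "{\<xi> \<in> T. \<not> g \<xi> \<prec> b} \<notin> J"
    have "\<exists>k. {\<xi> \<in> {\<xi> \<in> T. \<not> g \<xi> \<prec> b}. g \<xi> = k} \<notin> J" by (rule normal[OF R]) (use assms in simp)
    then obtain k where k: "{\<xi> \<in> {\<xi> \<in> T. \<not> g \<xi> \<prec> b}. g \<xi> = k} \<notin> J" ..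
    have "\<not> k \<prec> b"
    proof
      assume "k \<prec> b"
      then have "{\<xi> \<in> {\<xi> \<in> T. \<not> g \<xi> \<prec> b}. g \<xi> = k} = {}" by auto
      then show False using k J_empty by metis
    qed
    moreover have "{\<xi> \<in> T. g \<xi> = k} \<notin> J"
      using k J_subset[of "{\<xi> \<in> T. g \<xi> = k}" "{\<xi> \<in> {\<xi> \<in> T. \<not> g \<xi> \<prec> b}. g \<xi> = k}"] by auto
    ultimately show False using b by auto
  qed
  then show ?thesis by blast
qed

text \<open>The classical fact that a stationary set consists, on a stationary part, of points at
  which it does not reflect.\<close>
lemma stationary_null_part:
  assumes F: "F \<notin> J" shows "\<exists>E\<subseteq>F. E \<in> J \<and> \<not> nonst E"
proof -
  define ok where "ok g \<eta> \<longleftrightarrow> (\<exists>i. i \<prec> \<eta>) \<and> (\<forall>i. i \<prec> \<eta> \<longrightarrow> g i \<prec> \<eta>)" for g \<eta>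
  have nst: "nonst x \<longleftrightarrow> (\<exists>g. \<forall>\<xi>\<in>x. \<not> ok g (h \<xi>))" for x
  proof -
    have "((\<forall>i. \<not> i \<prec> \<eta>) \<or> (\<exists>i. i \<prec> \<eta> \<and> \<not> g i \<prec> \<eta>)) \<longleftrightarrow> \<not> ok g \<eta>" for g \<eta>
      unfolding ok_def by simp
    then show ?thesis unfolding nonst_def by simp
  qed
  \<comment> \<open>Failure of reflection at \<open>\<xi>\<close>: the closure points of
    \<open>g\<close> avoid the image of \<open>F\<close> below \<open>h \<xi>\<close>, and
    \<open>h \<xi>\<close> itself is closed.\<close>
  define w where "w \<xi> g \<longleftrightarrow> (\<forall>i. i \<prec> h \<xi> \<longrightarrow> g i \<prec> h \<xi>) \<and> (\<forall>\<eta>\<in>h ` F. \<eta> \<prec> h \<xi> \<longrightarrow> \<not> ok g \<eta>)" for \<xi> g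
  define T where "T = {\<xi> \<in> F. \<exists>g. w \<xi> g}"
  have "\<not> nonst T"
  proof
    assume "nonst T"
    from this[unfolded nst] obtain g where g: "\<forall>\<xi>\<in>T. \<not> ok g (h \<xi>)" ..
    have "\<not> nonst F" using F nonst_null by auto
    then have "\<exists>\<xi>\<in>F. ok g (h \<xi>)" unfolding nst by simp
    then obtain \<xi>0 where "\<xi>0 \<in> F" "ok g (h \<xi>0)" by (rule bexE)
    then have "h \<xi>0 \<in> h ` F \<and> ok g (h \<xi>0)" by simp
    \<comment> \<open>At the least closed point in the image of \<open>F\<close> reflection fails,
      with \<open>g\<close> as witness.\<close>
    from lt_least[of "\<lambda>\<eta>. \<eta> \<in> h ` F \<and> ok g \<eta>", OF this]
    obtain \<eta> where \<eta>': "(\<eta> \<in> h ` F \<and> ok g \<eta>) \<and> (\<forall>b. b \<prec> \<eta> \<longrightarrow> \<not> (b \<in> h ` F \<and> ok g b))" ..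
    note \<eta> = conjunct1[OF \<eta>'] conjunct2[OF \<eta>']
    from \<eta>(1) obtain \<xi> where \<xi>: "\<xi> \<in> F" "\<eta> = h \<xi>" by (elim conjE imageE)
    have "w \<xi> g" using \<eta> \<xi> unfolding w_def ok_def by auto
    then have "\<xi> \<in> T" using \<xi> unfolding T_def by auto
    then show False using g \<eta>(1) \<xi>(2) by auto
  qed
  moreover have "T \<in> J"
  proof (rule ccontr)
    assume T: "T \<notin> J"
    define g where "g \<xi> = (SOME g. w \<xi> g)" for \<xi>
    have g: "w \<xi> (g \<xi>)" if "\<xi> \<in> T" for \<xi>
    proof -
      have "\<exists>g. w \<xi> g" using that unfolding T_def by simp
      then show ?thesis unfolding g_def by (rule someI_ex)
    qed
    \<comment> \<open>Each coordinate of the witnesses is regressive on \<open>T\<close>, so one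
      function \<open>b\<close> bounds all of them off a diagonal union of null sets. A point closed
      under \<open>b\<close> is then closed under the witness of a larger point, which that witness
      forbids.\<close>
    have "\<forall>i. \<exists>b. {\<xi> \<in> {\<xi> \<in> T. i \<prec> h \<xi>}. \<not> g \<xi> i \<prec> b} \<in> J"
      by (rule allI, rule regressive_bounded) (use g in \<open>auto simp: w_def\<close>)
    from choice[OF this] obtain b where b: "\<forall>i. {\<xi> \<in> {\<xi> \<in> T. i \<prec> h \<xi>}. \<not> g \<xi> i \<prec> b i} \<in> J" ..
    define N where "N = {\<xi>. \<exists>i. i \<prec> h \<xi> \<and> \<xi> \<in> {\<xi> \<in> {\<xi> \<in> T. i \<prec> h \<xi>}. \<not> g \<xi> i \<prec> b i}}"
    have "N \<in> J" unfolding N_def by (rule diagonal_null[OF b[rule_format]])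
    then have T': "T - N \<notin> J" using T J_Un[of "T - N" N] J_subset[of "T - N \<union> N" T] by auto
    have bnd: "g \<xi> i \<prec> b i" if "\<xi> \<in> T - N" "i \<prec> h \<xi>" for \<xi> i using that unfolding N_def by auto
    have "\<not> nonst (T - N)" using T' nonst_null by auto
    then have "\<exists>\<xi>\<in>T - N. ok b (h \<xi>)" unfolding nst by simp
    then obtain \<xi>0 where \<xi>0: "\<xi>0 \<in> T - N" "ok b (h \<xi>0)" by (rule bexE)
    from positive_above[OF T', of "h \<xi>0"] obtain \<xi>1 where \<xi>1: "\<xi>1 \<in> T - N" "h \<xi>0 \<prec> h \<xi>1" by (rule bexE)
    have "h \<xi>0 \<in> h ` F" using \<xi>0(1) unfolding T_def by auto
    then have "\<not> ok (g \<xi>1) (h \<xi>0)" using g[of \<xi>1] \<xi>1 unfolding w_def by auto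
    then obtain i where i: "i \<prec> h \<xi>0" "\<not> g \<xi>1 i \<prec> h \<xi>0" using \<xi>0(2) unfolding ok_def by auto
    have "g \<xi>1 i \<prec> b i" using bnd[OF \<xi>1(1) lt_trans[OF i(1) \<xi>1(2)]] .
    also have "b i \<prec> h \<xi>0" using \<xi>0(2) i(1) unfolding ok_def by auto
    finally show False using i(2) by simp
  qed
  moreover have "T \<subseteq> F" unfolding T_def by auto
  ultimately show ?thesis by blast
qed

section \<open>Families of events and the ideal of null families\<close>

definition null :: "'k set set \<Rightarrow> bool" where
  "null Z \<longleftrightarrow> (\<exists>D\<in>J. \<forall>E\<in>Z. nonst (E - D))"

lemma null_subset: "null Z \<Longrightarrow> Y \<subseteq> Z \<Longrightarrow> null Y"
  unfolding null_def by (elim bexE, rule bexI) auto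

lemma null_singleton: "E \<in> J \<Longrightarrow> null {E}"
  unfolding null_def by (rule bexI[of _ E]) simp_all

text \<open>One diagonal union along \<open>h\<close> covers all the families: it loses from
  \<open>D i\<close> only points whose \<open>h\<close> is not above \<open>i\<close>, a
  nonstationary set. So null families are closed under \<kappa> many unions, although
  \<open>J\<close> is only \<kappa>-complete by assumption.\<close>

lemma null_Union:
  assumes "\<And>i :: 'k. null (Z i)" shows "null (\<Union>i. Z i)"
proof -
  have "\<forall>i. \<exists>D. D \<in> J \<and> (\<forall>E\<in>Z i. nonst (E - D))" using assms unfolding null_def by (simp add: Bex_def)
  from choice[OF this] obtain D where D: "\<forall>i. D i \<in> J \<and> (\<forall>E\<in>Z i. nonst (E - D i))" ..
  show ?thesis unfolding null_def
  proof (rule bexI[of _ "{\<xi>. \<exists>i. i \<prec> h \<xi> \<and> \<xi> \<in> D i}"])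
    let ?D = "{\<xi>. \<exists>i. i \<prec> h \<xi> \<and> \<xi> \<in> D i}"
    show "?D \<in> J" by (rule diagonal_null) (simp add: D)
    show "\<forall>E\<in>\<Union>i. Z i. nonst (E - ?D)"
    proof
    fix E assume "E \<in> (\<Union>i. Z i)"
    then obtain i where "E \<in> Z i" by (rule UN_E)
    then have "nonst (E - D i)" using D by simp
    then have "nonst ((E - D i) \<union> {\<xi>. \<not> i \<prec> h \<xi>})" by (rule nonst_Un[OF _ nonst_bounded])
    then show "nonst (E - ?D)" by (rule nonst_subset) auto
    qed
  qed
qed

lemma null_Un: assumes "null Y" "null Z" shows "null (Y \<union> Z)"
proof -
  obtain c d :: 'k where cd: "c \<noteq> d" using ex_two by metis
  have "null (\<Union>i. if i = c then Y else Z)" by (rule null_Union) (simp add: assms)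
  moreover have "Y \<union> Z \<subseteq> (\<Union>i. if i = c then Y else Z)"
    using cd by (auto split: if_splits)
  ultimately show ?thesis by (rule null_subset)
qed

text \<open>Otherwise the null subfamilies would form a \<kappa>^+-complete prime ideal on
  \<open>Z\<close>. An event is determined by \<kappa> many membership questions, so almost all
  members would equal the set \<open>X\<close> of prevailing answers; but one null set alone is a
  null family.\<close>

lemma ex_split:
  assumes Z: "\<not> null Z" "Z \<subseteq> J"
  shows "\<exists>Y\<subseteq>Z. \<not> null Y \<and> \<not> null (Z - Y)"
proof (rule ccontr)
  assume no: "\<not> ?thesis"
  have alt: "null {E \<in> Z. \<xi> \<in> E} \<or> null {E \<in> Z. \<xi> \<notin> E}" for \<xi>
  proof -
    have "Z - {E \<in> Z. \<xi> \<in> E} = {E \<in> Z. \<xi> \<notin> E}" by auto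
    then show ?thesis using no by (metis (no_types, lifting) mem_Collect_eq subsetI)
  qed
  define X where "X = {\<xi>. null {E \<in> Z. \<xi> \<notin> E}}"
  have "null (\<Union>\<xi>. {E \<in> Z. (\<xi> \<in> E) \<noteq> (\<xi> \<in> X)})"
  proof (rule null_Union)
    fix \<xi>
    show "null {E \<in> Z. (\<xi> \<in> E) \<noteq> (\<xi> \<in> X)}"
      using alt[of \<xi>] by (cases "\<xi> \<in> X") (simp_all add: X_def)
  qed
  moreover have "null (Z \<inter> {X})"
  proof (cases "X \<in> Z")
    case True
    then have "X \<in> J" using Z(2) by auto
    then show ?thesis by (rule null_subset[OF null_singleton]) auto
  next
    case False
    then show ?thesis by (intro null_subset[OF null_singleton[OF J_empty]]) auto
  qed
  ultimately have "null ((\<Union>\<xi>. {E \<in> Z. (\<xi> \<in> E) \<noteq> (\<xi> \<in> X)}) \<union> (Z \<inter> {X}))" by (rule null_Un)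
  moreover have "Z \<subseteq> (\<Union>\<xi>. {E \<in> Z. (\<xi> \<in> E) \<noteq> (\<xi> \<in> X)}) \<union> (Z \<inter> {X})" by auto
  ultimately have "null Z" by (rule null_subset)
  then show False using Z(1) by simp
qed

text \<open>If a null set covered a maximal almost disjoint family, its positive complement would
  contain a null stationary set, which contradicts maximality.\<close>

lemma ex_maximal_family:
  "\<exists>A. (\<forall>E\<in>A. E \<in> J \<and> \<not> nonst E) \<and> (\<forall>E\<in>A. \<forall>F\<in>A. E \<noteq> F \<longrightarrow> nonst (E \<inter> F)) \<and> \<not> null A"
proof -
  obtain A where A: "\<forall>E\<in>A. E \<in> J \<and> \<not> nonst E" "\<forall>E\<in>A. \<forall>F\<in>A. E \<noteq> F \<longrightarrow> nonst (E \<inter> F)"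
    "\<forall>E. (E \<in> J \<and> \<not> nonst E) \<longrightarrow> (\<forall>B\<in>A. nonst (E \<inter> B) \<and> nonst (B \<inter> E)) \<longrightarrow> E \<in> A"
    using maximal_pairwise[of "\<lambda>E. E \<in> J \<and> \<not> nonst E" "\<lambda>B C. nonst (B \<inter> C)"] by (elim exE conjE)
  have "\<not> null A"
  proof
    assume "null A"
    from this[unfolded null_def] obtain D where D: "D \<in> J" "\<forall>E\<in>A. nonst (E - D)" by (rule bexE)
    have "- D \<notin> J" using J_Un[of D "- D"] D(1) J_proper by (auto simp: Compl_partition)
    from stationary_null_part[OF this] obtain E where E: "E \<subseteq> - D \<and> E \<in> J \<and> \<not> nonst E" ..
    have *: "nonst (E \<inter> B)" if "B \<in> A" for B
      by (rule nonst_subset[of "B - D"]) (use D(2) that E in auto)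
    then have "\<forall>B\<in>A. nonst (E \<inter> B) \<and> nonst (B \<inter> E)" by (simp add: Int_commute)
    then have "E \<in> A" using A(3) E by simp
    then have "nonst (E \<inter> E)" by (rule *)
    then show False using E by simp
  qed
  then show ?thesis using A(1,2) by (intro exI[of _ A]) simp
qed

end

section \<open>Well-ordered coloured families of events\<close>

locale event_family = normal_ideal r J h for r :: "'k rel" and J h +
  fixes AA :: "'k set set" and ls :: "'k set \<Rightarrow> 'k set \<Rightarrow> bool" and col :: "'k set \<Rightarrow> nat"
  assumes AA_J: "E \<in> AA \<Longrightarrow> E \<in> J" and AA_stat: "E \<in> AA \<Longrightarrow> \<not> nonst E"
    and AA_disj: "E \<in> AA \<Longrightarrow> F \<in> AA \<Longrightarrow> E \<noteq> F \<Longrightarrow> nonst (E \<inter> F)"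
    and ls_trans: "ls E F \<Longrightarrow> ls F K \<Longrightarrow> ls E K" and ls_irrefl: "\<not> ls E E"
    and ls_total: "ls E F \<or> E = F \<or> ls F E" and wf_ls: "wf {(E, F). ls E F}"
    and null_initial: "\<zeta> \<in> AA \<Longrightarrow> null {E \<in> AA. ls E \<zeta>}"
    and not_null_col: "c < 3 \<Longrightarrow> \<not> null {E \<in> AA. col E = c}"

lemma (in normal_ideal) ex_event_family: "\<exists>AA ls col. event_family r J h AA ls col"
proof -
  obtain A where A: "\<forall>E\<in>A. E \<in> J \<and> \<not> nonst E" "\<forall>E\<in>A. \<forall>F\<in>A. E \<noteq> F \<longrightarrow> nonst (E \<inter> F)" "\<not> null A"
    using ex_maximal_family by (elim exE conjE)
  obtain R :: "'k set rel" where R: "Well_order R \<and> Field R = UNIV" using well_ordering by (rule exE)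
  define ls where "ls E F \<longleftrightarrow> (E, F) \<in> R \<and> E \<noteq> F" for E F
  have lin: "trans R" "antisym R" "total_on UNIV R" "wf (R - Id)"
    using conjunct1[OF R, unfolded conjunct2[OF R]]
    unfolding well_order_on_def linear_order_on_def partial_order_on_def preorder_on_def by simp_all
  have ls_trans: "ls E K" if "ls E F" "ls F K" for E F K
  proof -
    have "(E, K) \<in> R" using that lin(1) unfolding ls_def by (meson transD)
    moreover have "E \<noteq> K" using that lin(2) unfolding ls_def by (metis antisymD)
    ultimately show ?thesis unfolding ls_def by simp
  qed
  have ls_total: "ls E F \<or> E = F \<or> ls F E" for E F
    using lin(3) unfolding ls_def total_on_def by auto
  have "{(E, F). ls E F} = R - Id" unfolding ls_def by auto
  then have wf_ls: "wf {(E, F). ls E F}" using lin(4) by simp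
  \<comment> \<open>Cut at the first place where the initial segment is not null. Below it all
    initial segments are null, so no \<kappa> many events are cofinal.\<close>
  have "\<exists>AA\<subseteq>A. \<not> null AA \<and> (\<forall>\<zeta>\<in>AA. null {E \<in> AA. ls E \<zeta>})"
  proof (cases "\<exists>\<zeta>. \<zeta> \<in> {\<zeta>. \<not> null {E \<in> A. ls E \<zeta>}}")
    case True
    then obtain \<zeta>0 where "\<zeta>0 \<in> {\<zeta>. \<not> null {E \<in> A. ls E \<zeta>}}" ..
    from wf_ls[unfolded wf_eq_minimal, rule_format, OF this]
    obtain \<zeta> where \<zeta>: "\<zeta> \<in> {\<zeta>. \<not> null {E \<in> A. ls E \<zeta>}}"
      "\<forall>y. (y, \<zeta>) \<in> {(E, F). ls E F} \<longrightarrow> y \<notin> {\<zeta>. \<not> null {E \<in> A. ls E \<zeta>}}" ..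
    have "null {E \<in> {E \<in> A. ls E \<zeta>}. ls E y}" if "y \<in> {E \<in> A. ls E \<zeta>}" for y
      by (rule null_subset[of "{E \<in> A. ls E y}"]) (use that \<zeta>(2) in auto)
    then show ?thesis using \<zeta>(1) by (intro exI[of _ "{E \<in> A. ls E \<zeta>}"]) simp
  next
    case False
    then show ?thesis using A(3) by (intro exI[of _ A]) simp
  qed
  then obtain AA where AA: "AA \<subseteq> A" "\<not> null AA" "\<forall>\<zeta>\<in>AA. null {E \<in> AA. ls E \<zeta>}" by (elim exE conjE)
  have sub: "AA \<subseteq> J" using AA(1) A(1) by auto
  \<comment> \<open>Two splittings give three colours: 1 opens a message, 2 closes it, 0 is for
    counting.\<close>
  from ex_split[OF AA(2) sub] obtain Y where Y: "Y \<subseteq> AA" "\<not> null Y" "\<not> null (AA - Y)" by (elim exE conjE)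
  have subY: "AA - Y \<subseteq> J" using sub by auto
  from ex_split[OF Y(3) subY] obtain Z where Z: "Z \<subseteq> AA - Y" "\<not> null Z" "\<not> null (AA - Y - Z)" by (elim exE conjE)
  define col :: "'k set \<Rightarrow> nat" where "col E = (if E \<in> Y then 1 else if E \<in> Z then 2 else 0)" for E
  have "\<not> null {E \<in> AA. col E = c}" if c: "c < 3" for c
  proof -
    consider "c = 0" | "c = 1" | "c = 2" using c by linarith
    then show ?thesis
    proof cases
      case 1
      then have "{E \<in> AA. col E = c} = AA - Y - Z" unfolding col_def by auto
      then show ?thesis using Z(3) by simp
    next
      case 2
      then have "{E \<in> AA. col E = c} = Y" using Y(1) unfolding col_def by auto
      then show ?thesis using Y(2) by simp
    next
      case 3
      then have "{E \<in> AA. col E = c} = Z" using Z(1) unfolding col_def by auto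
      then show ?thesis using Z(2) by simp
    qed
  qed
  moreover have "\<not> ls E E" for E unfolding ls_def by simp
  moreover have "E \<in> J \<and> \<not> nonst E" if "E \<in> AA" for E using that AA(1) A(1) by auto
  moreover have "nonst (E \<inter> F)" if "E \<in> AA" "F \<in> AA" "E \<noteq> F" for E F using that AA(1) A(2) by auto
  ultimately have "event_family r J h AA ls col"
    using ls_trans ls_total wf_ls AA(3) normal_ideal_axioms
    unfolding event_family_def event_family_axioms_def by simp
  then show ?thesis by (intro exI[of _ AA] exI[of _ ls] exI[of _ col])
qed

context event_family begin

definition few :: "'k set set \<Rightarrow> bool" where
  "few N \<longleftrightarrow> (\<exists>f :: 'k \<Rightarrow> 'k set. N \<subseteq> range f)"

lemma few_small: assumes "small r N" shows "few N"
proof (cases "N = {}")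
  case True then show ?thesis unfolding few_def by simp
next
  case False
  have "|N| \<le>o r" using assms unfolding small_def by (rule ordLess_imp_ordLeq)
  then have "|N| \<le>o |UNIV :: 'k set|" by (rule ordLeq_ordIso_trans[OF _ ordIso_symmetric[OF card_UNIV_r]])
  from ex_surj_on[OF this False] obtain f :: "'k \<Rightarrow> 'k set" where "range f = N" ..
  then show ?thesis unfolding few_def by (intro exI[of _ f]) simp
qed

lemma not_ls: "\<not> ls E F \<Longrightarrow> E \<noteq> F \<Longrightarrow> ls F E"
  using ls_total[of E F] by simp

lemma ls_asym: "ls E F \<Longrightarrow> \<not> ls F E"
  using ls_trans[of E F E] ls_irrefl[of E] by auto

lemma null_below:
  assumes "few N" "N \<subseteq> AA" shows "null {E \<in> AA. \<exists>\<zeta>\<in>N. E = \<zeta> \<or> ls E \<zeta>}"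
proof -
  from assms(1)[unfolded few_def] obtain f :: "'k \<Rightarrow> 'k set" where f: "N \<subseteq> range f" ..
  have "null (\<Union>i. if f i \<in> N then {E \<in> AA. ls E (f i)} \<union> {f i} else {})"
  proof (rule null_Union)
    fix i
    show "null (if f i \<in> N then {E \<in> AA. ls E (f i)} \<union> {f i} else {})"
    proof (cases "f i \<in> N")
      case True
      then have "f i \<in> AA" using assms(2) by auto
      then have "null ({E \<in> AA. ls E (f i)} \<union> {f i})"
        by (intro null_Un null_initial null_singleton AA_J)
      then show ?thesis using True by simp
    next
      case False
      then show ?thesis using null_subset[OF null_singleton[OF J_empty], of "{}"] by simp
    qed
  qed
  then show ?thesis
  proof (rule null_subset)
    show "{E \<in> AA. \<exists>\<zeta>\<in>N. E = \<zeta> \<or> ls E \<zeta>} \<subseteq> (\<Union>i. if f i \<in> N then {E \<in> AA. ls E (f i)} \<union> {f i} else {})"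
    proof
      fix E assume "E \<in> {E \<in> AA. \<exists>\<zeta>\<in>N. E = \<zeta> \<or> ls E \<zeta>}"
      then obtain \<zeta> where \<zeta>: "E \<in> AA" "\<zeta> \<in> N" "E = \<zeta> \<or> ls E \<zeta>" by auto
      then obtain i where "\<zeta> = f i" using f by auto
      then show "E \<in> (\<Union>i. if f i \<in> N then {E \<in> AA. ls E (f i)} \<union> {f i} else {})"
        using \<zeta> by (intro UN_I[of i]) auto
    qed
  qed
qed

text \<open>The events up to few given ones form a null family, while no colour class is null; hence
  each colour has events above all of them and outside \<open>Z\<close>.\<close>

lemma ex_fresh:
  assumes "few N" "N \<subseteq> AA" "null Z" "c < 3"
  shows "\<exists>E. E \<in> AA \<and> col E = c \<and> E \<notin> Z \<and> (\<forall>\<zeta>\<in>N. ls \<zeta> E)"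
proof -
  have "null ({E \<in> AA. \<exists>\<zeta>\<in>N. E = \<zeta> \<or> ls E \<zeta>} \<union> Z)" by (intro null_Un null_below assms)
  then have "\<not> {E \<in> AA. col E = c} \<subseteq> {E \<in> AA. \<exists>\<zeta>\<in>N. E = \<zeta> \<or> ls E \<zeta>} \<union> Z" (is "\<not> ?A \<subseteq> ?B")
  proof (rule contrapos_pn)
    assume "?A \<subseteq> ?B"
    then show "\<not> null ?B" using not_null_col[OF assms(4)] null_subset[of ?B ?A] by auto
  qed
  then have "\<exists>E. E \<in> ?A \<and> E \<notin> ?B" by (simp only: subset_eq Ball_def not_all not_imp)
  then obtain E where "E \<in> ?A \<and> E \<notin> ?B" ..
  note E = conjunct1[OF this] conjunct2[OF this]
  have "ls \<zeta> E" if "\<zeta> \<in> N" for \<zeta>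
  proof (rule not_ls)
    show "\<not> ls E \<zeta>" "E \<noteq> \<zeta>" using E that by auto
  qed
  then show ?thesis using E by (intro exI[of _ E]) simp
qed

lemma null_empty: "null {}"
  using null_subset[OF null_singleton[OF J_empty]] by simp

text \<open>Taking the least bound makes limits of stages work: an event below it is below an
  earlier bound, hence already settled.\<close>

lemma ex_sup:
  assumes "few N" "N \<subseteq> AA"
  shows "\<exists>\<zeta>. \<zeta> \<in> AA \<and> (\<forall>n\<in>N. n = \<zeta> \<or> ls n \<zeta>) \<and> (\<forall>E\<in>AA. ls E \<zeta> \<longrightarrow> (\<exists>n\<in>N. ls E n))"
proof -
  let ?U = "{\<zeta> \<in> AA. \<forall>n\<in>N. n = \<zeta> \<or> ls n \<zeta>}"
  have "(0::nat) < 3" by simp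
  from ex_fresh[OF assms null_empty this] obtain E0 where "E0 \<in> AA \<and> col E0 = 0 \<and> E0 \<notin> {} \<and> (\<forall>\<zeta>\<in>N. ls \<zeta> E0)" ..
  then have "E0 \<in> ?U" by simp
  from wf_ls[unfolded wf_eq_minimal, rule_format, OF this]
  obtain \<zeta> where \<zeta>: "\<zeta> \<in> ?U" "\<forall>y. (y, \<zeta>) \<in> {(E, F). ls E F} \<longrightarrow> y \<notin> ?U" ..
  have "\<exists>n\<in>N. ls E n" if E: "E \<in> AA" "ls E \<zeta>" for E
  proof -
    have "E \<notin> ?U" using \<zeta>(2) E(2) by simp
    then obtain n where "n \<in> N" "\<not> (n = E \<or> ls n E)" using E(1) by auto
    then show ?thesis using not_ls[of n E] by auto
  qed
  then show ?thesis using \<zeta>(1) by (intro exI[of _ \<zeta>]) simp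
qed

section \<open>Occurring events and the messages they spell\<close>

definition events :: "'k set \<Rightarrow> 'k set set" where
  "events x = {E \<in> AA. \<not> nonst (E \<inter> x)}"

definition between :: "'k set \<Rightarrow> 'k set \<Rightarrow> 'k set \<Rightarrow> 'k set set" where
  "between x E F = {K \<in> events x. ls E K \<and> ls K F}"

definition has_type :: "'k set set \<Rightarrow> 'k \<Rightarrow> bool" where
  "has_type S j \<longleftrightarrow> (\<exists>f. bij_betw f {b. b \<prec> j} S \<and> (\<forall>a b. a \<prec> b \<longrightarrow> b \<prec> j \<longrightarrow> ls (f a) (f b)))"

text \<open>Colours 1 and 2 act as brackets. Allowing only colour 0 in between prevents an older
  opening event from pairing with a new closing one.\<close>

definition tells :: "'k set \<Rightarrow> 'k \<Rightarrow> 'k set \<Rightarrow> 'k set \<Rightarrow> bool" where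
  "tells x j E F \<longleftrightarrow> E \<in> events x \<and> F \<in> events x \<and> ls E F \<and> col E = 1 \<and> col F = 2 \<and>
     (\<forall>K\<in>between x E F. col K = 0) \<and> has_type (between x E F) j"

definition told :: "'k set \<Rightarrow> 'k set" where
  "told x = {j. \<exists>E F. tells x j E F}"

definition settled :: "'k set \<Rightarrow> 'k set \<Rightarrow> bool" where
  "settled \<zeta> D \<longleftrightarrow> (\<forall>E\<in>AA. ls E \<zeta> \<longrightarrow> nonst (E - D))"

text \<open>Occurrence below \<open>\<zeta>\<close> is determined by the trace on \<open>D\<close>,
  so extensions of the point outside \<open>D\<close> add events at \<open>\<zeta>\<close> or above
  only: the sequence of events is end-extended and told messages stay.\<close>

definition stage :: "'k set \<Rightarrow> 'k set \<Rightarrow> bool" where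
  "stage x D \<longleftrightarrow> x \<subseteq> D \<and> D \<in> J \<and> (\<exists>\<zeta>\<in>AA. (\<forall>E\<in>events x. ls E \<zeta>) \<and> settled \<zeta> D)"

lemma events_AA: "E \<in> events x \<Longrightarrow> E \<in> AA"
  unfolding events_def by simp

lemma events_mono: assumes "x \<subseteq> y" shows "events x \<subseteq> events y"
proof
  fix E assume E: "E \<in> events x"
  have "\<not> nonst (E \<inter> y)"
  proof
    assume "nonst (E \<inter> y)"
    then have "nonst (E \<inter> x)" by (rule nonst_subset) (use assms in auto)
    then show False using E unfolding events_def by simp
  qed
  then show "E \<in> events y" using E unfolding events_def by simp
qed

lemma ex_settled: "\<zeta> \<in> AA \<Longrightarrow> \<exists>D\<in>J. settled \<zeta> D"
  using null_initial[of \<zeta>] unfolding null_def settled_def by (simp add: Ball_def imp_conjL)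

lemma settled_mono: assumes "settled \<zeta> D" "D \<subseteq> D'" shows "settled \<zeta> D'"
  unfolding settled_def
proof (intro ballI impI)
  fix E assume "E \<in> AA" "ls E \<zeta>"
  then have "nonst (E - D)" using assms(1) unfolding settled_def by simp
  then show "nonst (E - D')" by (rule nonst_subset) (use assms(2) in auto)
qed

lemma events_local:
  assumes "settled \<zeta> D" "x' \<inter> D = x \<inter> D" "E \<in> AA" "ls E \<zeta>" "E \<in> events x"
  shows "E \<in> events x'"
proof -
  have "\<not> nonst (E \<inter> x')"
  proof
    assume "nonst (E \<inter> x')"
    moreover have "nonst (E - D)" using assms(1,3,4) unfolding settled_def by simp
    ultimately have "nonst ((E \<inter> x') \<union> (E - D))" by (rule nonst_Un)
    then have "nonst (E \<inter> x)" by (rule nonst_subset) (use assms(2) in auto)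
    then show False using assms(5) unfolding events_def by simp
  qed
  then show ?thesis using assms(3) unfolding events_def by simp
qed

lemma tells_transfer:
  assumes "tells x j E F" "ls F \<zeta>" "\<And>K. K \<in> AA \<Longrightarrow> ls K \<zeta> \<Longrightarrow> K \<in> events x \<longleftrightarrow> K \<in> events x'"
  shows "tells x' j E F"
proof -
  have EF: "E \<in> events x" "F \<in> events x" "ls E F" using assms(1) unfolding tells_def by simp_all
  have "between x' E F = between x E F"
  proof -
    have "K \<in> events x' \<longleftrightarrow> K \<in> events x" if "ls K F" for K
      using assms(3)[of K] ls_trans[OF that assms(2)] events_AA[of K] by auto
    then show ?thesis unfolding between_def by auto
  qed
  moreover have "F \<in> events x'" using assms(3)[OF events_AA[OF EF(2)] assms(2)] EF(2) by simp
  moreover have "E \<in> events x'"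
    using assms(3)[OF events_AA[OF EF(1)] ls_trans[OF EF(3) assms(2)]] EF(1) by simp
  ultimately show ?thesis using assms(1) unfolding tells_def by simp
qed

lemma tells_local:
  assumes "tells x j E F" "ls F \<zeta>" "settled \<zeta> D" "x' \<inter> D = x \<inter> D"
  shows "tells x' j E F"
  using assms(1,2)
proof (rule tells_transfer)
  show "K \<in> events x \<longleftrightarrow> K \<in> events x'" if "K \<in> AA" "ls K \<zeta>" for K
    using events_local[OF assms(3,4) that] events_local[OF assms(3) assms(4)[symmetric] that] by auto
qed

text \<open>Comparing the enumerations gives an increasing map from the predecessors of
  \<open>m\<close> to those of \<open>j\<close>. Increasing maps never press an element down, but
  \<open>j\<close> would go below itself.\<close>

lemma has_type_unique:
  assumes "has_type S j" "has_type S m" shows "\<not> j \<prec> m"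
proof
  assume jm: "j \<prec> m"
  from assms(1)[unfolded has_type_def] obtain f where
    f: "bij_betw f {b. b \<prec> j} S \<and> (\<forall>a b. a \<prec> b \<longrightarrow> b \<prec> j \<longrightarrow> ls (f a) (f b))" ..
  from assms(2)[unfolded has_type_def] obtain g where
    g: "bij_betw g {b. b \<prec> m} S \<and> (\<forall>a b. a \<prec> b \<longrightarrow> b \<prec> m \<longrightarrow> ls (g a) (g b))" ..
  have "\<forall>a. \<exists>b. a \<prec> m \<longrightarrow> b \<prec> j \<and> f b = g a"
  proof
    fix a
    show "\<exists>b. a \<prec> m \<longrightarrow> b \<prec> j \<and> f b = g a"
    proof (cases "a \<prec> m")
      case True
      then have "g a \<in> S" using g unfolding bij_betw_def by auto
      then have "g a \<in> f ` {b. b \<prec> j}" using f unfolding bij_betw_def by simp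
      then obtain b where "b \<prec> j" "g a = f b" by auto
      then show ?thesis by (intro exI[of _ b]) simp
    qed simp
  qed
  from choice[OF this] obtain k where k: "\<forall>a. a \<prec> m \<longrightarrow> k a \<prec> j \<and> f (k a) = g a" ..
  have mono: "k a \<prec> k b" if "a \<prec> b" "b \<prec> m" for a b
  proof (rule ccontr)
    assume n: "\<not> k a \<prec> k b"
    have am: "a \<prec> m" using lt_trans[OF that] .
    have ls: "ls (f (k a)) (f (k b))" using g k am that by simp
    have "k b \<prec> k a \<or> k b = k a" using n lt_linear[of "k a" "k b"] by auto
    then show False
    proof
      assume "k b \<prec> k a"
      moreover have "k a \<prec> j" using k am by simp
      ultimately have "ls (f (k b)) (f (k a))" using conjunct2[OF f] by blast
      then show False using ls ls_asym by simp
    next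
      assume "k b = k a"
      then show False using ls ls_irrefl by simp
    qed
  qed
  have "a \<prec> m \<longrightarrow> \<not> k a \<prec> a" for a
  proof (induction a rule: lt_induct)
    case (less a)
    show ?case
    proof (intro impI notI)
      assume a: "a \<prec> m" "k a \<prec> a"
      have km: "k a \<prec> m" using lt_trans[OF a(2,1)] .
      have "k (k a) \<prec> k a" using mono[OF a(2,1)] .
      then show False using less[OF a(2)] km by simp
    qed
  qed
  then have "\<not> k j \<prec> j" using jm by (rule mp)
  then show False using k jm by simp
qed

end

section \<open>Messages for a saturated ideal\<close>

context event_family begin

lemma told_lock:
  assumes "stage x D" "x' \<inter> D = x" shows "told x \<subseteq> told x'"
proof
  fix j assume "j \<in> told x"
  then obtain E F where t: "tells x j E F" unfolding told_def by (elim CollectE exE)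
  from assms(1) obtain \<zeta> where z: "\<forall>E\<in>events x. ls E \<zeta>" "settled \<zeta> D" and xD: "x \<subseteq> D"
    unfolding stage_def by (elim conjE bexE)
  have "F \<in> events x" using t unfolding tells_def by simp
  then have "ls F \<zeta>" using z(1) by simp
  moreover have "x' \<inter> D = x \<inter> D" using assms(2) xD by auto
  ultimately have "tells x' j E F" by (rule tells_local[OF t _ z(2)])
  then show "j \<in> told x'" unfolding told_def by (intro CollectI exI)
qed

text \<open>The new bound is the supremum of the earlier ones, so a bracketed pair in the union lies
  below an earlier bound and its message was told there. The premise \<open>big\<close> covers both
  short unions and diagonal unions of length \<kappa>.\<close>

lemma stage_union:
  fixes C :: "('k set \<times> 'k set) set"
  assumes C: "C \<subseteq> range (c :: 'k \<Rightarrow> 'k set \<times> 'k set)" and st: "\<And>p. p \<in> C \<Longrightarrow> stage (fst p) (snd p)"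
    and coh: "\<And>p q. p \<in> C \<Longrightarrow> q \<in> C \<Longrightarrow> (snd p \<subseteq> snd q \<and> fst q \<inter> snd p = fst p) \<or> (snd q \<subseteq> snd p \<and> fst p \<inter> snd q = fst q)"
    and big: "\<And>E. (\<And>p. p \<in> C \<Longrightarrow> nonst (E \<inter> fst p)) \<Longrightarrow> nonst (E \<inter> \<Union>(fst ` C))"
  shows "\<exists>\<zeta>\<in>AA. (\<forall>E\<in>events (\<Union>(fst ` C)). ls E \<zeta>) \<and> settled \<zeta> (\<Union>(snd ` C))"
    and "told (\<Union>(fst ` C)) \<subseteq> (\<Union>x\<in>fst ` C. told x)"
proof -
  let ?X = "\<Union>(fst ` C)" and ?D = "\<Union>(snd ` C)"
  have "\<forall>p\<in>C. \<exists>\<zeta>. \<zeta> \<in> AA \<and> (\<forall>E\<in>events (fst p). ls E \<zeta>) \<and> settled \<zeta> (snd p)"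
    using st unfolding stage_def Bex_def by simp
  from bchoice[OF this] obtain z where
    z: "\<forall>p\<in>C. z p \<in> AA \<and> (\<forall>E\<in>events (fst p). ls E (z p)) \<and> settled (z p) (snd p)" ..
  have "few (z ` C)" unfolding few_def by (rule exI[of _ "\<lambda>k. z (c k)"]) (use C in auto)
  moreover have "z ` C \<subseteq> AA" using z by auto
  ultimately have "\<exists>\<zeta>. \<zeta> \<in> AA \<and> (\<forall>n\<in>z ` C. n = \<zeta> \<or> ls n \<zeta>) \<and> (\<forall>E\<in>AA. ls E \<zeta> \<longrightarrow> (\<exists>n\<in>z ` C. ls E n))"
    by (rule ex_sup)
  then obtain \<zeta> where "\<zeta> \<in> AA \<and> (\<forall>n\<in>z ` C. n = \<zeta> \<or> ls n \<zeta>) \<and> (\<forall>E\<in>AA. ls E \<zeta> \<longrightarrow> (\<exists>n\<in>z ` C. ls E n))" ..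
  then have \<zeta>: "\<zeta> \<in> AA" "\<And>p. p \<in> C \<Longrightarrow> z p = \<zeta> \<or> ls (z p) \<zeta>"
    "\<And>E. E \<in> AA \<Longrightarrow> ls E \<zeta> \<Longrightarrow> \<exists>p\<in>C. ls E (z p)" by simp_all
  have below: "ls E \<zeta>" if E: "E \<in> events ?X" for E
  proof (rule ccontr)
    assume n: "\<not> ls E \<zeta>"
    have "nonst (E \<inter> fst p)" if p: "p \<in> C" for p
    proof (rule ccontr)
      assume "\<not> nonst (E \<inter> fst p)"
      then have "E \<in> events (fst p)" using events_AA[OF E] unfolding events_def by simp
      then have *: "ls E (z p)" using z p by simp
      from \<zeta>(2)[OF p] show False
      proof
        assume "z p = \<zeta>" then show False using * n by simp
      next
        assume "ls (z p) \<zeta>" then show False using ls_trans[OF *] n by simp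
      qed
    qed
    then have "nonst (E \<inter> ?X)" by (rule big)
    then show False using E unfolding events_def by simp
  qed
  moreover have "settled \<zeta> ?D" unfolding settled_def
  proof (intro ballI impI)
    fix E assume E: "E \<in> AA" "ls E \<zeta>"
    from \<zeta>(3)[OF this] obtain p where p: "p \<in> C" "ls E (z p)" by (rule bexE)
    then have "nonst (E - snd p)" using z E(1) unfolding settled_def by simp
    then show "nonst (E - ?D)" by (rule nonst_subset) (use p(1) in auto)
  qed
  ultimately show "\<exists>\<zeta>\<in>AA. (\<forall>E\<in>events ?X. ls E \<zeta>) \<and> settled \<zeta> ?D" using \<zeta>(1) by (intro bexI[of _ \<zeta>]) simp_all
  show "told ?X \<subseteq> (\<Union>x\<in>fst ` C. told x)"
  proof
    fix j assume "j \<in> told ?X"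
    then obtain E F where t: "tells ?X j E F" unfolding told_def by (elim CollectE exE)
    then have F: "F \<in> events ?X" unfolding tells_def by simp
    from \<zeta>(3)[OF events_AA[OF F] below[OF F]] obtain p where p: "p \<in> C" "ls F (z p)" by (rule bexE)
    have "fst p \<inter> snd p = ?X \<inter> snd p"
    proof -
      have "fst q \<inter> snd p \<subseteq> fst p" if q: "q \<in> C" for q
        using coh[OF p(1) q]
      proof
        assume "snd q \<subseteq> snd p \<and> fst p \<inter> snd q = fst q" then show ?thesis by auto
      qed simp
      then show ?thesis using p(1) by auto
    qed
    moreover have "settled (z p) (snd p)" using z p(1) by simp
    ultimately have "tells (fst p) j E F" using tells_local[OF t p(2)] by simp
    then have "j \<in> told (fst p)" unfolding told_def by (intro CollectI exI)
    then show "j \<in> (\<Union>x\<in>fst ` C. told x)" by (rule UN_I[OF imageI[OF p(1)]])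
  qed
qed

lemma ex_chain:
  assumes "F \<in> AA" "null Z"
  shows "\<exists>g. \<forall>a. g a \<in> AA \<and> col (g a) = 0 \<and> g a \<notin> Z \<and> ls F (g a) \<and> (\<forall>b. b \<prec> a \<longrightarrow> ls (g b) (g a))"
proof (rule dependent_wf_choice[OF wf_lt])
  fix g g' :: "'k \<Rightarrow> 'k set" and a E assume "\<And>z. (z, a) \<in> {(a, b). a \<prec> b} \<Longrightarrow> g z = g' z"
  then show "(E \<in> AA \<and> col E = 0 \<and> E \<notin> Z \<and> ls F E \<and> (\<forall>b. b \<prec> a \<longrightarrow> ls (g b) E)) =
      (E \<in> AA \<and> col E = 0 \<and> E \<notin> Z \<and> ls F E \<and> (\<forall>b. b \<prec> a \<longrightarrow> ls (g' b) E))" by simp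
next
  fix a and g :: "'k \<Rightarrow> 'k set"
  assume *: "\<And>b. (b, a) \<in> {(a, b). a \<prec> b} \<Longrightarrow>
    g b \<in> AA \<and> col (g b) = 0 \<and> g b \<notin> Z \<and> ls F (g b) \<and> (\<forall>c. c \<prec> b \<longrightarrow> ls (g c) (g b))"
  let ?N = "insert F (g ` {b. b \<prec> a})"
  have "few ?N" by (intro few_small small_insert small_image small_below)
  moreover have "?N \<subseteq> AA" using * assms(1) by auto
  moreover have "(0::nat) < 3" by simp
  ultimately have "\<exists>E. E \<in> AA \<and> col E = 0 \<and> E \<notin> Z \<and> (\<forall>\<zeta>\<in>?N. ls \<zeta> E)"
    by (rule ex_fresh[OF _ _ assms(2)])
  then show "\<exists>E. E \<in> AA \<and> col E = 0 \<and> E \<notin> Z \<and> ls F E \<and> (\<forall>b. b \<prec> a \<longrightarrow> ls (g b) E)" by simp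
qed

text \<open>Above the settled bound there is room for an opening event, a chain of type
  \<open>m\<close> and a closing event, none covered by \<open>D\<close>; the parts outside
  \<open>D\<close> are added to the point.\<close>

lemma stage_add:
  assumes st: "stage x D"
  shows "\<exists>x' D'. stage x' D' \<and> D \<subseteq> D' \<and> x' \<inter> D = x \<and> told x' = insert m (told x)"
proof -
  from st obtain \<zeta> where xD: "x \<subseteq> D" "D \<in> J" and \<zeta>: "\<zeta> \<in> AA" "\<forall>E\<in>events x. ls E \<zeta>" "settled \<zeta> D"
    unfolding stage_def by (elim conjE bexE)
  define Z where "Z = {E \<in> AA. nonst (E - D)}"
  have Z: "null Z" unfolding null_def Z_def using xD(2) by (intro bexI[of _ D]) simp_all
  have fresh: "\<exists>E. E \<in> AA \<and> col E = c \<and> E \<notin> Z \<and> (\<forall>n\<in>N. ls n E)" if "small r N" "N \<subseteq> AA" "c < 3" for N c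
    by (rule ex_fresh[OF few_small[OF that(1)] that(2) Z that(3)])
  have "small r {\<zeta>}" "{\<zeta>} \<subseteq> AA" "(1::nat) < 3" using small_finite[of "{\<zeta>}"] \<zeta>(1) by simp_all
  from fresh[OF this] obtain A where A: "A \<in> AA \<and> col A = 1 \<and> A \<notin> Z \<and> (\<forall>n\<in>{\<zeta>}. ls n A)" ..
  then have "A \<in> AA" by simp
  from ex_chain[OF this Z] obtain g where
    g: "\<forall>a. g a \<in> AA \<and> col (g a) = 0 \<and> g a \<notin> Z \<and> ls A (g a) \<and> (\<forall>b. b \<prec> a \<longrightarrow> ls (g b) (g a))" ..
  define M where "M = g ` {a. a \<prec> m}"
  have M: "K \<in> AA \<and> col K = 0 \<and> K \<notin> Z \<and> ls A K" if "K \<in> M" for K using that g unfolding M_def by auto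
  have smM: "small r M" unfolding M_def by (intro small_image small_below)
  have "small r (insert A M)" "insert A M \<subseteq> AA" "(2::nat) < 3"
    using small_insert[OF smM] A M by auto
  from fresh[OF this] obtain B where B: "B \<in> AA \<and> col B = 2 \<and> B \<notin> Z \<and> (\<forall>n\<in>insert A M. ls n B)" ..
  have "small r {B}" "{B} \<subseteq> AA" "(0::nat) < 3" using small_finite[of "{B}"] B by simp_all
  from fresh[OF this] obtain \<zeta>' where \<zeta>': "\<zeta>' \<in> AA \<and> col \<zeta>' = 0 \<and> \<zeta>' \<notin> Z \<and> (\<forall>n\<in>{B}. ls n \<zeta>')" ..
  then have "\<zeta>' \<in> AA" by simp
  from ex_settled[OF this] obtain D1 where D1: "D1 \<in> J" "settled \<zeta>' D1" by (rule bexE)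
  define N where "N = insert B (insert A M)"
  have N: "K \<in> AA" "K \<notin> Z" "ls \<zeta> K" "ls K \<zeta>'" if "K \<in> N" for K
  proof -
    have cases: "K = B \<or> K = A \<or> K \<in> M" using that unfolding N_def by simp
    show "K \<in> AA" "K \<notin> Z" using cases A B M[of K] by auto
    have zA: "ls \<zeta> A" and AB: "ls A B" and Bz: "ls B \<zeta>'" using A B \<zeta>' by simp_all
    have "ls A K" if "K \<in> M" using M[OF that] by simp
    moreover have "ls K B" if "K \<in> M" using B that by simp
    ultimately show "ls \<zeta> K" "ls K \<zeta>'"
      using cases zA ls_trans[OF zA AB] ls_trans[OF zA, of K] Bz ls_trans[OF AB Bz] ls_trans[OF _ Bz, of K] by auto
  qed
  have smN: "small r N" unfolding N_def by (intro small_insert smM)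
  define x' where "x' = x \<union> (\<Union>K\<in>N. K - D)"
  define D' where "D' = D \<union> \<Union>N \<union> D1"
  have x'D: "x' \<inter> D = x" unfolding x'_def using xD(1) by auto
  have NJ: "N \<subseteq> J" using N(1) AA_J by auto
  \<comment> \<open>Few almost disjoint events are added, so no other event comes to occur by
    accident.\<close>
  have ev: "events x' = events x \<union> N"
  proof (intro equalityI subsetI)
    fix E assume E: "E \<in> events x'"
    show "E \<in> events x \<union> N"
    proof (rule ccontr)
      assume n: "E \<notin> events x \<union> N"
      then have "nonst (E \<inter> x)" using events_AA[OF E] unfolding events_def by simp
      moreover have "nonst (\<Union>K\<in>N. E \<inter> K)"
      proof (rule nonst_UN[OF smN])
        fix K assume "K \<in> N"
        then show "nonst (E \<inter> K)" using n by (intro AA_disj events_AA[OF E] N(1)) auto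
      qed
      ultimately have "nonst (E \<inter> x \<union> (\<Union>K\<in>N. E \<inter> K))" by (rule nonst_Un)
      then have "nonst (E \<inter> x')" by (rule nonst_subset) (auto simp: x'_def)
      then show False using E unfolding events_def by simp
    qed
  next
    fix E assume "E \<in> events x \<union> N"
    then show "E \<in> events x'"
    proof
      assume "E \<in> events x"
      then show ?thesis using events_mono[of x x'] unfolding x'_def by auto
    next
      assume E: "E \<in> N"
      have "\<not> nonst (E \<inter> x')"
      proof
        assume "nonst (E \<inter> x')"
        then have "nonst (E - D)" by (rule nonst_subset) (use E in \<open>auto simp: x'_def\<close>)
        then show False using N(1,2)[OF E] unfolding Z_def by simp
      qed
      then show ?thesis using N(1)[OF E] unfolding events_def by simp
    qed
  qed
  have z\<zeta>': "ls \<zeta> \<zeta>'"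
  proof -
    have "A \<in> N" unfolding N_def by simp
    then show ?thesis using N(3,4) ls_trans by blast
  qed
  have "stage x' D'" unfolding stage_def
  proof (intro conjI bexI[of _ \<zeta>'] ballI)
    show "x' \<subseteq> D'" unfolding x'_def D'_def using xD(1) by auto
    show "D' \<in> J" unfolding D'_def using J_Union[OF smN NJ] xD(2) D1(1) by (intro J_Un)
    show "settled \<zeta>' D'" by (rule settled_mono[OF D1(2)]) (simp add: D'_def)
    show "\<zeta>' \<in> AA" using \<zeta>' by simp
    fix E assume "E \<in> events x'"
    then show "ls E \<zeta>'" using N(4)[of E] \<zeta>(2) ls_trans[OF _ z\<zeta>', of E] unfolding ev by auto
  qed
  moreover have "D \<subseteq> D'" unfolding D'_def by auto
  moreover have "told x' = insert m (told x)"
  proof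
    have agree: "K \<in> events x \<longleftrightarrow> K \<in> events x'" if "ls K \<zeta>" for K
      using N(3)[of K] ls_asym[OF that] unfolding ev by auto
    have btw: "between x' A B = M"
    proof (intro equalityI subsetI)
      fix K assume "K \<in> between x' A B"
      then have K: "K \<in> events x \<union> N" "ls A K" "ls K B" unfolding between_def ev by simp_all
      have "K \<noteq> A" "K \<noteq> B" using K(2,3) ls_irrefl by auto
      moreover have "K \<notin> events x"
      proof
        assume "K \<in> events x"
        then have "ls K \<zeta>" using \<zeta>(2) by simp
        moreover have "ls \<zeta> A" using A by simp
        ultimately have "ls K A" by (rule ls_trans)
        then show False using ls_asym[OF K(2)] by simp
      qed
      ultimately show "K \<in> M" using K(1) unfolding N_def by simp
    next
      fix K assume K: "K \<in> M"
      then show "K \<in> between x' A B" using M[OF K] B unfolding between_def ev N_def by simp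
    qed
    have type: "has_type M m" unfolding has_type_def
    proof (intro exI[of _ g] conjI allI impI)
      have "inj_on g {b. b \<prec> m}"
      proof (rule inj_onI, rule ccontr)
        fix a b assume eq: "g a = g b" and "a \<noteq> b"
        then have "a \<prec> b \<or> b \<prec> a" using lt_linear[of a b] by simp
        then have "ls (g a) (g b) \<or> ls (g b) (g a)" using g by auto
        then show False unfolding eq using ls_irrefl by simp
      qed
      then show "bij_betw g {b. b \<prec> m} M" unfolding M_def by (rule inj_on_imp_bij_betw)
      show "ls (g a) (g b)" if "a \<prec> b" for a b using g that by simp
    qed
    have "tells x' m A B"
      using A B btw type M unfolding tells_def ev N_def by simp
    then have "m \<in> told x'" unfolding told_def by (intro CollectI exI)
    moreover have "told x \<subseteq> told x'" by (rule told_lock[OF st x'D])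
    ultimately show "insert m (told x) \<subseteq> told x'" by simp
    show "told x' \<subseteq> insert m (told x)"
    proof
      fix j assume "j \<in> told x'"
      then obtain E F where t: "tells x' j E F" unfolding told_def by (elim CollectE exE)
      then have EF: "E \<in> events x \<union> N" "F \<in> events x \<union> N" "col E = 1" "col F = 2" "ls E F"
        "\<forall>K\<in>between x' E F. col K = 0" "has_type (between x' E F) j" unfolding tells_def ev by simp_all
      show "j \<in> insert m (told x)"
      proof (cases "F \<in> events x")
        case True
        then have "ls F \<zeta>" using \<zeta>(2) by simp
        then have "tells x j E F" by (rule tells_transfer[OF t]) (simp add: agree)
        then have "j \<in> told x" unfolding told_def by (intro CollectI exI)
        then show ?thesis by simp
      next
        case False
        then have "F = B" using EF(2,4) A M[of F] unfolding N_def by auto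
        \<comment> \<open>An older opening event would have \<open>A\<close>, of colour 1, between
          itself and \<open>B\<close>.\<close>
        have "E = A"
        proof (rule ccontr)
          assume "E \<noteq> A"
          then have "E \<in> events x" using EF(1,3) B M[of E] unfolding N_def by auto
          then have "ls E \<zeta>" using \<zeta>(2) by simp
          moreover have "ls \<zeta> A" using A by simp
          ultimately have "ls E A" by (rule ls_trans)
          then have "A \<in> between x' E F" using B unfolding \<open>F = B\<close> between_def ev N_def by simp
          then show False using EF(6) A by simp
        qed
        then have "has_type M j" using EF(7) btw \<open>F = B\<close> by simp
        then have "\<not> j \<prec> m" "\<not> m \<prec> j" using has_type_unique type by simp_all
        then show ?thesis using lt_linear[of j m] by simp
      qed
    qed
  qed
  ultimately show ?thesis using x'D by (intro exI[of _ x'] exI[of _ D']) simp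
qed

lemma ex_AA: "\<exists>\<zeta>. \<zeta> \<in> AA"
proof (rule ccontr)
  assume "\<not> ?thesis"
  then have "AA = {}" by auto
  then show False using not_null_col[of 0] null_empty by simp
qed

text \<open>Limit points are required to be null so that such a point, inside a settling domain, is
  a stage itself; this yields \<open>G_local\<close>.\<close>

lemma messages_told: "messages r J told stage {x \<in> J. \<exists>\<zeta>\<in>AA. \<forall>E\<in>events x. ls E \<zeta>} h"
proof
  have ev0: "events {} = {}" unfolding events_def by simp
  show "\<exists>D. stage {} D"
  proof -
    from ex_AA obtain \<zeta> where \<zeta>: "\<zeta> \<in> AA" ..
    from ex_settled[OF \<zeta>] obtain D where "D \<in> J" "settled \<zeta> D" by (rule bexE)
    then show ?thesis unfolding stage_def ev0 using \<zeta> by (intro exI[of _ D] conjI bexI[of _ \<zeta>]) simp_all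
  qed
  show "told {} = {}" unfolding told_def tells_def ev0 by simp
  show "x \<subseteq> D \<and> D \<in> J" if "stage x D" for x D using that unfolding stage_def by simp
  show "told x \<subseteq> told x'" if "stage x D" "x' \<inter> D = x" for x D x' using that by (rule told_lock)
  show "stage x (D \<union> D')" if st: "stage x D" and D': "D' \<in> J" for x D D'
  proof -
    from st obtain \<zeta> where \<zeta>: "\<zeta> \<in> AA" "\<forall>E\<in>events x. ls E \<zeta>" "settled \<zeta> D" and xD: "x \<subseteq> D" "D \<in> J"
      unfolding stage_def by (elim conjE bexE)
    have "settled \<zeta> (D \<union> D')" by (rule settled_mono[OF \<zeta>(3)]) simp
    then show ?thesis unfolding stage_def using xD \<zeta>(1,2) J_Un[OF xD(2) D'] by auto
  qed
  show "{\<xi>. h \<xi> = k} \<in> J" for k by (rule h_null)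
  show "\<exists>x' D'. stage x' D' \<and> D \<subseteq> D' \<and> x' \<inter> D = x \<and> told x' = insert m (told x)" if "stage x D" for x D m
    by (rule stage_add[OF that])
  show "stage (\<Union>(fst ` C)) (\<Union>(snd ` C)) \<and> told (\<Union>(fst ` C)) \<subseteq> (\<Union>x\<in>fst ` C. told x)"
    if C: "small r C" "C \<noteq> {}" and st: "\<And>x D. (x, D) \<in> C \<Longrightarrow> stage x D"
      and coh: "\<And>x D x' D'. (x, D) \<in> C \<Longrightarrow> (x', D') \<in> C \<Longrightarrow>
           (D \<subseteq> D' \<and> x' \<inter> D = x) \<or> (D' \<subseteq> D \<and> x \<inter> D' = x')" for C :: "('k set \<times> 'k set) set"
  proof -
    have "|C| \<le>o r" using C(1) unfolding small_def by (rule ordLess_imp_ordLeq)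
    then have "|C| \<le>o |UNIV :: 'k set|" by (rule ordLeq_ordIso_trans[OF _ ordIso_symmetric[OF card_UNIV_r]])
    from ex_surj_on[OF this C(2)] obtain c :: "'k \<Rightarrow> 'k set \<times> 'k set" where "range c = C" ..
    then have c: "C \<subseteq> range c" by simp
    have st': "stage (fst p) (snd p)" if "p \<in> C" for p using st[of "fst p" "snd p"] that by simp
    have coh': "(snd p \<subseteq> snd q \<and> fst q \<inter> snd p = fst p) \<or> (snd q \<subseteq> snd p \<and> fst p \<inter> snd q = fst q)"
      if "p \<in> C" "q \<in> C" for p q using coh[of "fst p" "snd p" "fst q" "snd q"] that by simp
    have big: "nonst (E \<inter> \<Union>(fst ` C))" if "\<And>p. p \<in> C \<Longrightarrow> nonst (E \<inter> fst p)" for E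
    proof (rule nonst_subset)
      show "nonst (\<Union>p\<in>C. E \<inter> fst p)" by (rule nonst_UN[OF C(1) that])
    qed auto
    note U = stage_union[OF c st' coh' big]
    have dom: "fst p \<subseteq> snd p" "snd p \<in> J" if "p \<in> C" for p using st'[OF that] unfolding stage_def by simp_all
    have "\<Union>(snd ` C) \<in> J" by (rule J_Union[OF small_image[OF C(1)]]) (use dom(2) in auto)
    moreover have "\<Union>(fst ` C) \<subseteq> \<Union>(snd ` C)" using dom(1) by fastforce
    ultimately have "stage (\<Union>(fst ` C)) (\<Union>(snd ` C))" using U(1) unfolding stage_def by simp
    then show ?thesis using U(2) by simp
  qed
  show "(\<Union>k. X k) \<in> {x \<in> J. \<exists>\<zeta>\<in>AA. \<forall>E\<in>events x. ls E \<zeta>} \<and> told (\<Union>k. X k) \<subseteq> (\<Union>k. told (X k))"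
    if st: "\<And>k. stage (X k) (Y k)" and coh: "\<And>j k. j \<prec> k \<Longrightarrow> Y j \<subseteq> Y k \<and> X k \<inter> Y j = X j"
      and early: "\<And>\<xi> k. \<xi> \<in> X k \<Longrightarrow> (\<forall>j. \<not> j \<prec> h \<xi>) \<or> (\<exists>j. j \<prec> h \<xi> \<and> \<xi> \<in> X j)"
    for X Y :: "'k \<Rightarrow> 'k set"
  proof -
    let ?C = "range (\<lambda>k. (X k, Y k))"
    have dom: "X k \<subseteq> Y k" "Y k \<in> J" for k using st[of k] unfolding stage_def by simp_all
    \<comment> \<open>Points entered before the stage given by \<open>h\<close>, so the union is
      diagonal: it is null, and no event occurs in it that occurs at no stage.\<close>
    have diag: "(\<Union>k. X k) \<subseteq> {\<xi>. \<forall>j. \<not> j \<prec> h \<xi>} \<union> {\<xi>. \<exists>i. i \<prec> h \<xi> \<and> \<xi> \<in> X i}"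
      using early by auto
    have fC: "\<Union>(fst ` ?C) = (\<Union>k. X k)" "(\<Union>x\<in>fst ` ?C. told x) = (\<Union>k. told (X k))"
      by (simp_all add: image_image)
    have st': "stage (fst p) (snd p)" if "p \<in> ?C" for p using that st by auto
    have coh': "(snd p \<subseteq> snd q \<and> fst q \<inter> snd p = fst p) \<or> (snd q \<subseteq> snd p \<and> fst p \<inter> snd q = fst q)"
      if pq: "p \<in> ?C" "q \<in> ?C" for p q
    proof -
      obtain i j where ij: "p = (X i, Y i)" "q = (X j, Y j)" using pq by auto
      show ?thesis using lt_linear[of i j]
      proof (elim disjE)
        assume "i \<prec> j" then show ?thesis using coh[of i j] unfolding ij by simp
      next
        assume "i = j" then show ?thesis using dom(1)[of j] unfolding ij by auto
      next
        assume "j \<prec> i" then show ?thesis using coh[of j i] unfolding ij by simp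
      qed
    qed
    have big: "nonst (E \<inter> \<Union>(fst ` ?C))" if n: "\<And>p. p \<in> ?C \<Longrightarrow> nonst (E \<inter> fst p)" for E
    proof (rule nonst_subset)
      have "nonst (E \<inter> X i)" for i using n[of "(X i, Y i)"] by simp
      then show "nonst ({\<xi>. \<forall>j. \<not> j \<prec> h \<xi>} \<union> {\<xi>. \<exists>i. i \<prec> h \<xi> \<and> \<xi> \<in> E \<inter> X i})"
        by (intro nonst_Un nonst_zero nonst_diagonal)
      show "E \<inter> \<Union>(fst ` ?C) \<subseteq> {\<xi>. \<forall>j. \<not> j \<prec> h \<xi>} \<union> {\<xi>. \<exists>i. i \<prec> h \<xi> \<and> \<xi> \<in> E \<inter> X i}"
        unfolding fC using diag by auto
    qed
    note U = stage_union[OF subset_refl st' coh' big]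
    have "X i \<in> J" for i by (rule J_subset[OF dom(2) dom(1)])
    then have "{\<xi>. \<forall>j. \<not> j \<prec> h \<xi>} \<union> {\<xi>. \<exists>i. i \<prec> h \<xi> \<and> \<xi> \<in> X i} \<in> J"
      by (intro J_Un zero_null diagonal_null)
    then have "(\<Union>k. X k) \<in> J" using diag by (rule J_subset)
    then show ?thesis using U unfolding fC by auto
  qed
  show "\<exists>D'. D \<subseteq> D' \<and> stage (x \<inter> D') D' \<and> told (x \<inter> D') \<subseteq> told x"
    if x: "x \<in> {x \<in> J. \<exists>\<zeta>\<in>AA. \<forall>E\<in>events x. ls E \<zeta>}" and D: "D \<in> J" for x D
  proof -
    from x obtain \<zeta> where \<zeta>: "\<zeta> \<in> AA" "\<forall>E\<in>events x. ls E \<zeta>" and xJ: "x \<in> J" by (elim CollectE conjE bexE)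
    from ex_settled[OF \<zeta>(1)] obtain D1 where D1: "D1 \<in> J" "settled \<zeta> D1" by (rule bexE)
    let ?D = "D \<union> x \<union> D1"
    have x': "x \<inter> ?D = x" by auto
    have "?D \<in> J" by (intro J_Un D xJ D1(1))
    moreover have "settled \<zeta> ?D" by (rule settled_mono[OF D1(2)]) simp
    ultimately have "stage x ?D" unfolding stage_def using \<zeta> by auto
    then show ?thesis using x' by (intro exI[of _ ?D]) auto
  qed
qed

end

section \<open>Restriction to a positive set carrying an incompressible function\<close>

lemma (in saturated_ideal) saturated_strict:
  assumes a: "ord_pos (cardSuc r) a"
  shows "hierarchy_strict r J a"
proof -
  from ex_incompressible obtain A h where Ah: "A \<notin> J" "\<forall>k. {\<xi>. h \<xi> = k} \<in> J"
    "\<forall>E g. E \<subseteq> A \<longrightarrow> E \<notin> J \<longrightarrow> (\<forall>\<xi>\<in>E. g \<xi> \<prec> h \<xi>) \<longrightarrow> (\<exists>k. {\<xi> \<in> E. g \<xi> = k} \<notin> J)"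
    by (elim exE conjE)
  have "\<exists>z. True \<and> (\<forall>b. b \<prec> z \<longrightarrow> \<not> True)" by (rule lt_least[of "\<lambda>_. True"]) simp
  then obtain z where z: "\<forall>b. \<not> b \<prec> z" by auto
  \<comment> \<open>The least value outside A makes the complement of A nonstationary, so that only
    the part of a set inside A matters.\<close>
  define h' where "h' \<xi> = (if \<xi> \<in> A then h \<xi> else z)" for \<xi>
  \<comment> \<open>Declaring the complement of \<open>A\<close> null turns incompressibility on
    \<open>A\<close> into normality everywhere.\<close>
  define K where "K = {D. D \<inter> A \<in> J}"
  have JK: "J \<subseteq> K" unfolding K_def using J_subset by auto
  interpret K: normal_ideal r K h'
  proof
    show "B \<in> K" if "C \<in> K" "B \<subseteq> C" for B C
      using that J_subset[of "C \<inter> A" "B \<inter> A"] unfolding K_def by auto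
    show "\<Union>X \<in> K" if X: "small r X" "X \<subseteq> K" for X
    proof -
      have "(\<Union>B\<in>X. B \<inter> A) \<in> J" by (rule J_UN[OF X(1)]) (use X(2) in \<open>auto simp: K_def\<close>)
      moreover have "\<Union>X \<inter> A = (\<Union>B\<in>X. B \<inter> A)" by auto
      ultimately have "\<Union>X \<inter> A \<in> J" by (simp only:)
      then show ?thesis unfolding K_def by (rule CollectI)
    qed
    show "UNIV \<notin> K" unfolding K_def using Ah(1) by simp
    show "{k} \<in> K" for k using JK J_singleton by auto
    show "\<nexists>B :: 'k \<Rightarrow> 'k set. (\<forall>j. B j \<notin> K) \<and> (\<forall>i j. i \<noteq> j \<longrightarrow> B i \<inter> B j = {})"
    proof
      assume "\<exists>B :: 'k \<Rightarrow> 'k set. (\<forall>j. B j \<notin> K) \<and> (\<forall>i j. i \<noteq> j \<longrightarrow> B i \<inter> B j = {})"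
      then obtain B :: "'k \<Rightarrow> 'k set" where B: "(\<forall>j. B j \<notin> K) \<and> (\<forall>i j. i \<noteq> j \<longrightarrow> B i \<inter> B j = {})" ..
      have "B j \<notin> J" for j using conjunct1[OF B] JK by auto
      then have "\<exists>B :: 'k \<Rightarrow> 'k set. (\<forall>j. B j \<notin> J) \<and> (\<forall>i j. i \<noteq> j \<longrightarrow> B i \<inter> B j = {})"
        using conjunct2[OF B] by (intro exI[of _ B]) simp
      then show False using saturated by (rule notE[rotated])
    qed
    show "{\<xi>. h' \<xi> = k} \<in> K" for k
    proof -
      have "{\<xi>. h' \<xi> = k} \<inter> A \<subseteq> {\<xi>. h \<xi> = k}" unfolding h'_def by auto
      then show ?thesis unfolding K_def using J_subset[OF Ah(2)[rule_format, of k]] by simp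
    qed
    show "\<exists>k. {\<xi> \<in> E. g \<xi> = k} \<notin> K" if E: "E \<notin> K" "\<And>\<xi>. \<xi> \<in> E \<Longrightarrow> g \<xi> \<prec> h' \<xi>" for E g
    proof -
      have "g \<xi> \<prec> h \<xi>" if "\<xi> \<in> E \<inter> A" for \<xi> using E(2)[of \<xi>] that unfolding h'_def by simp
      then have reg: "\<forall>\<xi>\<in>E \<inter> A. g \<xi> \<prec> h \<xi>" by (rule ballI)
      have pos: "E \<inter> A \<notin> J" using E(1) unfolding K_def by simp
      have "\<exists>k. {\<xi> \<in> E \<inter> A. g \<xi> = k} \<notin> J"
        by (rule Ah(3)[THEN spec, THEN spec, THEN mp, THEN mp, THEN mp, OF Int_lower2 pos reg])
      then obtain k where "{\<xi> \<in> E \<inter> A. g \<xi> = k} \<notin> J" ..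
      moreover have "{\<xi> \<in> E. g \<xi> = k} \<inter> A = {\<xi> \<in> E \<inter> A. g \<xi> = k}" by auto
      ultimately show ?thesis unfolding K_def by (intro exI[of _ k]) simp
    qed
  qed
  obtain AA ls col where "event_family r K h' AA ls col" using K.ex_event_family by (elim exE)
  then interpret F: event_family r K h' AA ls col .
  have nonA: "K.nonst (- A)"
    by (rule K.nonst_subset[OF K.nonst_zero]) (use z in \<open>auto simp: h'_def\<close>)
  show ?thesis
  proof (rule messages_strict[OF a ideal_on_axioms F.messages_told JK])
    fix j
    show "open_in J {X. j \<in> F.told X}" unfolding open_in_def
    proof
      fix X assume "X \<in> {X. j \<in> F.told X}"
      then obtain E G where t: "F.tells X j E G" unfolding F.told_def by (elim CollectE exE)
      then have "G \<in> AA" unfolding F.tells_def by (elim conjE F.events_AA)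
      then have "F.few {G}" "{G} \<subseteq> AA" "(0::nat) < 3" using F.few_small small_finite[of "{G}"] by simp_all
      from F.ex_fresh[OF this(1,2) F.null_empty this(3)]
      obtain \<zeta> where \<zeta>: "\<zeta> \<in> AA \<and> col \<zeta> = 0 \<and> \<zeta> \<notin> {} \<and> (\<forall>n\<in>{G}. ls n \<zeta>)" ..
      then have "\<zeta> \<in> AA" "ls G \<zeta>" by simp_all
      from F.ex_settled[OF this(1)] obtain D where D: "D \<in> K" "F.settled \<zeta> D" by (rule bexE)
      \<comment> \<open>The settling set lies only in \<open>K\<close>. Cutting it down to
        \<open>A\<close> puts it into \<open>J\<close> and costs a nonstationary set, so messages
        are open for the original ideal.\<close>
      have "F.settled \<zeta> (D \<inter> A)" unfolding F.settled_def
      proof (intro ballI impI)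
        fix H assume "H \<in> AA" "ls H \<zeta>"
        then have "K.nonst (H - D)" using D(2) unfolding F.settled_def by simp
        then have "K.nonst ((H - D) \<union> - A)" by (rule K.nonst_Un[OF _ nonA])
        then show "K.nonst (H - D \<inter> A)" by (rule K.nonst_subset) auto
      qed
      then have "F.tells X' j E G" if "X' \<inter> (D \<inter> A) = X \<inter> (D \<inter> A)" for X'
        using F.tells_local[OF t \<open>ls G \<zeta>\<close>] that by simp
      then have "\<forall>X'. X' \<inter> (D \<inter> A) = X \<inter> (D \<inter> A) \<longrightarrow> X' \<in> {X. j \<in> F.told X}"
        unfolding F.told_def by auto
      moreover have "D \<inter> A \<in> J" using D(1) unfolding K_def by simp
      ultimately show "\<exists>D\<in>J. \<forall>X'. X' \<inter> D = X \<inter> D \<longrightarrow> X' \<in> {X. j \<in> F.told X}" by (rule bexI)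
    qed
  qed
qed

section \<open>The case distinction on saturation and the conclusion\<close>

lemma (in ideal_on) ideal_strict:
  assumes a: "ord_pos (cardSuc r) a"
  shows "hierarchy_strict r J a"
proof (cases "\<exists>B :: 'k \<Rightarrow> 'k set. (\<forall>j. B j \<notin> J) \<and> (\<forall>i j. i \<noteq> j \<longrightarrow> B i \<inter> B j = {})")
  case True
  then obtain B :: "'k \<Rightarrow> 'k set" where B: "(\<forall>j. B j \<notin> J) \<and> (\<forall>i j. i \<noteq> j \<longrightarrow> B i \<inter> B j = {})" ..
  show ?thesis by (rule positive_family_strict[OF a, of B]) (use B in simp_all)
next
  case False
  then have "saturated_ideal r J" by unfold_locales
  then show ?thesis by (rule saturated_ideal.saturated_strict[OF _ a])
qed

theorem theorem4p9:
  fixes r :: "'k rel" and I :: "'k set set"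
  assumes "Card_order r" and "Field r = UNIV" and "regularCard r"
    and "uncountable (UNIV :: 'k set)"
    and "proper_ideal_on I" and "kappa_complete r I"
    and "\<And>A. bounded_in r A \<Longrightarrow> A \<in> I"
  shows "\<forall>a. ord_pos (cardSuc r) a \<longrightarrow>
           {A :: ('k \<Rightarrow> bool) set. I_Sigma I (cardSuc r) a A} \<noteq> {A. I_Borel I A}
         \<and> {A :: ('k \<Rightarrow> 'k) set. I_Sigma I (cardSuc r) a A} \<noteq> {A. I_Borel I A}"
proof -
  have "ideal_on r I"
  proof
    show "Card_order r" "Field r = UNIV" "regularCard r" "uncountable (UNIV :: 'k set)" by fact+
    show "B \<in> I" if "A \<in> I" "B \<subseteq> A" for A B using that assms(5) unfolding proper_ideal_on_def by auto
    show "\<Union>X \<in> I" if "small r X" "X \<subseteq> I" for X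
      using that assms(6) unfolding kappa_complete_def small_def by simp
    show "UNIV \<notin> I" using assms(5) unfolding proper_ideal_on_def by simp
    show "{k} \<in> I" for k
    proof (rule assms(7))
      have "Refl r" using assms(1)
        unfolding card_order_on_def well_order_on_def linear_order_on_def partial_order_on_def preorder_on_def by simp
      then have "(k, k) \<in> r" using assms(2) unfolding refl_on_def by simp
      then show "bounded_in r {k}" unfolding bounded_in_def under_def by auto
    qed
  qed
  then show ?thesis using ideal_on.ideal_strict unfolding hierarchy_strict_def by blast
qed

end
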